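(* Let $q=\rho/\sigma\in\mathbb{Q}$ with $\rho,\sigma$ nonzero integers and $|q|>1$, and let $\alpha,\lambda\in\mathbb{C}$ satisfy $\alpha\ne 0$, $\lambda\notin q^{\mathbb{Z}_{>0}}$ and $\alpha\notin-\lambda q^{\mathbb{Z}_{>0}}$. Suppose that $$ \gamma=\frac{\log|\rho|}{\log|\sigma|}>\begin{cases} \dfrac{126\pi^2}{47\pi^2-72\sqrt3\,\operatorname{Im}\operatorname{Li}_2(e^{2\pi\sqrt{-1}/3})}=3.27694460\dots & \text{if }\lambda=0,\\[2mm] \dfrac{27\pi^2}{5\pi^2-18\sqrt3\,\operatorname{Im}\operatorname{Li}_2(e^{2\pi\sqrt{-1}/3})}=9.43194241\dots & \text{if }\lambda\ne0. \end{cases} $$ Then the three numbers $\alpha$, $\lambda$ and $\mu=F_q(\alpha;\lambda)$ cannot all belong to a (common) quadratic extension of $\mathbb{Q}$. In particular, if $\alpha$ and $\lambda$ are rational, then $F_q(\alpha;\lambda)$ is neither rational nor quadratic (i.e. it is not an algebraic number of degree $1$ or $2$ over $\mathbb{Q}$).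
   Context: For $|q|>1$ and $\lambda\notin q^{\mathbb{Z}_{>0}}$, $F_q(z;\lambda)$ denotes the entire function $$F_q(z;\lambda)=\sum_{n=0}^\infty\frac{z^n}{\prod_{j=1}^n(q^j-\lambda)}.$$ Here $q^{\mathbb{Z}_{>0}}=\{q^k:k\in\mathbb{Z},\,k>0\}$ and $-\lambda q^{\mathbb{Z}_{>0}}=\{-\lambda q^k: k\in\mathbb{Z},\,k>0\}$. $\operatorname{Li}_2(z)=\sum_{n\ge1}z^n/n^2$ (for $|z|\le1$) is the dilogarithm. Convention: $\gamma=+\infty$ if $q\in\mathbb{Z}$. A quadratic extension of $\mathbb{Q}$ is a subfield of $\mathbb{C}$ of degree $2$ over $\mathbb{Q}$. *)

theory Defs
  imports
    "HOL-Analysis.Analysis"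
    "HOL-Computational_Algebra.Computational_Algebra"
    "HOL-Library.Extended_Real"
    "HOL-Algebra.Algebraic_Closure_Type"
begin

text \<open>
  The dilogarithm series. It converges absolutely for \<open>norm z \<le> 1\<close>; outside the closed
  unit disc the value is unspecified.
\<close>
definition Li2 :: "complex \<Rightarrow> complex" where
  "Li2 z = (\<Sum>n. z ^ Suc n / of_nat (Suc n) ^ 2)"

text \<open>
  The series has no vanishing denominator and converges for every \<open>z\<close> when \<open>norm q > 1\<close>
  and \<open>l\<close> is not in \<open>pos_powers q\<close>.
\<close>
definition F :: "complex \<Rightarrow> complex \<Rightarrow> complex \<Rightarrow> complex" where
  "F q z l = (\<Sum>n. z ^ n / (\<Prod>j = 1..n. (q ^ j - l)))"

definition pos_powers :: "complex \<Rightarrow> complex set" where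
  "pos_powers q = {q powi k | k :: int. k > 0}"

text \<open>
  The exponent is infinite whenever the quotient is an integer, even if the fraction is not given
  in lowest terms. Otherwise the absolute value of the denominator is at least 2, so the
  logarithm in the denominator is positive.
\<close>
definition log_ratio :: "int \<Rightarrow> int \<Rightarrow> ereal" where
  "log_ratio r s =
     (if (of_int r / of_int s :: complex) \<in> \<int> then \<infinity>
      else ereal (ln \<bar>real_of_int r\<bar> / ln \<bar>real_of_int s\<bar>))"

text \<open>Subfields of the complex numbers that have dimension 2 over the rationals.\<close>
definition quadratic_extension :: "complex set \<Rightarrow> bool" where
  "quadratic_extension K \<longleftrightarrow>
     subfield K (ring_of_type_algebra :: complex ring) \<and>
     ring.dimension (ring_of_type_algebra :: complex ring) 2 \<rat> K"

text \<open>The monic irreducible polynomial below is the minimal polynomial of \<open>x\<close>.\<close>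
definition algebraic_of_degree :: "complex \<Rightarrow> nat \<Rightarrow> bool" where
  "algebraic_of_degree x d \<longleftrightarrow>
     (\<exists>p :: rat poly. Polynomial.lead_coeff p = 1 \<and> Factorial_Ring.irreducible p \<and>
        Polynomial.degree p = d \<and> poly (map_poly of_rat p) x = 0)"

end

theory Submission
  imports Defs "Jordan_Normal_Form.Determinant"
begin

text \<open>
  Put \<open>v 0 = \<mu>\<close> and \<open>v (n + 1) = (q ^ (n + 1) - l) * (v n - \<alpha> ^ n)\<close>. If \<open>\<mu> = F q \<alpha> l\<close>, then
  \<open>v n\<close> is the tail of the series from the index \<open>n\<close> on, multiplied by the denominator of its leading
  term, so it only grows like \<open>\<alpha> ^ n\<close>; for other values of \<open>\<mu>\<close> it grows like
  \<open>q ^ (n * (n + 1) / 2)\<close>. At the same time \<open>v n\<close> is a polynomial with integer coefficients in \<open>q\<close>,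
  \<open>\<alpha>\<close>, \<open>l\<close> and \<open>\<mu>\<close>. The proof compares the \<open>n \<times> n\<close> Hankel determinants \<open>V\<close> of this sequence (shifted by a
  fixed \<open>s\<close>) with their conjugates, regarding \<open>q\<close> as a variable \<open>X\<close> in all algebraic arguments. All
  degrees and all logarithms of sizes are given up to \<open>o(n ^ 3)\<close>, and \<open>\<delta>\<close> is \<open>1\<close> if \<open>l = 0\<close> and \<open>0\<close> otherwise.

  \<^item> At the true value of \<open>\<mu>\<close>, the tails have an expansion in powers of \<open>q ^ (- n)\<close>. Therefore \<open>V\<close> is
    the Gram determinant of the monomials for a discrete complex measure on the nodes \<open>q ^ (- k)\<close>. Newton
    polynomials for these nodes make the Gram matrix nearly diagonal. Hence \<open>V\<close> is not zero and its logarithmic size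
    is at most \<open>- (2 + \<delta>) / 6 * n ^ 3 * ln \<bar>q\<bar>\<close> (\<open>qhankel_small\<close>).

  \<^item> As a polynomial in \<open>X\<close>, the determinant has degree at most \<open>2 / 3 * n ^ 3\<close>, and the logarithmic size at \<open>q\<close> of any
    such determinant, in particular of the conjugate one, is at most \<open>2 / 3 * n ^ 3 * ln \<bar>q\<bar>\<close>
    (\<open>qhankel_growth\<close>).

  \<^item> Both determinants are divisible by an explicit product \<open>psi\<close> of a power of \<open>X\<close> and of cyclotomic
    polynomials. This comes from row and column operations with difference operators that almost annihilate the
    sequence \<open>v\<close>: modulo \<open>X\<close> and modulo \<open>X - z\<close> for a root of unity \<open>z\<close>, the recurrence (over a full period)
    degenerates to one with constant coefficients (\<open>X_power_xval_dvd_qhankel\<close>, \<open>X_power_xval0_dvd_qhankel\<close>,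
    \<open>cyclotomic_power_dvd_qhankel\<close>). The power of \<open>X\<close> has exponent \<open>n ^ 3 / 6\<close>, or \<open>5 / 24 * n ^ 3\<close> for
    \<open>l = 0\<close>. The cyclotomic part has degree \<open>E * n ^ 3\<close>, where \<open>E\<close> is the sum of \<open>1 / (\<pi> * J)\<^sup>2\<close> over
    \<open>J \<ge> 2\<close> with \<open>J mod 3 \<noteq> 1\<close>, which is where the dilogarithm enters.

  If \<open>\<alpha>\<close>, \<open>l\<close> and \<open>\<mu>\<close> lie in \<open>\<rat> + \<rat> * \<theta>\<close> with \<open>\<theta>\<^sup>2\<close> an integer, then the product of the two quotients by
  \<open>psi\<close> at \<open>q = \<rho> / \<sigma>\<close>, once cleared of denominators, is a nonzero integer, hence at least \<open>1\<close> in absolute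
  value (\<open>qhankel_product_ge\<close>). With \<open>B\<close> the coefficient of \<open>n ^ 3\<close> in the degree of \<open>psi\<close>, this means
  \<open>0 \<le> 2 * (2 / 3 - B) * ln \<bar>\<sigma>\<bar> + (2 / 3 - (2 + \<delta>) / 6 - 2 * B) * ln \<bar>q\<bar>\<close>,
  and the bound on the exponent says exactly that the right-hand side is negative.
\<close>

hide_const (open) Polynomials.degree Polynomials.lead_coeff UnivPoly.monom UnivPoly.coeff
  Module.smult Coset.order Divisibility.prime Divisibility.irreducible

section \<open>Determinants indexed by natural numbers\<close>

text \<open>Matrices whose size is a natural number and whose entries may be indexed by all natural
  numbers, so that the size can vary without changing the matrix.\<close>
definition ndet :: "nat \<Rightarrow> (nat \<Rightarrow> nat \<Rightarrow> 'a :: comm_ring_1) \<Rightarrow> 'a" where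
  "ndet n f = (\<Sum>p | p permutes {0..<n}. signof p * (\<Prod>i = 0..<n. f i (p i)))"

lemma ndet_eq_det: "ndet n f = Determinant.det (Matrix.mat n n (\<lambda>(i, j). f i j))"
proof -
  have "(\<Prod>i = 0..<n. f i (p i)) = (\<Prod>i = 0..<n. Matrix.mat n n (\<lambda>(i, j). f i j) $$ (i, p i))"
    if "p permutes {0..<n}" for p
  proof (rule prod.cong[OF refl])
    fix i assume "i \<in> {0..<n}"
    with permutes_in_image[OF that, of i] show "f i (p i) = Matrix.mat n n (\<lambda>(i, j). f i j) $$ (i, p i)"
      by auto
  qed
  then show ?thesis
    unfolding ndet_def by (subst det_def'[of _ n]) (auto intro!: sum.cong)
qed

lemma ndet_cong:
  "(\<And>i j. i < n \<Longrightarrow> j < n \<Longrightarrow> f i j = g i j) \<Longrightarrow> ndet n f = ndet n g"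
  unfolding ndet_eq_det by (rule arg_cong[where f = Determinant.det]) (auto intro!: eq_matI)

lemma ndet_unitriangular_change:
  fixes f :: "nat \<Rightarrow> nat \<Rightarrow> 'a :: comm_ring_1"
  assumes "\<And>i. i < n \<Longrightarrow> a i i = 1" "\<And>i k. k < n \<Longrightarrow> i < k \<Longrightarrow> a i k = 0"
    and "\<And>j. j < n \<Longrightarrow> b j j = 1" "\<And>j k. k < n \<Longrightarrow> j < k \<Longrightarrow> b j k = 0"
  shows "ndet n (\<lambda>i j. \<Sum>k<n. \<Sum>l<n. a i k * f k l * b j l) = ndet n f"
proof -
  let ?A = "Matrix.mat n n (\<lambda>(i, j). a i j)" and ?B = "Matrix.mat n n (\<lambda>(i, j). b i j)"
  let ?F = "Matrix.mat n n (\<lambda>(i, j). f i j)"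
  have A: "Determinant.det ?A = 1"
    by (subst det_lower_triangular[of n]) (use assms in \<open>auto simp: prod_list_diag_prod intro!: prod.neutral\<close>)
  have B: "Determinant.det ?B = 1"
    by (subst det_lower_triangular[of n]) (use assms in \<open>auto simp: prod_list_diag_prod intro!: prod.neutral\<close>)
  have "Matrix.mat n n (\<lambda>(i, j). \<Sum>k<n. \<Sum>l<n. a i k * f k l * b j l)
      = ?A * ?F * Matrix.transpose_mat ?B"
    by (rule eq_matI)
      (auto simp: scalar_prod_def sum_distrib_right lessThan_atLeast0 intro: sum.swap[THEN trans])
  moreover have "Determinant.det (?A * ?F * Matrix.transpose_mat ?B) = Determinant.det ?F"
  proof -
    have c: "?A \<in> carrier_mat n n" "?F \<in> carrier_mat n n" "?B \<in> carrier_mat n n"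
      "?A * ?F \<in> carrier_mat n n" "Matrix.transpose_mat ?B \<in> carrier_mat n n"
      by auto
    show ?thesis
      by (simp only: det_mult[OF c(4,5)] det_mult[OF c(1,2)] det_transpose[OF c(3)] A B
          mult_1_left mult_1_right)
  qed
  ultimately show ?thesis
    unfolding ndet_eq_det by simp
qed

lemma ndet_eq_0_kernel:
  fixes f :: "nat \<Rightarrow> nat \<Rightarrow> 'a :: field"
  assumes "ndet n f = 0"
  obtains c where "\<exists>j<n. c j \<noteq> 0" "\<And>i. i < n \<Longrightarrow> (\<Sum>j<n. f i j * c j) = 0"
proof -
  let ?F = "Matrix.mat n n (\<lambda>(i, j). f i j)"
  have "\<exists>v. v \<in> carrier_vec n \<and> v \<noteq> 0\<^sub>v n \<and> ?F *\<^sub>v v = 0\<^sub>v n"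
    using det_0_iff_vec_prod_zero_field[of ?F n] assms unfolding ndet_eq_det by auto
  then obtain v where v: "v \<in> carrier_vec n" "v \<noteq> 0\<^sub>v n" "?F *\<^sub>v v = 0\<^sub>v n" by blast
  show ?thesis
  proof
    show "\<exists>j<n. Matrix.vec_index v j \<noteq> 0"
      using v(1,2) by (metis carrier_vecD eq_vecI index_zero_vec(1,2))
    fix i assume i: "i < n"
    have "Matrix.vec_index (?F *\<^sub>v v) i = 0" using v(3) i by simp
    then show "(\<Sum>j<n. f i j * Matrix.vec_index v j) = 0"
      using i v(1) by (auto simp: scalar_prod_def lessThan_atLeast0)
  qed
qed

lemma ndet_smult:
  fixes f :: "nat \<Rightarrow> nat \<Rightarrow> 'a :: comm_ring_1"
  shows "ndet n (\<lambda>i j. x i * y j * f i j) = (\<Prod>i<n. x i) * (\<Prod>j<n. y j) * ndet n f"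
proof -
  have "(\<Prod>i = 0..<n. x i * y (p i) * f i (p i))
      = (\<Prod>i<n. x i) * (\<Prod>j<n. y j) * (\<Prod>i = 0..<n. f i (p i))" if "p permutes {0..<n}" for p
    using prod.permute[OF that, of y] by (simp add: prod.distrib lessThan_atLeast0 o_def)
  then show ?thesis
    unfolding ndet_def sum_distrib_left by (auto intro!: sum.cong simp: mult_ac)
qed

lemma poly_ndet: "poly (ndet n f) x = ndet n (\<lambda>i j. poly (f i j) x)"
  by (simp add: ndet_def poly_sum poly_prod sign_def if_distrib[of "\<lambda>p. poly p x"] cong: if_cong)

lemma degree_ndet_le:
  fixes f :: "nat \<Rightarrow> nat \<Rightarrow> 'a :: idom poly"
  assumes "\<And>i j. i < n \<Longrightarrow> j < n \<Longrightarrow> degree (f i j) \<le> d i + d j"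
  shows "degree (ndet n f) \<le> 2 * (\<Sum>i<n. d i)"
  unfolding ndet_def
proof (rule degree_sum_le)
  fix p assume "p \<in> {p. p permutes {0..<n}}"
  then have p: "p permutes {0..<n}" by simp
  have "degree (signof p * (\<Prod>i = 0..<n. f i (p i))) = degree (\<Prod>i = 0..<n. f i (p i))"
    by (simp add: sign_def)
  also have "\<dots> \<le> (\<Sum>i = 0..<n. degree (f i (p i)))"
    using degree_prod_sum_le[of "{0..<n}" "\<lambda>i. f i (p i)"] by (simp add: o_def)
  also have "\<dots> \<le> (\<Sum>i = 0..<n. d i + d (p i))"
    using permutes_in_image[OF p] by (intro sum_mono assms) auto
  also have "\<dots> = 2 * (\<Sum>i<n. d i)"
    using sum.permute[OF p, of d] by (simp add: sum.distrib lessThan_atLeast0 o_def mult_2)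
  finally show "degree (signof p * (\<Prod>i = 0..<n. f i (p i))) \<le> 2 * (\<Sum>i<n. d i)" .
qed (simp add: finite_permutations)

text \<open>Every term of the Leibniz expansion has valuation at least the sum of the \<open>m i (p i)\<close>.\<close>
lemma power_dvd_ndet:
  fixes f :: "nat \<Rightarrow> nat \<Rightarrow> 'a :: comm_ring_1"
  assumes "\<And>i j. i < n \<Longrightarrow> j < n \<Longrightarrow> \<pi> ^ m i j dvd f i j"
    and "\<And>p. p permutes {0..<n} \<Longrightarrow> e \<le> (\<Sum>i<n. m i (p i))"
  shows "\<pi> ^ e dvd ndet n f"
  unfolding ndet_def
proof (rule dvd_sum)
  fix p assume "p \<in> {p. p permutes {0..<n}}"
  then have p: "p permutes {0..<n}" by simp
  have "\<pi> ^ e dvd \<pi> ^ (\<Sum>i<n. m i (p i))" by (rule le_imp_power_dvd) (rule assms(2)[OF p])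
  also have "\<dots> = (\<Prod>i = 0..<n. \<pi> ^ m i (p i))" by (simp add: power_sum lessThan_atLeast0)
  also have "\<dots> dvd (\<Prod>i = 0..<n. f i (p i))"
    using permutes_in_image[OF p] by (intro prod_dvd_prod assms(1)) auto
  finally show "\<pi> ^ e dvd signof p * (\<Prod>i = 0..<n. f i (p i))" by (rule dvd_mult)
qed

lemma norm_ndet_le:
  fixes f :: "nat \<Rightarrow> nat \<Rightarrow> complex"
  assumes "\<And>i j. i < n \<Longrightarrow> j < n \<Longrightarrow> norm (f i j) \<le> d i * d j" "\<And>i. i < n \<Longrightarrow> 0 \<le> d i"
  shows "norm (ndet n f) \<le> fact n * (\<Prod>i<n. d i)\<^sup>2"
proof -
  have "norm (ndet n f) \<le> (\<Sum>p | p permutes {0..<n}. (\<Prod>i<n. d i)\<^sup>2)"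
    unfolding ndet_def
  proof (rule sum_norm_le)
    fix p assume "p \<in> {p. p permutes {0..<n}}"
    then have p: "p permutes {0..<n}" by simp
    have "norm (signof p * (\<Prod>i = 0..<n. f i (p i)) :: complex) = (\<Prod>i = 0..<n. norm (f i (p i)))"
      by (simp add: norm_mult sign_def prod_norm)
    also have "\<dots> \<le> (\<Prod>i = 0..<n. d i * d (p i))"
      using permutes_in_image[OF p] by (intro prod_mono) (auto intro!: assms(1))
    also have "\<dots> = (\<Prod>i<n. d i)\<^sup>2"
      using prod.permute[OF p, of d]
      by (simp add: prod.distrib lessThan_atLeast0 o_def power2_eq_square)
    finally show "norm (signof p * (\<Prod>i = 0..<n. f i (p i)) :: complex) \<le> (\<Prod>i<n. d i)\<^sup>2" .
  qed
  also have "\<dots> = fact n * (\<Prod>i<n. d i)\<^sup>2"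
    by (simp add: card_permutations)
  finally show ?thesis .
qed

section \<open>Hankel determinants\<close>

text \<open>The polynomial \<open>P\<close> acts on sequences, with the indeterminate acting as the shift operator.\<close>
definition act :: "'a :: comm_ring_1 poly \<Rightarrow> (nat \<Rightarrow> 'a) \<Rightarrow> nat \<Rightarrow> 'a" where
  "act P v n = (\<Sum>k\<le>degree P. coeff P k * v (n + k))"

lemma act_eq: "degree P \<le> N \<Longrightarrow> act P v n = (\<Sum>k\<le>N. coeff P k * v (n + k))"
  unfolding act_def by (rule sum.mono_neutral_left) (auto simp: coeff_eq_0)

lemma act_add_left: "act (P + Q) v n = act P v n + act Q v n"
  by (simp add: act_eq[of _ "max (degree P) (degree Q)"] degree_add_le algebra_simps sum.distrib)

lemma act_pCons: "act (pCons a P) v n = a * v n + act P v (Suc n)"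
proof -
  have "act (pCons a P) v n = (\<Sum>k\<le>Suc (degree P). coeff (pCons a P) k * v (n + k))"
    by (rule act_eq) (simp add: degree_pCons_le)
  then show ?thesis by (subst (asm) sum.atMost_Suc_shift) (simp add: act_def)
qed

lemma act_0 [simp]: "act 0 v n = 0"
  by (simp add: act_def)

lemma act_1 [simp]: "act 1 v n = v n"
  by (simp add: act_def)

lemma act_smult: "act (smult a P) v n = a * act P v n"
  by (simp add: act_eq[of _ "degree P"] degree_smult_le sum_distrib_left mult_ac)

lemma act_mult: "act (P * Q) v n = act P (act Q v) n"
  by (induction P arbitrary: n) (auto simp: act_add_left act_smult act_pCons)

lemma act_monom_mult: "act (monom 1 r * P) v n = act P v (n + r)"
proof (induction r arbitrary: n)
  case (Suc r)
  have "monom 1 (Suc r) * P = pCons 0 (monom 1 r * P)" by (simp add: monom_Suc)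
  then show ?case using Suc[of "Suc n"] by (simp add: act_pCons)
qed simp

text \<open>Read \<open>v (i + j)\<close> as \<open>L (X ^ i * X ^ j)\<close> for the functional \<open>L P = act P v 0\<close>: monic polynomials
  of degrees \<open>i\<close> and \<open>j\<close> may replace the powers by unitriangular row and column operations.\<close>
lemma hankel_ndet_change_basis:
  fixes P Q :: "nat \<Rightarrow> 'a :: comm_ring_1 poly"
  assumes P: "\<And>i. i < n \<Longrightarrow> degree (P i) = i \<and> lead_coeff (P i) = 1"
    and Q: "\<And>i. i < n \<Longrightarrow> degree (Q i) = i \<and> lead_coeff (Q i) = 1"
  shows "ndet n (\<lambda>i j. v (i + j)) = ndet n (\<lambda>i j. act (P i * Q j) v 0)"
proof -
  have "ndet n (\<lambda>i j. act (P i * Q j) v 0)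
      = ndet n (\<lambda>i j. \<Sum>k<n. \<Sum>l<n. coeff (P i) k * v (k + l) * coeff (Q j) l)"
  proof (rule ndet_cong)
    fix i j assume ij: "i < n" "j < n"
    have "act (P i * Q j) v 0 = (\<Sum>k\<le>n - 1. coeff (P i) k * act (Q j) v k)"
      unfolding act_mult by (subst act_eq[of _ "n - 1"]) (use P ij in auto)
    also have "\<dots> = (\<Sum>k\<le>n - 1. coeff (P i) k * (\<Sum>l\<le>n - 1. coeff (Q j) l * v (k + l)))"
      using Q ij by (intro sum.cong refl arg_cong2[where f = "(*)"] act_eq) auto
    also have "{..n - 1} = {..<n}" using ij by auto
    finally show "act (P i * Q j) v 0 = (\<Sum>k<n. \<Sum>l<n. coeff (P i) k * v (k + l) * coeff (Q j) l)"
      by (simp add: sum_distrib_left mult_ac)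
  qed
  also have "\<dots> = ndet n (\<lambda>i j. v (i + j))"
    using P Q by (intro ndet_unitriangular_change) (auto intro: coeff_eq_0, metis+)
  finally show ?thesis by simp
qed

section \<open>Rearrangement\<close>

lemma sum_lessThan_card_le_sum:
  fixes S :: "nat set"
  assumes "finite S"
  shows "\<Sum>{..<card S} \<le> \<Sum>S"
  using assms
proof (induction "card S" arbitrary: S)
  case (Suc k)
  define M where "M = Max S"
  have S: "S \<noteq> {}" "finite S" using Suc by auto
  then have M: "M \<in> S" "\<And>x. x \<in> S \<Longrightarrow> x \<le> M" unfolding M_def by auto
  then have "S \<subseteq> {..M}" by auto
  then have "card S \<le> Suc M" by (metis card_atMost card_mono finite_atMost)
  then have k: "k \<le> M" using Suc(2) by simp
  have "k = card (S - {M})" using Suc(2) M S by simp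
  from Suc(1)[OF this] S have "\<Sum>{..<k} \<le> \<Sum>(S - {M})" using \<open>k = _\<close> by simp
  moreover have "\<Sum>S = M + \<Sum>(S - {M})" using S M by (simp add: sum.remove)
  ultimately show ?case using k Suc(2)[symmetric] by simp
qed simp

text \<open>The permuted sum counts each increment \<open>d k\<close> with weight the sum of the \<open>n - k\<close> indices \<open>i\<close> with
  \<open>k \<le> p i\<close>; these are distinct, so their sum is smallest when they are the initial ones, as for the reversal.\<close>
lemma rearrangement_ge:
  fixes x d :: "nat \<Rightarrow> nat"
  assumes x: "\<And>j. x j = (\<Sum>k\<le>j. d k)" and p: "p permutes {0..<n}"
  shows "(\<Sum>i<n. i * x (n - 1 - i)) \<le> (\<Sum>i<n. i * x (p i))"
proof -
  define p' where "p' = inv_into UNIV p"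
  have *: "(\<Sum>i<n. i * x (r i)) = (\<Sum>k<n. d k * \<Sum>{i \<in> {..<n}. k \<le> r i})"
    if r: "\<And>i. i < n \<Longrightarrow> r i < n" for r
  proof -
    have "(\<Sum>i<n. i * x (r i)) = (\<Sum>i<n. \<Sum>k<n. if k \<le> r i then d k * i else 0)"
    proof (rule sum.cong[OF refl])
      fix i assume "i \<in> {..<n}"
      then have "{k \<in> {..<n}. k \<le> r i} = {..r i}" using r[of i] by auto
      then have "(\<Sum>k<n. if k \<le> r i then d k * i else 0) = (\<Sum>k\<le>r i. d k * i)"
        by (subst sum.inter_filter[symmetric]) simp_all
      then show "i * x (r i) = (\<Sum>k<n. if k \<le> r i then d k * i else 0)"
        unfolding x[of "r i"] by (simp add: sum_distrib_left mult.commute)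
    qed
    also have "\<dots> = (\<Sum>k<n. d k * \<Sum>{i \<in> {..<n}. k \<le> r i})"
    proof (subst sum.swap, rule sum.cong[OF refl])
      fix k
      show "(\<Sum>i<n. if k \<le> r i then d k * i else 0) = d k * \<Sum>{i \<in> {..<n}. k \<le> r i}"
        unfolding sum_distrib_left by (rule sum.inter_filter[symmetric]) simp
    qed
    finally show ?thesis .
  qed
  have pn: "p i < n" if "i < n" for i using permutes_in_image[OF p, of i] that by simp
  have "(\<Sum>i<n. i * x (n - 1 - i)) = (\<Sum>k<n. d k * \<Sum>{i \<in> {..<n}. k \<le> n - 1 - i})"
    by (rule *[of "\<lambda>i. n - 1 - i"]) simp
  also have "\<dots> \<le> (\<Sum>k<n. d k * \<Sum>{i \<in> {..<n}. k \<le> p i})"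
    proof (intro sum_mono mult_left_mono)
      fix k assume "k \<in> {..<n}"
      then have k: "k < n" by simp
      have "{i \<in> {..<n}. k \<le> n - 1 - i} = {..<n - k}" using k by auto
      moreover have "card {i \<in> {..<n}. k \<le> p i} = n - k"
      proof -
        have "{i \<in> {..<n}. k \<le> p i} = p -` {k..<n} \<inter> {..<n}" using pn by auto
        also have "\<dots> = p' ` {k..<n}"
        proof -
          have "p -` {k..<n} = p' ` {k..<n}" 
            unfolding p'_def by (rule bij_vimage_eq_inv_image) (rule permutes_bij[OF p])
          moreover have "p' ` {k..<n} \<subseteq> {..<n}"
          proof (rule image_subsetI)
            fix i assume "i \<in> {k..<n}"
            then show "p' i \<in> {..<n}"
              using permutes_in_image[OF permutes_inv[OF p], of i] unfolding p'_def by simp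
          qed
          ultimately show ?thesis by auto
        qed
        finally have "{i \<in> {..<n}. k \<le> p i} = p' ` {k..<n}" .
        moreover have "card (p' ` {k..<n}) = n - k"
          unfolding p'_def by (subst card_image)
            (simp_all add: inj_on_subset[OF permutes_inj[OF permutes_inv[OF p]]])
        ultimately show ?thesis by simp
      qed
      ultimately show "\<Sum>{i \<in> {..<n}. k \<le> n - 1 - i} \<le> \<Sum>{i \<in> {..<n}. k \<le> p i}"
        using sum_lessThan_card_le_sum[of "{i \<in> {..<n}. k \<le> p i}"] by simp
    qed simp
  also have "\<dots> = (\<Sum>i<n. i * x (p i))"
    by (rule *[of p, symmetric]) (rule pn)
  finally show ?thesis .
qed

section \<open>The polynomials\<close>

text \<open>For \<open>\<mu> = F q a l\<close> the value at \<open>q\<close> is \<open>\<Sum>m\<ge>n. a ^ m / (\<Prod>j=n+1..m. q ^ j - l)\<close>.\<close>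
primrec qtail :: "complex \<Rightarrow> complex \<Rightarrow> complex \<Rightarrow> nat \<Rightarrow> complex poly" where
  "qtail a l \<mu> 0 = [:\<mu>:]"
| "qtail a l \<mu> (Suc n) = (monom 1 (Suc n) - [:l:]) * (qtail a l \<mu> n - [:a ^ n:])"

definition qhankel :: "complex \<Rightarrow> complex \<Rightarrow> complex \<Rightarrow> nat \<Rightarrow> nat \<Rightarrow> complex poly" where
  "qhankel a l \<mu> s n = ndet n (\<lambda>i j. qtail a l \<mu> (i + j + s))"

text \<open>The degree \<open>(i + j + s) * (i + j + s + 1) / 2\<close> of an entry is not a sum of a function of \<open>i\<close> and one
  of \<open>j\<close>, because of the product \<open>i * j\<close>; the bound \<open>2 * i * j \<le> i\<^sup>2 + j\<^sup>2\<close> separates the variables.\<close>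
definition qdeg :: "nat \<Rightarrow> nat \<Rightarrow> nat" where
  "qdeg s i = i\<^sup>2 + (s + 1) * i + (s + 1)\<^sup>2"

lemma sum_upto_le_qdeg: "\<Sum>{..i + j + s} \<le> qdeg s i + qdeg s j"
proof -
  have "2 * \<Sum>{..i + j + s} = (i + j + s) * (i + j + s + 1)"
    using gauss_sum_nat[of "i + j + s"] by (simp add: atLeast0AtMost)
  also have "\<dots> \<le> 2 * (qdeg s i + qdeg s j)"
  proof -
    have "2 * (i * j) \<le> i\<^sup>2 + j\<^sup>2"
    proof -
      have "int (2 * (i * j)) \<le> int (i\<^sup>2 + j\<^sup>2)"
        using zero_le_power2[of "int i - int j"] by (simp add: power2_eq_square algebra_simps)
      then show ?thesis by (simp only: of_nat_le_iff)
    qed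
    then show ?thesis unfolding qdeg_def by (simp add: power2_eq_square algebra_simps)
  qed
  finally show ?thesis by simp
qed

lemma degree_qtail: "degree (qtail a l \<mu> n) \<le> \<Sum>{..n}"
proof (induction n)
  case (Suc n)
  have "degree (qtail a l \<mu> (Suc n)) \<le> degree (monom 1 (Suc n) - [:l:]) + degree (qtail a l \<mu> n - [:a ^ n:])"
    unfolding qtail.simps by (rule degree_mult_le)
  also have "\<dots> \<le> Suc n + \<Sum>{..n}"
    by (intro add_mono degree_diff_le) (use Suc in \<open>auto simp: degree_monom_eq\<close>)
  finally show ?case by simp
qed simp

lemma degree_qhankel: "degree (qhankel a l \<mu> s n) \<le> 2 * (\<Sum>i<n. qdeg s i)"
  unfolding qhankel_def
  by (rule degree_ndet_le) (rule order.trans[OF degree_qtail sum_upto_le_qdeg])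

lemma norm_poly_qtail_le:
  assumes q: "norm q \<ge> 1"
  shows "norm (poly (qtail a l \<mu> n) q)
    \<le> (2 * (1 + norm l) * (1 + norm a) * (1 + norm \<mu>)) ^ (n + 1) * norm q ^ \<Sum>{..n}"
proof (induction n)
  case 0
  have "norm \<mu> \<le> 1 * 1 * 1 * (1 + norm \<mu>)" by simp
  also have "\<dots> \<le> 2 * (1 + norm l) * (1 + norm a) * (1 + norm \<mu>)"
    by (intro mult_right_mono mult_mono) auto
  finally show ?case by simp
next
  case (Suc n)
  define C where "C = 2 * (1 + norm l) * (1 + norm a) * (1 + norm \<mu>)"
  define Q where "Q = norm q ^ \<Sum>{..n}"
  have Q: "1 \<le> Q" unfolding Q_def using q by simp
  have C: "2 * (1 + norm l) \<le> C" 
  proof -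
    have "2 * (1 + norm l) * 1 * 1 \<le> C" unfolding C_def by (intro mult_mono) auto
    then show ?thesis by simp
  qed
  have Ca: "norm a \<le> C"
  proof -
    have "1 * (norm a) * 1 \<le> C" unfolding C_def by (intro mult_mono) (auto intro: order.trans[of 1 2] simp: field_simps)
    then show ?thesis by simp
  qed
  have C1: "1 \<le> C" using C by (smt (verit) norm_ge_zero)
  have qn: "1 \<le> norm q ^ Suc n" using q by (rule one_le_power)
  have "norm (poly (qtail a l \<mu> (Suc n)) q) = norm (q ^ Suc n - l) * norm (poly (qtail a l \<mu> n) q - a ^ n)"
    by (simp add: poly_monom norm_mult)
  also have "\<dots> \<le> (norm q ^ Suc n * (1 + norm l)) * (2 * (C ^ (n + 1) * Q))"
  proof (rule mult_mono)
    have "norm (q ^ Suc n - l) \<le> norm q ^ Suc n + norm l"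
      using norm_triangle_ineq4[of "q ^ Suc n" l] by (simp add: norm_power norm_mult)
    also have "\<dots> \<le> norm q ^ Suc n * (1 + norm l)"
      using mult_right_mono[OF qn, of "norm l"] by (simp add: algebra_simps)
    finally show "norm (q ^ Suc n - l) \<le> norm q ^ Suc n * (1 + norm l)" .
    have "norm a ^ n \<le> C ^ n" by (rule power_mono[OF Ca]) simp
    also have "\<dots> \<le> C ^ (n + 1)" using C1 by (intro power_increasing) auto
    also have "\<dots> \<le> C ^ (n + 1) * Q" using Q C1 by simp
    finally have "norm a ^ n \<le> C ^ (n + 1) * Q" .
    moreover have "norm (poly (qtail a l \<mu> n) q - a ^ n) \<le> norm (poly (qtail a l \<mu> n) q) + norm a ^ n"
      using norm_triangle_ineq4[of "poly (qtail a l \<mu> n) q" "a ^ n"] by (simp add: norm_power)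
    ultimately show "norm (poly (qtail a l \<mu> n) q - a ^ n) \<le> 2 * (C ^ (n + 1) * Q)"
      using Suc unfolding C_def[symmetric] Q_def[symmetric] by linarith
  qed (use C1 Q q in auto)
  also have "\<dots> = (2 * (1 + norm l)) * (C ^ (n + 1) * (norm q ^ Suc n * Q))" by (simp add: algebra_simps)
  also have "\<dots> \<le> C * (C ^ (n + 1) * (norm q ^ Suc n * Q))"
    using C C1 Q by (intro mult_right_mono) auto
  also have "\<dots> = C ^ (Suc n + 1) * norm q ^ \<Sum>{..Suc n}"
    unfolding Q_def by (simp add: power_add)
  finally show ?case unfolding C_def .
qed

section \<open>Divisibility by powers of the indeterminate\<close>

text \<open>These sequences, polynomials in \<open>X ^ n\<close> with coefficients not depending on \<open>n\<close>, form a ring that is closed under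
  the shift and whose differences are divisible by \<open>X ^ n\<close>.\<close>
definition ypoly :: "(nat \<Rightarrow> complex poly) \<Rightarrow> bool" where
  "ypoly s \<longleftrightarrow> (\<exists>r. \<forall>n. s n = poly r (monom 1 n))"

lemma ypoly_const [simp]: "ypoly (\<lambda>_. c)"
  unfolding ypoly_def by (rule exI[of _ "[:c:]"]) simp

lemma ypoly_monom [simp]: "ypoly (\<lambda>n. monom 1 n)"
  unfolding ypoly_def by (rule exI[of _ "[:0, 1:]"]) simp

lemma ypoly_add: "ypoly s \<Longrightarrow> ypoly t \<Longrightarrow> ypoly (\<lambda>n. s n + t n)"
proof -
  assume "ypoly s" "ypoly t"
  then obtain p r where "\<forall>n. s n = poly p (monom 1 n)" "\<forall>n. t n = poly r (monom 1 n)"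
    unfolding ypoly_def by blast
  then have "\<forall>n. s n + t n = poly (p + r) (monom 1 n)" by simp
  then show ?thesis unfolding ypoly_def by blast
qed

lemma ypoly_diff: "ypoly s \<Longrightarrow> ypoly t \<Longrightarrow> ypoly (\<lambda>n. s n - t n)"
proof -
  assume "ypoly s" "ypoly t"
  then obtain p r where "\<forall>n. s n = poly p (monom 1 n)" "\<forall>n. t n = poly r (monom 1 n)"
    unfolding ypoly_def by blast
  then have "\<forall>n. s n - t n = poly (p - r) (monom 1 n)" by simp
  then show ?thesis unfolding ypoly_def by blast
qed

lemma ypoly_mult: "ypoly s \<Longrightarrow> ypoly t \<Longrightarrow> ypoly (\<lambda>n. s n * t n)"
proof -
  assume "ypoly s" "ypoly t"
  then obtain p r where "\<forall>n. s n = poly p (monom 1 n)" "\<forall>n. t n = poly r (monom 1 n)"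
    unfolding ypoly_def by blast
  then have "\<forall>n. s n * t n = poly (p * r) (monom 1 n)" by simp
  then show ?thesis unfolding ypoly_def by blast
qed

lemma ypoly_shift: "ypoly s \<Longrightarrow> ypoly (\<lambda>n. s (n + k))"
proof -
  assume "ypoly s"
  then obtain r where r: "\<And>n. s n = poly r (monom 1 n)" unfolding ypoly_def by blast
  have "s (n + k) = poly (pcompose r [:0, monom 1 k:]) (monom 1 n)" for n
    by (simp add: r poly_pcompose mult_monom)
  then show ?thesis unfolding ypoly_def by blast
qed

lemma ypoly_induct [consumes 1, case_names const step]:
  assumes "ypoly s" and "\<And>c. Q (\<lambda>_. c)"
    and "\<And>c t. ypoly t \<Longrightarrow> Q t \<Longrightarrow> Q (\<lambda>n. c + monom 1 n * t n)"
  shows "Q s"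
proof -
  obtain r where r: "s = (\<lambda>n. poly r (monom 1 n))" using assms(1) unfolding ypoly_def by blast
  have "Q (\<lambda>n. poly r (monom 1 n))"
  proof (induction r)
    case (pCons c r)
    have "ypoly (\<lambda>n. poly r (monom 1 n))" unfolding ypoly_def by blast
    from assms(3)[OF this pCons(2), of c] show ?case by simp
  qed (simp add: assms(2))
  then show ?thesis using r by simp
qed

lemma ypoly_difference:
  assumes "ypoly s"
  shows "\<exists>t. ypoly t \<and> (\<forall>n. s (n + 1) - s n = monom 1 n * t n)"
  using assms
proof (induction rule: ypoly_induct)
  case (const c)
  show ?case by (rule exI[of _ "\<lambda>_. 0"]) simp
next
  case (step c t)
  let ?t = "\<lambda>n. monom 1 1 * t (n + 1) - t n"
  have "ypoly ?t" 
    by (intro ypoly_diff ypoly_mult ypoly_shift[OF step(1), of 1] step(1) ypoly_const)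
  moreover have "c + monom 1 (n + 1) * t (n + 1) - (c + monom 1 n * t n) = monom 1 n * ?t n" for n
  proof -
    have "monom 1 (n + 1) = monom 1 n * monom (1::complex) 1" by (simp add: mult_monom)
    then show ?thesis by (simp only: algebra_simps)
  qed
  ultimately show ?case by blast
qed

lemma act_linear_factor: "act [:-c, 1:] v n = v (n + 1) - c * v n"
  by (simp add: act_pCons)

lemma act_linear_factor_mult: "act ([:-c, 1:] * P) v n = act P v (n + 1) - c * act P v n"
  unfolding act_mult act_linear_factor ..

abbreviation expo_op :: "complex \<Rightarrow> nat \<Rightarrow> complex poly poly" where
  "expo_op c k \<equiv> [:- monom c k, 1:]"

text \<open>In the induction step the operator shift plus \<open>l * X ^ x\<close> treats the part with factor
  \<open>qtail\<close>, since \<open>qtail (n + 1)\<close> is \<open>- l * qtail n\<close> modulo \<open>X ^ n\<close> and \<open>a ^ n\<close>, and the operator shift minus \<open>a * X ^ x\<close>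
  treats the part with factor \<open>a ^ n\<close>. Together they gain \<open>X ^ (n + 2 * x)\<close>: one \<open>X ^ n\<close> from the
  differences of the multipliers, and \<open>X ^ x\<close> for each from the shift of the exponent \<open>n * x\<close> that is already there.\<close>
lemma act_expo_ops_qtail:
  "\<exists>r s. ypoly r \<and> ypoly s \<and> (\<forall>n. act (\<Prod>k<x. expo_op a k * expo_op (-l) k) (qtail a l \<mu>) n =
     monom 1 (x * (x - 1) + n * x) * (qtail a l \<mu> n * r n + [:a ^ n:] * s n))"
proof (induction x)
  case 0
  show ?case by (rule exI[of _ "\<lambda>_. 1"], rule exI[of _ "\<lambda>_. 0"]) (auto simp: monom_0)
next
  case (Suc x)
  let ?P = "\<Prod>k<x. expo_op a k * expo_op (-l) k" and ?v = "qtail a l \<mu>"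
  define M where "M k = monom (1::complex) k" for k
  define A where "A = [:a:]" define l' where "l' = [:l:]"
  define an where "an n = [:a ^ n:]" for n
  have M: "M (m + n) = M m * M n" for m n by (simp add: M_def mult_monom)
  have an: "an (n + 1) = A * an n" for n by (simp add: an_def A_def)
  have v: "?v (n + 1) = (M (n + 1) - l') * (?v n - an n)" for n by (simp add: M_def l'_def an_def)
  from Suc obtain r s where rs: "ypoly r" "ypoly s"
    and w0: "\<forall>n. act ?P ?v n = monom 1 (x * (x - 1) + n * x) * (?v n * r n + [:a ^ n:] * s n)"
    by blast
  have w: "act ?P ?v n = M (x * (x - 1) + n * x) * (?v n * r n + an n * s n)" for n
    unfolding M_def an_def by (rule w0[rule_format])
  obtain t where t: "ypoly t" "\<forall>n. r (n + 1) - r n = monom 1 n * t n"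
    using ypoly_difference[OF rs(1)] by (elim exE conjE)
  define r' where "r' n = M 1 * r (n + 1) - l' * t n" for n
  define s' where "s' n = A * s (n + 1) + l' * s n - (M n * M 1 - l') * r (n + 1)" for n
  have rs': "ypoly r'" "ypoly s'"
    unfolding r'_def s'_def M_def l'_def A_def
    by (intro ypoly_diff ypoly_add ypoly_mult ypoly_shift[OF rs(1), of 1] ypoly_shift[OF rs(2), of 1]
        rs t(1) ypoly_const ypoly_monom)+
  have w': "act (expo_op (-l) x * ?P) ?v n
      = M (x * (x - 1) + x + n * x) * (?v n * M n * r' n + an n * s' n)" for n
  proof -
    have r1: "r (n + 1) = r n + M n * t n" using t(2)[rule_format, of n] by (simp add: algebra_simps M_def)
    have m: "monom (-l) x = - (l' * M x)" by (simp add: l'_def M_def smult_monom minus_monom)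
    (* c, y, k stand for M (x * (x - 1)), M (n * x), M x; after the substitution of the recurrence and
       of r (n + 1) the claim is this ring identity. *)
    have alg: "c * (y * k) * ((xn * x1 - L) * (vn - e) * (R + xn * T) + A * e * s1) - (- (L * k)) * (c * y * (vn * R + e * s0))
        = c * k * y * (vn * xn * (x1 * (R + xn * T) - L * T) + e * (A * s1 + L * s0 - (xn * x1 - L) * (R + xn * T)))"
      for c y k xn x1 L vn e R T s1 s0 :: "complex poly"
      by (simp add: algebra_simps)
    have "act (expo_op (-l) x * ?P) ?v n = act ?P ?v (n + 1) - monom (-l) x * act ?P ?v n"
      by (rule act_linear_factor_mult)
    also have "\<dots> = M (x * (x - 1)) * (M (n * x) * M x)
        * ((M n * M 1 - l') * (?v n - an n) * (r n + M n * t n) + A * an n * s (n + 1))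
        - (- (l' * M x)) * (M (x * (x - 1)) * M (n * x) * (?v n * r n + an n * s n))"
      unfolding w m by (simp only: v an M r1 add_mult_distrib mult_1)
    finally show ?thesis
      unfolding alg r'_def s'_def by (simp only: M r1)
  qed
  obtain t' where t': "ypoly t'" "\<forall>n. s' (n + 1) - s' n = monom 1 n * t' n"
    using ypoly_difference[OF rs'(2)] by (elim exE conjE)
  define r2 where "r2 n = (M n * M 1 - l') * M 1 * r' (n + 1) - A * r' n" for n
  define s2 where "s2 n = A * t' n - (M n * M 1 - l') * M 1 * r' (n + 1)" for n
  have rs2: "ypoly r2" "ypoly s2" unfolding r2_def s2_def M_def l'_def A_def
    by (intro ypoly_diff ypoly_add ypoly_mult ypoly_shift[OF rs'(1), of 1] rs' t'(1) ypoly_const ypoly_monom)+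
  have "act (expo_op a x * (expo_op (-l) x * ?P)) ?v n
      = M (x * (x - 1) + x + x + n * x + n) * (?v n * r2 n + an n * s2 n)" for n
  proof -
    have s1: "s' (n + 1) = s' n + M n * t' n" using t'(2)[rule_format, of n] by (simp add: algebra_simps M_def)
    have m: "monom a x = A * M x" by (simp add: A_def M_def smult_monom)
    have alg: "c * k * (y * k) * ((xn * x1 - L) * (vn - e) * (xn * x1) * R + A * e * (s0 + xn * T))
          - A * k * (c * k * y * (vn * xn * R0 + e * s0))
        = c * k * k * y * xn * (vn * ((xn * x1 - L) * x1 * R - A * R0) + e * (A * T - (xn * x1 - L) * x1 * R))"
      for c y k xn x1 L vn e R T R0 s0 :: "complex poly"
      by (simp add: algebra_simps)
    have "act (expo_op a x * (expo_op (-l) x * ?P)) ?v n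
        = act (expo_op (-l) x * ?P) ?v (n + 1) - monom a x * act (expo_op (-l) x * ?P) ?v n"
      by (rule act_linear_factor_mult)
    also have "\<dots> = M (x * (x - 1)) * M x * (M (n * x) * M x)
        * ((M n * M 1 - l') * (?v n - an n) * (M n * M 1) * r' (n + 1) + A * an n * (s' n + M n * t' n))
        - A * M x * (M (x * (x - 1)) * M x * M (n * x) * (?v n * M n * r' n + an n * s' n))"
      unfolding w' m by (simp only: v an M s1 add_mult_distrib mult_1)
    finally show ?thesis
      unfolding alg r2_def s2_def by (simp only: M)
  qed
  moreover have "x * (x - 1) + x + x + n * x + n = Suc x * (Suc x - 1) + n * Suc x" for n
    by (cases x) (auto simp: algebra_simps)
  moreover have "(\<Prod>k<Suc x. expo_op a k * expo_op (-l) k) = expo_op a x * (expo_op (-l) x * ?P)"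
    by (simp only: prod.lessThan_Suc mult_ac)
  ultimately have "act (\<Prod>k<Suc x. expo_op a k * expo_op (-l) k) ?v n
      = monom 1 (Suc x * (Suc x - 1) + n * Suc x) * (?v n * r2 n + [:a ^ n:] * s2 n)" for n
    by (simp only: M_def an_def)
  then show ?case using rs2 by blast
qed

lemma monic_prod_expo_ops:
  "finite S \<Longrightarrow> degree (\<Prod>k\<in>S. expo_op c k) = card S \<and> lead_coeff (\<Prod>k\<in>S. expo_op c k) = 1"
  using lead_coeff_prod[of "expo_op c" S] by (simp add: degree_prod_eq_sum_degree)

lemma monic_monom_mult:
  fixes P :: "'a :: idom poly"
  assumes "lead_coeff P = 1" "degree P = d"
  shows "degree (monom 1 k * P) = k + d \<and> lead_coeff (monom 1 k * P) = 1"
proof -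
  have "P \<noteq> 0" using assms by auto
  then show ?thesis
    using assms lead_coeff_mult[of "monom 1 k" P]
    by (simp add: degree_mult_eq monom_eq_0_iff degree_monom_eq)
qed

text \<open>Only the columns are combined. The entry in row \<open>i\<close> and column \<open>j\<close> is then \<open>act (Q j)\<close> at the
  index \<open>i + (j - k j) + s\<close>, so its valuation grows linearly in \<open>i\<close> with slope \<open>x j\<close>; the least total
  valuation over all permutations is found by rearrangement.\<close>
lemma power_X_dvd_qhankel:
  assumes Q: "\<And>j. j < n \<Longrightarrow> degree (Q j) = k j \<and> lead_coeff (Q j) = 1 \<and> k j \<le> j"
    and dvd: "\<And>j t. j < n \<Longrightarrow> monom 1 (b j + t * x j) dvd act (Q j) (qtail a l \<mu>) t"
    and x: "\<And>j. x j = (\<Sum>k\<le>j. d k)"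
    and e: "e \<le> (\<Sum>j<n. b j + (j - k j) * x j) + (\<Sum>i<n. i * x (n - 1 - i))"
  shows "monom 1 e dvd qhankel a l \<mu> s n"
proof -
  let ?v = "\<lambda>i. qtail a l \<mu> (i + s)"
  define m where "m i j = b j + (i + (j - k j)) * x j" for i j
  have "qhankel a l \<mu> s n = ndet n (\<lambda>i j. act (monom 1 i * (monom 1 (j - k j) * Q j)) ?v 0)"
    unfolding qhankel_def
  proof (rule hankel_ndet_change_basis)
    fix i assume "i < n"
    then show "degree (monom 1 (i - k i) * Q i) = i \<and> lead_coeff (monom 1 (i - k i) * Q i) = 1"
      using Q[of i] monic_monom_mult[of "Q i" "k i" "i - k i"] by auto
  qed (simp add: degree_monom_eq)
  moreover have "monom 1 1 ^ e dvd ndet n (\<lambda>i j. act (monom 1 i * (monom 1 (j - k j) * Q j)) ?v 0)"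
  proof (rule power_dvd_ndet[where m = m])
    fix i j assume ij: "i < n" "j < n"
    have "act (monom 1 i * (monom 1 (j - k j) * Q j)) ?v 0 = act (Q j) (qtail a l \<mu>) (i + (j - k j) + s)"
      by (simp only: act_monom_mult) (simp add: act_def add_ac)
    moreover have "monom 1 1 ^ m i j dvd monom (1::complex) (b j + (i + (j - k j) + s) * x j)"
      unfolding m_def by (simp add: monom_power monom_1_dvd_iff' coeff_monom algebra_simps)
    ultimately show "monom 1 1 ^ m i j dvd act (monom 1 i * (monom 1 (j - k j) * Q j)) ?v 0"
      using dvd[OF ij(2)] dvd_trans by metis
  next
    fix p assume p: "p permutes {0..<n}"
    have "(\<Sum>i<n. m i (p i)) = (\<Sum>i<n. b (p i) + (p i - k (p i)) * x (p i)) + (\<Sum>i<n. i * x (p i))"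
      by (simp add: m_def sum.distrib algebra_simps)
    also have "(\<Sum>i<n. b (p i) + (p i - k (p i)) * x (p i)) = (\<Sum>j<n. b j + (j - k j) * x j)"
      using sum.permute[OF p, of "\<lambda>j. b j + (j - k j) * x j"] by (simp add: o_def lessThan_atLeast0)
    finally show "e \<le> (\<Sum>i<n. m i (p i))"
      using e rearrangement_ge[OF x p] by linarith
  qed
  ultimately show ?thesis by (simp add: monom_power)
qed

lemma monom_0_eq_1: "monom 1 0 = 1"
  by (simp add: monom_0 one_pCons)

text \<open>Column \<open>j\<close> receives \<open>j div 2\<close> pairs of operators, so that all its degree, up to parity, is used.\<close>
definition xval :: "nat \<Rightarrow> nat" where
  "xval n = (\<Sum>j<n. (j div 2) * (j div 2 - 1) + (j mod 2) * (j div 2)) + (\<Sum>i<n. i * ((n - 1 - i) div 2))"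

lemma X_power_xval_dvd_qhankel: "monom 1 (xval n) dvd qhankel a l \<mu> s n"
proof (rule power_X_dvd_qhankel[where b = "\<lambda>j. (j div 2) * (j div 2 - 1)" and x = "\<lambda>j. j div 2"
      and d = "\<lambda>j. if j = 0 then 0 else j div 2 - (j - 1) div 2" and k = "\<lambda>j. 2 * (j div 2)"
      and Q = "\<lambda>j. \<Prod>k<j div 2. expo_op a k * expo_op (-l) k"])
  fix j :: nat
  have "j div 2 = (\<Sum>k\<le>j. if k = 0 then 0 else k div 2 - (k - 1) div 2)"
  proof (induction j)
    case (Suc j)
    have "(\<Sum>k\<le>Suc j. if k = 0 then 0 else k div 2 - (k - 1) div 2)
      = (\<Sum>k\<le>j. if k = 0 then 0 else k div 2 - (k - 1) div 2) + (Suc j div 2 - j div 2)" by simp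
    also have "\<dots> = j div 2 + (Suc j div 2 - j div 2)" using Suc by simp
    finally show ?case by (simp add: div_le_mono)
  qed simp
  then show "j div 2 = (\<Sum>k\<le>j. if k = 0 then 0 else k div 2 - (k - 1) div 2)" .
next
  fix j assume "j < n"
  let ?A = "\<Prod>k<j div 2. expo_op a k" and ?B = "\<Prod>k<j div 2. expo_op (-l) k"
  have "degree ?A = j div 2" "lead_coeff ?A = 1" "degree ?B = j div 2" "lead_coeff ?B = 1"
    using monic_prod_expo_ops[of "{..<j div 2}" a] monic_prod_expo_ops[of "{..<j div 2}" "-l"] by auto
  moreover have "?A \<noteq> 0" "?B \<noteq> 0" using calculation by (metis leading_coeff_0_iff zero_neq_one)+
  ultimately have "degree (?A * ?B) = 2 * (j div 2)" "lead_coeff (?A * ?B) = 1"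
    using degree_mult_eq[of ?A ?B] lead_coeff_mult[of ?A ?B] by auto
  then show "degree (\<Prod>k<j div 2. expo_op a k * expo_op (-l) k) = 2 * (j div 2) \<and>
      lead_coeff (\<Prod>k<j div 2. expo_op a k * expo_op (-l) k) = 1 \<and> 2 * (j div 2) \<le> j"
    unfolding prod.distrib by auto
next
  fix j t :: nat assume "j < n"
  obtain r s' where "act (\<Prod>k<j div 2. expo_op a k * expo_op (-l) k) (qtail a l \<mu>) t =
     monom 1 (j div 2 * (j div 2 - 1) + t * (j div 2)) * (qtail a l \<mu> t * r t + [:a ^ t:] * s' t)"
    using act_expo_ops_qtail[where x = "j div 2" and a = a and l = l and \<mu> = \<mu>] by blast
  then show "monom 1 (j div 2 * (j div 2 - 1) + t * (j div 2)) dvd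
      act (\<Prod>k<j div 2. expo_op a k * expo_op (-l) k) (qtail a l \<mu>) t"
    by simp
next
  have "(j - 2 * (j div 2)) = j mod 2" for j :: nat by presburger
  then show "xval n \<le> (\<Sum>j<n. j div 2 * (j div 2 - 1) + (j - 2 * (j div 2)) * (j div 2)) + (\<Sum>i<n. i * ((n - 1 - i) div 2))"
    unfolding xval_def by simp
qed

lemma sum_lessThan_real: "(\<Sum>i<n. real i) = real n * (real n - 1) / 2"
  by (induction n) (auto simp: field_simps)

lemma sum_lessThan_real_square: "(\<Sum>i<n. (real i)\<^sup>2) = real n * (real n - 1) * (2 * real n - 1) / 6"
  by (induction n) (auto simp: field_simps power2_eq_square)

lemma xval_ge: "real n ^ 3 / 6 - 2 * real n ^ 2 \<le> real (xval n)"
proof -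
  have 1: "(real j ^ 2 - 4 * real j) / 4 \<le> real ((j div 2) * (j div 2 - 1) + (j mod 2) * (j div 2))" for j
  proof -
    obtain h where "j = 2 * h \<or> j = 2 * h + 1" by (meson evenE oddE)
    then show ?thesis by (cases h) (auto simp: power2_eq_square field_simps)
  qed
  have 2: "real i * (real n - 2 - real i) / 2 \<le> real (i * ((n - 1 - i) div 2))" if "i < n" for i
  proof -
    have "n - 1 - i \<le> 2 * ((n - 1 - i) div 2) + 1" by presburger
    then have "real n - 1 - real i \<le> 2 * real ((n - 1 - i) div 2) + 1" using that by linarith
    then have "real i * (real n - 2 - real i) \<le> real i * (2 * real ((n - 1 - i) div 2))"
      by (intro mult_left_mono) auto
    then show ?thesis by simp
  qed
  have "real n ^ 3 / 6 - 2 * real n ^ 2 \<le> (\<Sum>j<n. (real j ^ 2 - 4 * real j) / 4) + (\<Sum>i<n. real i * (real n - 2 - real i) / 2)"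
  proof -
    have e: "(\<Sum>j<n. (real j ^ 2 - 4 * real j) / 4) + (\<Sum>i<n. real i * (real n - 2 - real i) / 2)
      = (real n / 2 - 2) * (\<Sum>i<n. real i) - (\<Sum>i<n. real i ^ 2) / 4"
      unfolding sum.distrib[symmetric] sum_divide_distrib sum_distrib_left sum_subtractf[symmetric]
      by (intro sum.cong) (auto simp: field_simps power2_eq_square)
    show ?thesis unfolding e sum_lessThan_real sum_lessThan_real_square
      by (simp add: field_simps power2_eq_square power3_eq_cube)
  qed
  also have "\<dots> \<le> real (xval n)"
    unfolding xval_def of_nat_add of_nat_sum
    by (intro add_mono sum_mono) (use 1 2 in \<open>auto\<close>)
  finally show ?thesis .
qed

text \<open>A factor \<open>X ^ (n + 1)\<close> in the sequence turns the operator with exponent \<open>k + 1\<close> into the one with exponent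
  \<open>k\<close>, and leaves one more factor \<open>X\<close> outside.\<close>
lemma act_expo_ops_shift:
  assumes "\<And>n. w n = monom 1 (n + 1) * e n"
  shows "act (\<Prod>k<x. expo_op a (Suc k)) w n = monom 1 (n + 1 + x) * act (\<Prod>k<x. expo_op a k) e n"
proof (induction x arbitrary: n)
  case (Suc x)
  let ?P = "\<Prod>k<x. expo_op a (Suc k)" and ?R = "\<Prod>k<x. expo_op a k"
  have m: "monom a (Suc x) = monom 1 1 * monom a x" by (simp add: mult_monom)
  have m1: "monom 1 (n + 1 + 1 + x) = monom 1 1 * monom (1::complex) (n + 1 + x)" "monom 1 (n + 1 + Suc x) = monom 1 1 * monom (1::complex) (n + 1 + x)"
    by (simp_all add: mult_monom)
  have "act (\<Prod>k<Suc x. expo_op a (Suc k)) w n = act (expo_op a (Suc x) * ?P) w n"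
    by (simp only: prod.lessThan_Suc mult.commute)
  also have "\<dots> = act ?P w (n + 1) - monom a (Suc x) * act ?P w n"
    by (rule act_linear_factor_mult)
  also have "\<dots> = monom 1 (n + 1 + Suc x) * (act ?R e (n + 1) - monom a x * act ?R e n)"
    unfolding Suc m m1 by (simp only: right_diff_distrib mult_ac)
  also have "act ?R e (n + 1) - monom a x * act ?R e n = act (expo_op a x * ?R) e n"
    by (rule act_linear_factor_mult[symmetric])
  also have "expo_op a x * ?R = (\<Prod>k<Suc x. expo_op a k)" by (simp only: prod.lessThan_Suc mult.commute)
  finally show ?case .
qed (simp add: assms)

lemma act_shift: "act P v (n + k) = act P (\<lambda>n. v (n + k)) n"
  by (simp add: act_def add_ac)

text \<open>For \<open>l = 0\<close> the sequence satisfies \<open>v (n + 1) = X ^ (n + 1) * (v n - a ^ n)\<close>, so the part with factor \<open>v n\<close> is small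
  already and only the part with factor \<open>a ^ n\<close> has to be removed: one operator gains what takes two in general.
  The power \<open>a ^ n\<close> itself is annihilated by the operator with exponent \<open>0\<close>, which the index shift supplies.\<close>
lemma X_power_dvd_act_expo_ops_0:
  "monom 1 (n * x) dvd act (\<Prod>k<x. expo_op a (Suc k)) (qtail a 0 \<mu>) n"
proof (induction x arbitrary: n)
  case (Suc x)
  let ?v = "qtail a 0 \<mu>" and ?R = "\<Prod>k<x. expo_op a (Suc k)"
  show ?case
  proof (cases n)
    case (Suc m)
    have "act (\<Prod>k<Suc x. expo_op a (Suc k)) ?v n
        = act (\<Prod>k<Suc x. expo_op a (Suc k)) (\<lambda>n. ?v (n + 1)) m"
      unfolding Suc by (simp only: act_shift[symmetric] Suc_eq_plus1)
    also have "\<dots> = monom 1 (m + 1 + Suc x) * act (\<Prod>k<Suc x. expo_op a k) (\<lambda>n. ?v n - [:a ^ n:]) m"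
      by (rule act_expo_ops_shift) simp
    also have "act (\<Prod>k<Suc x. expo_op a k) (\<lambda>n. ?v n - [:a ^ n:]) m
        = act (?R * expo_op a 0) (\<lambda>n. ?v n - [:a ^ n:]) m"
      by (simp only: prod.lessThan_Suc_shift mult.commute)
    also have "\<dots> = act ?R (\<lambda>n. ?v (n + 1) - [:a:] * ?v n) m"
    proof -
      have "act (expo_op a 0) (\<lambda>n. ?v n - [:a ^ n:]) = (\<lambda>n. ?v (n + 1) - [:a:] * ?v n)"
        by (rule ext) (simp only: act_linear_factor, simp add: monom_0 algebra_simps)
      then show ?thesis by (simp only: act_mult)
    qed
    also have "\<dots> = act (expo_op a 0 * ?R) ?v m"
    proof -
      have "act (expo_op a 0) ?v = (\<lambda>n. ?v (n + 1) - [:a:] * ?v n)"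
        by (rule ext) (simp only: act_linear_factor, simp add: monom_0)
      then show ?thesis by (simp only: mult.commute[of "expo_op a 0"] act_mult)
    qed
    also have "\<dots> = act ?R ?v (m + 1) - monom a 0 * act ?R ?v m"
      by (rule act_linear_factor_mult)
    finally have e: "act (\<Prod>k<Suc x. expo_op a (Suc k)) ?v n
        = monom 1 (m + 1 + Suc x) * (act ?R ?v (m + 1) - monom a 0 * act ?R ?v m)" .
    have "monom (1::complex) (m * x) dvd monom 1 ((m + 1) * x)"
      by (auto simp: monom_1_dvd_iff' coeff_monom)
    then have "monom 1 (m * x) dvd act ?R ?v (m + 1) - monom a 0 * act ?R ?v m"
      using Suc.IH[of "m + 1"] Suc.IH[of m] by (meson dvd_diff dvd_mult dvd_trans)
    then have "monom 1 (m + 1 + Suc x) * monom 1 (m * x) dvd act (\<Prod>k<Suc x. expo_op a (Suc k)) ?v n"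
      unfolding e by (rule mult_dvd_mono[OF dvd_refl])
    moreover have "monom 1 (n * Suc x) dvd monom 1 (m + 1 + Suc x) * monom (1::complex) (m * x)"
      unfolding Suc by (simp add: mult_monom monom_1_dvd_iff' coeff_monom)
    ultimately show ?thesis by (rule dvd_trans[rotated])
  qed (simp add: monom_0_eq_1)
qed (simp add: monom_0_eq_1)

text \<open>Column \<open>j\<close> receives \<open>min j (n div 2)\<close> operators. Each one costs the column a shift by one and gains a factor
  \<open>X\<close> per row, which pays off up to about \<open>n / 2\<close> operators.\<close>
definition xval0 :: "nat \<Rightarrow> nat" where
  "xval0 n = (\<Sum>j<n. (j - min j (n div 2)) * min j (n div 2)) + (\<Sum>i<n. i * min (n - 1 - i) (n div 2))"

lemma X_power_xval0_dvd_qhankel: "monom 1 (xval0 n) dvd qhankel a 0 \<mu> s n"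
proof (rule power_X_dvd_qhankel[where b = "\<lambda>j. 0" and x = "\<lambda>j. min j (n div 2)"
      and d = "\<lambda>j. if j = 0 \<or> j > n div 2 then 0 else 1" and k = "\<lambda>j. min j (n div 2)"
      and Q = "\<lambda>j. \<Prod>k<min j (n div 2). expo_op a (Suc k)"])
  show "min j (n div 2) = (\<Sum>k\<le>j. if k = 0 \<or> k > n div 2 then 0 else 1)" for j
    by (induction j) auto
next
  fix j assume "j < n"
  let ?S = "{..<min j (n div 2)}"
  have e: "(\<Prod>k\<in>?S. expo_op a (Suc k)) = (\<Prod>k\<in>Suc ` ?S. expo_op a k)"
    by (simp add: prod.reindex)
  have "card (Suc ` ?S) = min j (n div 2)" by (simp add: card_image)
  then show "degree (\<Prod>k\<in>?S. expo_op a (Suc k)) = min j (n div 2) \<and>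
      lead_coeff (\<Prod>k\<in>?S. expo_op a (Suc k)) = 1 \<and> min j (n div 2) \<le> j"
    unfolding e using monic_prod_expo_ops[of "Suc ` ?S" a] by auto
next
  show "monom 1 (0 + t * min j (n div 2)) dvd act (\<Prod>k<min j (n div 2). expo_op a (Suc k)) (qtail a 0 \<mu>) t" for j t
    using X_power_dvd_act_expo_ops_0[of t "min j (n div 2)" a \<mu>] by simp
qed (simp add: xval0_def)

lemma xval0_ge: "5 / 24 * real n ^ 3 - 2 * real n ^ 2 \<le> real (xval0 n)"
proof -
  define h where "h = n div 2"
  have hn: "h \<le> n" "2 * h \<le> n" "n \<le> 2 * h + 1" unfolding h_def by auto
  have 1: "(\<Sum>j<n. real ((j - min j h) * min j h)) = (\<Sum>j<n - h. real j * real h)"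
  proof -
    have "(\<Sum>j<n. real ((j - min j h) * min j h)) = (\<Sum>j<h. 0) + (\<Sum>j\<in>{h..<n}. real ((j - h) * h))"
      unfolding lessThan_atLeast0 using hn(1)
      by (subst sum.atLeastLessThan_concat[of 0 h n, symmetric]) (auto intro!: arg_cong2[where f="(+)"] sum.cong)
    also have "\<dots> = (\<Sum>j<n - h. real j * real h)"
      using sum.shift_bounds_nat_ivl[of "\<lambda>j. real ((j - h) * h)" 0 h "n - h"] hn by (simp add: lessThan_atLeast0)
    finally show ?thesis .
  qed
  have 2: "(\<Sum>i<n. real (i * min (n - 1 - i) h)) = (\<Sum>i<n - h. real i * real h) + (\<Sum>i\<in>{n - h..<n}. real i * (real n - 1 - real i))"
    unfolding lessThan_atLeast0 using hn(1)
    by (subst sum.atLeastLessThan_concat[of 0 "n - h" n, symmetric]) (auto intro!: arg_cong2[where f="(+)"] sum.cong simp: min_def)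
  have 3: "(\<Sum>i\<in>{n - h..<n}. real i * (real n - 1 - real i)) = (\<Sum>i<n. real i * (real n - 1 - real i)) - (\<Sum>i<n-h. real i * (real n - 1 - real i))"
    unfolding lessThan_atLeast0 using sum.atLeastLessThan_concat[of 0 "n - h" n "\<lambda>i. real i * (real n - 1 - real i)"] by simp
  have 4: "(\<Sum>i<m. real i * (real n - 1 - real i)) = (real n - 1) * (real m * (real m - 1) / 2) - real m * (real m - 1) * (2 * real m - 1) / 6" for m
    unfolding sum_lessThan_real[symmetric] sum_lessThan_real_square[symmetric] sum_distrib_left sum_subtractf[symmetric]
    by (intro sum.cong) (auto simp: algebra_simps power2_eq_square)
  have 5: "(\<Sum>i<n-h. real i * real h) = real h * (real (n - h) * (real (n - h) - 1) / 2)"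
    unfolding sum_lessThan_real[symmetric] by (simp add: sum_distrib_left mult.commute)
  have "real (xval0 n) = 2 * (real h * (real (n - h) * (real (n - h) - 1) / 2)) +
     ((real n - 1) * (real n * (real n - 1) / 2) - real n * (real n - 1) * (2 * real n - 1) / 6) -
     ((real n - 1) * (real (n-h) * (real (n-h) - 1) / 2) - real (n-h) * (real (n-h) - 1) * (2 * real (n-h) - 1) / 6)"
    unfolding xval0_def h_def[symmetric] of_nat_add of_nat_sum 1 2 3 4 5 by simp
  note xval0_eq = this
  consider (even) "n = 2 * h" | (odd) "n = 2 * h + 1" using hn by linarith
  then show ?thesis
  proof cases
    case even
    then have "n - h = h" by simp
    then show ?thesis unfolding xval0_eq using even by (simp add: field_simps power2_eq_square power3_eq_cube)
  next
    case odd
    then have "n - h = h + 1" by simp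
    then show ?thesis unfolding xval0_eq using odd by (simp add: field_simps power2_eq_square power3_eq_cube)
  qed
qed

section \<open>Divisibility at roots of unity\<close>

text \<open>At \<open>X = z\<close> the sequence \<open>X ^ n\<close> has period \<open>L\<close>.\<close>
lemma ypoly_difference_root_of_unity:
  assumes "ypoly s" "z ^ L = 1"
  shows "\<exists>t. ypoly t \<and> (\<forall>n. s (n + L) - s n = [:-z, 1:] * t n)"
  using assms(1)
proof (induction rule: ypoly_induct)
  case (const c)
  show ?case by (rule exI[of _ "\<lambda>_. 0"]) simp
next
  case (step c t)
  from step(2) obtain u where u: "ypoly u" "\<forall>n. t (n + L) - t n = [:-z, 1:] * u n" by blast
  have "poly (monom 1 L - 1) z = 0" using assms(2) by (simp add: poly_monom)
  then obtain g where g: "monom 1 L - 1 = [:-z, 1:] * g" unfolding poly_eq_0_iff_dvd by (elim dvdE)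
  let ?t = "\<lambda>n. monom 1 n * (g * t (n + L) + u n)"
  have "ypoly ?t"
    by (intro ypoly_mult ypoly_add ypoly_monom ypoly_const ypoly_shift[OF step(1)] u(1))
  moreover have "c + monom 1 (n + L) * t (n + L) - (c + monom 1 n * t n) = [:-z, 1:] * ?t n" for n
  proof -
    have m: "monom 1 (n + L) = monom 1 n * monom (1::complex) L" by (simp add: mult_monom)
    have "c + monom 1 (n + L) * t (n + L) - (c + monom 1 n * t n)
        = monom 1 n * ((monom 1 L - 1) * t (n + L) + (t (n + L) - t n))"
      unfolding m by (simp add: algebra_simps)
    also have "\<dots> = [:-z, 1:] * ?t n" unfolding g u(2)[rule_format] by (simp only: algebra_simps)
    finally show ?thesis .
  qed
  ultimately show ?case by blast
qed

text \<open>A filtration by weights on the sequences of \<open>ypoly\<close>, for \<open>z ^ L = 1\<close>. The uniformizer \<open>X - z\<close> has weight \<open>2\<close>,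
  and \<open>X ^ (n * L) - 1\<close> has weight only \<open>1\<close>, although it is divisible by \<open>X - z\<close>. With
  this choice the difference with step \<open>L\<close> always raises the weight by one (\<open>wfil_difference\<close>), while
  weight \<open>k\<close> still gives half as many factors \<open>X - z\<close>, rounded up (\<open>wfil_dvd\<close>).\<close>
inductive wfil :: "complex \<Rightarrow> nat \<Rightarrow> nat \<Rightarrow> (nat \<Rightarrow> complex poly) \<Rightarrow> bool" for z L where
  wfil_const: "wfil z L 0 (\<lambda>_. c)"
| wfil_monom: "wfil z L 0 (\<lambda>n. monom 1 n)"
| wfil_root: "wfil z L 1 (\<lambda>n. monom 1 (n * L) - 1)"
| wfil_prime: "wfil z L 2 (\<lambda>_. [:-z, 1:])"
| wfil_add: "wfil z L k s \<Longrightarrow> wfil z L k t \<Longrightarrow> wfil z L k (\<lambda>n. s n + t n)"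
| wfil_mult: "wfil z L j s \<Longrightarrow> wfil z L k t \<Longrightarrow> wfil z L (j + k) (\<lambda>n. s n * t n)"
| wfil_weaken: "wfil z L (Suc k) s \<Longrightarrow> wfil z L k s"

lemma wfil_mono: "wfil z L k s \<Longrightarrow> j \<le> k \<Longrightarrow> wfil z L j s"
proof (induction "k - j" arbitrary: j)
  case (Suc d)
  then have "wfil z L (Suc j) s" by simp
  then show ?case by (rule wfil_weaken)
qed simp

lemma wfil_scale: "wfil z L k s \<Longrightarrow> wfil z L k (\<lambda>n. c * s n)"
  using wfil_mult[OF wfil_const, of z L k s c] by simp

lemma wfil_diff: "wfil z L k s \<Longrightarrow> wfil z L k t \<Longrightarrow> wfil z L k (\<lambda>n. s n - t n)"
  using wfil_add[OF _ wfil_scale[of z L k t "-1"], of s] by simp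

lemma wfil_zero: "wfil z L k (\<lambda>_. 0)"
proof (induction k)
  case (Suc k)
  show ?case using wfil_mult[OF wfil_root Suc] by simp
qed (rule wfil_const)

lemma wfil_imp_ypoly: "wfil z L k s \<Longrightarrow> ypoly s"
proof (induction rule: wfil.induct)
  case wfil_root
  have "ypoly (\<lambda>n. monom 1 (n * L))"
    unfolding ypoly_def by (rule exI[of _ "monom 1 L"]) (simp add: poly_monom monom_power)
  then show ?case by (rule ypoly_diff[OF _ ypoly_const])
qed (auto intro: ypoly_add ypoly_mult)

lemma ypoly_imp_wfil: "ypoly s \<Longrightarrow> wfil z L 0 s"
proof (induction rule: ypoly_induct)
  case (step c t)
  have "wfil z L (0 + 0) (\<lambda>n. monom 1 n * t n)" by (rule wfil_mult[OF wfil_monom step(2)])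
  then show ?case using wfil_add[OF wfil_const[of z L c], of "\<lambda>n. monom 1 n * t n"] by simp
qed (rule wfil_const)

lemma wfil_multiple:
  assumes "[:-z, 1:] dvd c"
  shows "wfil z L 2 (\<lambda>_. c)"
proof -
  obtain g where "c = g * [:-z, 1:]" using assms by (auto elim!: dvdE simp: mult.commute)
  then show ?thesis using wfil_scale[OF wfil_prime, of z L g] by simp
qed

context
  fixes z :: complex and L :: nat
  assumes zL: "z ^ L = 1"
begin

lemma root_dvd_monom_minus_1: "[:-z, 1:] dvd monom 1 (n * L) - 1"
  using zL by (simp add: poly_eq_0_iff_dvd[symmetric] poly_monom power_mult mult.commute)

text \<open>On generators: the \<open>L\<close>-difference of \<open>X ^ n\<close> is \<open>(X ^ L - 1) * X ^ n\<close>, and that of \<open>X ^ (n * L) - 1\<close> is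
  \<open>(X ^ (L * L) - 1) * X ^ (n * L)\<close>; both have the factor \<open>X - z\<close> of weight \<open>2\<close>. Products follow from the
  Leibniz rule.\<close>
lemma wfil_difference: "wfil z L k s \<Longrightarrow> wfil z L k (\<lambda>n. s (n + L)) \<and> wfil z L (Suc k) (\<lambda>n. s (n + L) - s n)"
proof (induction rule: wfil.induct)
  case (wfil_const c)
  show ?case using wfil.wfil_const wfil_zero by simp
next
  case wfil_monom
  have "wfil z L 2 (\<lambda>_. monom 1 L - 1)"
    by (rule wfil_multiple) (use root_dvd_monom_minus_1[of 1] in simp)
  from wfil_mult[OF this wfil.wfil_monom] have "wfil z L 2 (\<lambda>n. (monom 1 L - 1) * monom 1 n)" by simp
  moreover have "(monom 1 L - 1) * monom 1 n = monom 1 (n + L) - monom (1::complex) n" for n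
    by (simp add: algebra_simps mult_monom)
  ultimately have "wfil z L (Suc 0) (\<lambda>n. monom 1 (n + L) - monom 1 n)"
    by (intro wfil_mono[where k = 2 and j = "Suc 0"]) simp_all
  moreover have "wfil z L 0 (\<lambda>n. monom 1 (n + L))"
    using wfil_scale[OF wfil.wfil_monom, of z L "monom 1 L"] by (simp add: mult_monom add.commute)
  ultimately show ?case by simp
next
  case wfil_root
  have "wfil z L 2 (\<lambda>_. monom 1 (L * L) - 1)"
    by (rule wfil_multiple) (rule root_dvd_monom_minus_1)
  moreover have "wfil z L 0 (\<lambda>n. monom 1 (n * L))"
    using wfil_add[OF wfil_weaken[OF wfil.wfil_root[unfolded One_nat_def]] wfil_const[of z L 1]] by simp
  ultimately have "wfil z L (2 + 0) (\<lambda>n. (monom 1 (L * L) - 1) * monom 1 (n * L))"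
    by (rule wfil_mult)
  moreover have e: "(monom 1 (L * L) - 1) * monom 1 (n * L) = (monom 1 ((n + L) * L) - 1) - (monom (1::complex) (n * L) - 1)" for n
    by (simp add: algebra_simps mult_monom)
  ultimately have 2: "wfil z L 2 (\<lambda>n. (monom 1 ((n + L) * L) - 1) - (monom 1 (n * L) - 1))"
    by simp
  have "wfil z L 1 (\<lambda>n. ((monom 1 ((n + L) * L) - 1) - (monom 1 (n * L) - 1)) + (monom 1 (n * L) - 1))"
    by (rule wfil_add[OF wfil_mono[OF 2] wfil.wfil_root]) simp
  then show ?case using 2 by (simp add: numeral_2_eq_2)
next
  case wfil_prime
  show ?case using wfil.wfil_prime wfil_zero by simp
next
  case (wfil_add k s t)
  then have "wfil z L (Suc k) (\<lambda>n. (s (n + L) - s n) + (t (n + L) - t n))"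
    by (intro wfil.wfil_add) auto
  moreover have "(s (n + L) - s n) + (t (n + L) - t n) = s (n + L) + t (n + L) - (s n + t n)" for n by simp
  moreover have "wfil z L k (\<lambda>n. s (n + L) + t (n + L))" using wfil_add by (intro wfil.wfil_add) auto
  ultimately show ?case by simp
next
  case (wfil_mult j s k t)
  have "wfil z L (j + Suc k) (\<lambda>n. s (n + L) * (t (n + L) - t n))"
    using wfil_mult by (intro wfil.wfil_mult) auto
  moreover have "wfil z L (Suc j + k) (\<lambda>n. (s (n + L) - s n) * t n)"
    using wfil_mult by (intro wfil.wfil_mult) auto
  ultimately have "wfil z L (Suc (j + k)) (\<lambda>n. s (n + L) * (t (n + L) - t n) + (s (n + L) - s n) * t n)"
    by (intro wfil.wfil_add) simp_all
  moreover have "s (n + L) * (t (n + L) - t n) + (s (n + L) - s n) * t n = s (n + L) * t (n + L) - s n * t n" for n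
    by (simp add: algebra_simps)
  moreover have "wfil z L (j + k) (\<lambda>n. s (n + L) * t (n + L))"
    using wfil_mult by (intro wfil.wfil_mult) auto
  ultimately show ?case by simp
next
  case (wfil_weaken k s)
  then show ?case using wfil.wfil_weaken by blast
qed

lemma wfil_dvd: "wfil z L k s \<Longrightarrow> [:-z, 1:] ^ ((k + 1) div 2) dvd s n"
proof (induction arbitrary: n rule: wfil.induct)
  case wfil_root
  then show ?case using root_dvd_monom_minus_1 by simp
next
  case (wfil_mult j s k t)
  have "[:-z, 1:] ^ ((j + k + 1) div 2) dvd [:-z, 1:] ^ ((j + 1) div 2 + (k + 1) div 2)"
    by (rule le_imp_power_dvd) linarith
  also have "\<dots> dvd s n * t n" unfolding power_add by (intro mult_dvd_mono wfil_mult)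
  finally show ?case .
next
  case (wfil_weaken k s)
  have "[:-z, 1:] ^ ((k + 1) div 2) dvd [:-z, 1:] ^ ((Suc k + 1) div 2)"
    by (rule le_imp_power_dvd) linarith
  then show ?case using wfil_weaken(2) dvd_trans by blast
qed (auto intro: dvd_add)

end

lemma qtail_add:
  "\<exists>D. ypoly D \<and> (\<forall>n. qtail a l \<mu> (n + k) = (\<Prod>j<k. monom 1 (Suc j) * monom 1 n - [:l:]) * qtail a l \<mu> n + [:a ^ n:] * D n)"
proof (induction k)
  case 0
  show ?case by (rule exI[of _ "\<lambda>_. 0"]) simp
next
  case (Suc k)
  from Suc obtain D where D: "ypoly D" "\<forall>n. qtail a l \<mu> (n + k) = (\<Prod>j<k. monom 1 (Suc j) * monom 1 n - [:l:]) * qtail a l \<mu> n + [:a ^ n:] * D n"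
    by blast
  let ?D = "\<lambda>n. (monom 1 (Suc k) * monom 1 n - [:l:]) * (D n - [:a ^ k:])"
  have "ypoly ?D" by (intro ypoly_mult ypoly_diff ypoly_const ypoly_monom D(1))
  moreover have "qtail a l \<mu> (n + Suc k) = (\<Prod>j<Suc k. monom 1 (Suc j) * monom 1 n - [:l:]) * qtail a l \<mu> n + [:a ^ n:] * ?D n" for n
  proof -
    have "qtail a l \<mu> (n + Suc k) = (monom 1 (Suc k) * monom 1 n - [:l:]) * (qtail a l \<mu> (n + k) - [:a ^ n:] * [:a ^ k:])"
      by (simp add: mult_monom power_add add.commute)
    then show ?thesis unfolding D(2)[rule_format] prod.lessThan_Suc by (simp only: algebra_simps)
  qed
  ultimately show ?case by blast
qed

definition prim_root :: "nat \<Rightarrow> complex \<Rightarrow> bool" where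
  "prim_root L z \<longleftrightarrow> 0 < L \<and> z ^ L = 1 \<and> (\<forall>k. 0 < k \<and> k < L \<longrightarrow> z ^ k \<noteq> 1)"

lemma pcompose_monom: "pcompose (monom c k) p = smult c (p ^ k)"
  by (induction k) (auto simp: monom_0 monom_Suc pcompose_pCons)

text \<open>The product over a full period is invariant under \<open>Y \<mapsto> z * Y\<close>, so only exponents divisible by \<open>L\<close> occur.\<close>
lemma prod_linear_prim_root:
  assumes "prim_root L z"
  shows "\<exists>c0 c1. (\<Prod>j<L. [:-l, z ^ Suc j:]) = [:c0:] + monom c1 L"
proof -
  let ?p = "\<Prod>j<L. [:-l, z ^ Suc j:]"
  have L: "0 < L" "z ^ L = 1" "\<And>k. 0 < k \<Longrightarrow> k < L \<Longrightarrow> z ^ k \<noteq> 1" using assms by (auto simp: prim_root_def)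
  have "pcompose ?p [:0, z:] = (\<Prod>j<L. [:-l, z ^ Suc (Suc j):])"
    by (simp add: pcompose_prod pcompose_pCons mult.commute)
  also have "\<dots> = ?p"
  proof -
    have "[:-l, z ^ Suc 0:] * (\<Prod>j<L. [:-l, z ^ Suc (Suc j):]) = (\<Prod>j<Suc L. [:-l, z ^ Suc j:])"
      by (simp only: prod.lessThan_Suc_shift)
    also have "\<dots> = [:-l, z ^ Suc 0:] * ?p"
      unfolding prod.lessThan_Suc using L(2) by (simp add: mult.commute)
    finally show ?thesis
      by (subst (asm) mult_left_cancel) (use L in \<open>auto simp: power_0_left\<close>)
  qed
  finally have inv: "pcompose ?p [:0, z:] = ?p" .
  have deg: "degree ?p \<le> L"
    by (rule order.trans[OF degree_prod_sum_le]) (auto simp: o_def intro: order.trans[OF sum_mono[of _ _ "\<lambda>_. 1"]])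
  have "coeff ?p k = coeff ([:coeff ?p 0:] + monom (coeff ?p L) L) k" for k
  proof -
    consider "k = 0" | "0 < k" "k < L" | "k = L" | "k > L" by linarith
    then show ?thesis
    proof cases
      case 2
      have "z ^ k * coeff ?p k = coeff ?p k" using arg_cong[OF inv, of "\<lambda>p. coeff p k"]
        by (simp add: coeff_pcompose_linear)
      then have "coeff ?p k = 0" using L(3)[OF 2] by simp
      then show ?thesis using 2 by (simp add: coeff_pCons split: nat.split)
    next
      case 4
      then have "coeff ?p k = 0" by (intro coeff_eq_0) (use deg in linarith)
      then show ?thesis using 4 by (simp add: coeff_pCons split: nat.split)
    qed (use L(1) in \<open>auto simp: coeff_pCons split: nat.split\<close>)
  qed
  then show ?thesis by (metis poly_eqI)
qed

lemma wfil_prod_cong: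
  assumes "\<And>j. j < (m::nat) \<Longrightarrow> wfil z L 0 (f j)" "\<And>j. j < m \<Longrightarrow> wfil z L 0 (g j)"
    and "\<And>j. j < m \<Longrightarrow> wfil z L 2 (\<lambda>n. f j n - g j n)"
  shows "wfil z L 0 (\<lambda>n. \<Prod>j<m. g j n) \<and> wfil z L 2 (\<lambda>n. (\<Prod>j<m. f j n) - (\<Prod>j<m. g j n))"
  using assms
proof (induction m)
  case 0
  show ?case using wfil_const[of z L 1] wfil_zero[of z L 2] by simp
next
  case (Suc m)
  let ?F = "\<lambda>n. \<Prod>j<m. f j n" and ?G = "\<lambda>n. \<Prod>j<m. g j n"
  have IH: "wfil z L 0 ?G" "wfil z L 2 (\<lambda>n. ?F n - ?G n)" using Suc by auto
  have "wfil z L (2 + 0) (\<lambda>n. (?F n - ?G n) * f m n)" by (rule wfil_mult[OF IH(2)]) (use Suc in simp)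
  moreover have "wfil z L (0 + 2) (\<lambda>n. ?G n * (f m n - g m n))" by (rule wfil_mult[OF IH(1)]) (use Suc in simp)
  ultimately have "wfil z L 2 (\<lambda>n. (?F n - ?G n) * f m n + ?G n * (f m n - g m n))"
    by (intro wfil_add) (simp_all add: numeral_2_eq_2)
  moreover have "(?F n - ?G n) * f m n + ?G n * (f m n - g m n) = ?F n * f m n - ?G n * g m n" for n
    by (simp add: algebra_simps)
  moreover have "wfil z L (0 + 0) (\<lambda>n. ?G n * g m n)" by (rule wfil_mult[OF IH(1)]) (use Suc in simp)
  ultimately show ?case by simp
qed

text \<open>The multiplier of \<open>qtail n\<close> in \<open>qtail (n + L)\<close> is constant up to weight \<open>1\<close>: replacing the powers \<open>X ^ (j + 1)\<close> by
  \<open>z ^ (j + 1)\<close> changes it by weight \<open>2\<close>, and what remains is \<open>c0 + c1 * X ^ (n * L)\<close>.\<close>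
lemma wfil_multiplier:
  assumes "prim_root L z"
  shows "\<exists>c. wfil z L 1 (\<lambda>n. (\<Prod>j<L. monom 1 (Suc j) * monom 1 n - [:l:]) - [:c:])"
proof -
  obtain c0 c1 where c: "(\<Prod>j<L. [:-l, z ^ Suc j:]) = [:c0:] + monom c1 L"
    using prod_linear_prim_root[OF assms] by blast
  let ?f = "\<lambda>j n. monom 1 (Suc j) * monom 1 n - [:l:]" and ?g = "\<lambda>j n. [:z ^ Suc j:] * monom 1 n - [:l:]"
  have "wfil z L 2 (\<lambda>n. (\<Prod>j<L. ?f j n) - (\<Prod>j<L. ?g j n))"
  proof (rule conjunct2[OF wfil_prod_cong])
    fix j
    show "wfil z L 0 (?f j)" "wfil z L 0 (?g j)"
      by (intro wfil_diff wfil_scale wfil_monom wfil_const)+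
    have "wfil z L 2 (\<lambda>_. monom 1 (Suc j) - [:z ^ Suc j:])"
      by (rule wfil_multiple) (simp add: poly_eq_0_iff_dvd[symmetric] poly_monom)
    from wfil_mult[OF this wfil_monom] show "wfil z L 2 (\<lambda>n. ?f j n - ?g j n)"
      by (simp only: add_0_right algebra_simps) (simp add: algebra_simps numeral_2_eq_2)
  qed
  moreover have "(\<Prod>j<L. ?g j n) = [:c0 + c1:] + [:c1:] * (monom 1 (n * L) - 1)" for n
  proof -
    have "(\<Prod>j<L. ?g j n) = pcompose (\<Prod>j<L. [:-l, z ^ Suc j:]) (monom 1 n)"
      unfolding pcompose_prod
      by (intro prod.cong refl) (simp add: pcompose_pCons mult.commute diff_conv_add_uminus add.commute)
    also have "\<dots> = [:c0:] + [:c1:] * monom 1 (n * L)"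
      unfolding c by (simp add: pcompose_add pcompose_monom monom_power)
    finally show ?thesis by (simp add: algebra_simps one_pCons smult_monom)
  qed
  ultimately have "wfil z L 1 (\<lambda>n. ((\<Prod>j<L. ?f j n) - ([:c0 + c1:] + [:c1:] * (monom 1 (n * L) - 1))) + [:c1:] * (monom 1 (n * L) - 1))"
    by (intro wfil_add wfil_scale wfil_root) (auto intro: wfil_mono)
  moreover have "(p - (k + e)) + e = p - k" for p k e :: "complex poly" by simp
  ultimately have "wfil z L 1 (\<lambda>n. (\<Prod>j<L. ?f j n) - [:c0 + c1:])" by (simp only:)
  then show ?thesis by blast
qed

lemma act_monom_minus_const: "act ((monom 1 k - [:c:]) * P) v n = act P v (n + k) - c * act P v n"
proof -
  have "act (monom 1 k * P + smult (-c) P) v n = act P v (n + k) - c * act P v n"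
    by (simp add: act_add_left act_monom_mult act_smult del: smult_minus_left)
  then show ?thesis by (simp add: algebra_simps)
qed

text \<open>After the operators have been applied, the result is a combination of \<open>qtail n\<close> and \<open>a ^ n\<close>.
  Each operator shift by \<open>L\<close> minus \<open>c\<close> raises the weight of the multiplier of \<open>qtail n\<close> by one, and leaves an
  uncontrolled multiple of \<open>a ^ n\<close>. Each operator shift by \<open>L\<close> minus \<open>a ^ L\<close> then produces a full factor
  \<open>X - z\<close> in that multiple, up to terms of the weight reached before.\<close>
lemma act_shift_ops_dvd:
  assumes prim: "prim_root L z"
  shows "\<exists>c. \<forall>i b n. [:-z, 1:] ^ min i ((b + 1) div 2) dvd
    act ((monom 1 L - [:[:a ^ L:]:]) ^ i * (monom 1 L - [:[:c:]:]) ^ b) (qtail a l \<mu>) n"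
proof -
  let ?v = "qtail a l \<mu>" and ?A = "monom 1 L - [:[:a ^ L:]:]"
  have zL: "z ^ L = 1" using prim by (simp add: prim_root_def)
  define C where "C n = (\<Prod>j<L. monom 1 (Suc j) * monom 1 n - [:l:])" for n
  obtain c where c: "wfil z L 1 (\<lambda>n. C n - [:c:])" using wfil_multiplier[OF prim] unfolding C_def by blast
  have C: "wfil z L 0 C"
    using wfil_add[OF wfil_mono[OF c, of 0] wfil_const[of z L "[:c:]"]] by simp
  obtain D where D: "ypoly D" "\<forall>n. ?v (n + L) = C n * ?v n + [:a ^ n:] * D n"
    using qtail_add[of a l \<mu> L] unfolding C_def by blast
  define an where "an n = [:a ^ n:]" for n
  define aL where "aL = [:a ^ L:]"
  define c' where "c' = [:c:]"
  have c': "wfil z L 1 (\<lambda>n. C n - c')" unfolding c'_def by (rule c)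
  have an: "an (n + L) = aL * an n" for n by (simp add: an_def aL_def power_add mult.commute)
  have v: "?v (n + L) = C n * ?v n + an n * D n" for n using D(2) by (simp add: an_def)
  let ?B = "monom 1 L - [:c':]"
  have B: "\<exists>r t. wfil z L b r \<and> ypoly t \<and> (\<forall>n. act (?B ^ b) ?v n = ?v n * r n + an n * t n)" for b
  proof (induction b)
    case 0
    show ?case by (rule exI[of _ "\<lambda>_. 1"], rule exI[of _ "\<lambda>_. 0"]) (simp add: wfil_const)
  next
    case (Suc b)
    then obtain r t where rt: "wfil z L b r" "ypoly t" "\<forall>n. act (?B ^ b) ?v n = ?v n * r n + an n * t n" by blast
    let ?r = "\<lambda>n. (C n - c') * r (n + L) + c' * (r (n + L) - r n)"
    let ?t = "\<lambda>n. D n * r (n + L) + (aL * t (n + L) - c' * t n)"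
    have "wfil z L (1 + b) (\<lambda>n. (C n - c') * r (n + L))"
      by (rule wfil_mult[OF c']) (use wfil_difference[OF zL rt(1)] in blast)
    moreover have "wfil z L (1 + b) (\<lambda>n. c' * (r (n + L) - r n))"
      by (rule wfil_scale) (use wfil_difference[OF zL rt(1)] in simp)
    ultimately have r: "wfil z L (Suc b) ?r" unfolding plus_1_eq_Suc by (rule wfil_add)
    have t: "ypoly ?t"
      by (intro ypoly_add ypoly_mult ypoly_diff ypoly_const D(1) ypoly_shift[OF rt(2)] rt(2)
          ypoly_shift[OF wfil_imp_ypoly[OF rt(1)]])
    have "act (?B ^ Suc b) ?v n = ?v n * ?r n + an n * ?t n" for n
    proof -
      have "act (?B ^ Suc b) ?v n = act (?B ^ b) ?v (n + L) - c' * act (?B ^ b) ?v n"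
        unfolding power_Suc by (rule act_monom_minus_const)
      also have "\<dots> = ?v n * ?r n + an n * ?t n"
        unfolding rt(3)[rule_format] v an by (simp add: algebra_simps)
      finally show ?thesis .
    qed
    then show ?case using r t by blast
  qed
  have A: "\<exists>r u t. wfil z L b r \<and> wfil z L b u \<and> ypoly t \<and>
      (\<forall>n. act (?A ^ i * ?B ^ b) ?v n = ?v n * r n + an n * u n + an n * ([:-z, 1:] ^ i * t n))" for i b
  proof (induction i)
    case 0
    from B[of b] obtain r t where "wfil z L b r" "ypoly t" "\<forall>n. act (?B ^ b) ?v n = ?v n * r n + an n * t n" by blast
    then show ?case
      by (intro exI[of _ r] exI[of _ "\<lambda>_. 0"] exI[of _ t]) (simp add: wfil_zero)
  next
    case (Suc i)
    then obtain r u t where rut: "wfil z L b r" "wfil z L b u" "ypoly t"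
      "\<forall>n. act (?A ^ i * ?B ^ b) ?v n = ?v n * r n + an n * u n + an n * ([:-z, 1:] ^ i * t n)" by blast
    obtain t' where t': "ypoly t'" "\<forall>n. t (n + L) - t n = [:-z, 1:] * t' n"
      using ypoly_difference_root_of_unity[OF rut(3) zL] by blast
    have tt: "t (n + L) = t n + [:-z, 1:] * t' n" for n using t'(2)[rule_format, of n] by (simp add: algebra_simps)
    let ?r = "\<lambda>n. C n * r (n + L) - aL * r n"
    let ?u = "\<lambda>n. D n * r (n + L) + aL * (u (n + L) - u n)"
    have rL: "wfil z L b (\<lambda>n. r (n + L))" and uL: "wfil z L b (\<lambda>n. u (n + L))"
      using wfil_difference[OF zL rut(1)] wfil_difference[OF zL rut(2)] by auto
    have r: "wfil z L b ?r"
      using wfil_mult[OF C rL] by (intro wfil_diff wfil_scale rut(1)) simp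
    have u: "wfil z L b ?u"
      using wfil_mult[OF ypoly_imp_wfil[OF D(1)] rL] by (intro wfil_add wfil_scale wfil_diff uL rut(2)) simp
    have "act (?A ^ Suc i * ?B ^ b) ?v n = ?v n * ?r n + an n * ?u n + an n * ([:-z, 1:] ^ Suc i * (aL * t' n))" for n
    proof -
      have "act (?A ^ Suc i * ?B ^ b) ?v n = act (?A ^ i * ?B ^ b) ?v (n + L) - aL * act (?A ^ i * ?B ^ b) ?v n"
        unfolding power_Suc aL_def mult.assoc by (rule act_monom_minus_const)
      also have "\<dots> = ?v n * ?r n + an n * ?u n + an n * ([:-z, 1:] ^ Suc i * (aL * t' n))"
        unfolding rut(4)[rule_format] v an tt power_Suc by (simp only: algebra_simps)
      finally show ?thesis .
    qed
    moreover have "ypoly (\<lambda>n. aL * t' n)" by (intro ypoly_mult ypoly_const t'(1))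
    ultimately show ?case using r u by blast
  qed
  have "[:-z, 1:] ^ min i ((b + 1) div 2) dvd act (?A ^ i * ?B ^ b) ?v n" for i b n
  proof -
    obtain r u t where rut: "wfil z L b r" "wfil z L b u"
      "\<forall>n. act (?A ^ i * ?B ^ b) ?v n = ?v n * r n + an n * u n + an n * ([:-z, 1:] ^ i * t n)"
      using A by blast
    have d: "[:-z, 1:] ^ min i ((b + 1) div 2) dvd [:-z, 1:] ^ ((b + 1) div 2)"
      "[:-z, 1:] ^ min i ((b + 1) div 2) dvd [:-z, 1:] ^ i" by (simp_all add: le_imp_power_dvd)
    show ?thesis
      unfolding rut(3)[rule_format]
      by (intro dvd_add dvd_mult dvd_mult2[OF d(2)] dvd_trans[OF d(1) wfil_dvd[OF zL rut(1)]]
          dvd_trans[OF d(1) wfil_dvd[OF zL rut(2)]])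
  qed
  then show ?thesis unfolding c'_def by blast
qed

text \<open>This is \<open>2 * t / 3\<close> rounded down, written as the number of \<open>J \<le> t\<close> that are positive multiples of \<open>3\<close> or
  congruent to \<open>2\<close> modulo \<open>3\<close>.\<close>
definition cweight :: "nat \<Rightarrow> nat" where
  "cweight t = (t + 1) div 3 + t div 3"

lemma cweight_le: "3 * cweight t \<le> 2 * t"
proof -
  have *: "3 * A \<le> t + 1 \<Longrightarrow> 3 * B \<le> t \<Longrightarrow> 3 * (A + B) \<le> 2 * t" for A B :: nat
    by arith
  have "3 * ((t + 1) div 3) \<le> t + 1" "3 * (t div 3) \<le> t" by simp_all
  then show ?thesis unfolding cweight_def by (rule *)
qed

text \<open>Row \<open>i\<close> has room for \<open>i div L\<close> operators with step \<open>L\<close>. Of these, \<open>w i\<close> are of the kind that gains half a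
  factor \<open>X - z\<close>, and \<open>x i\<close> of the kind that gains a full one. The entry with indices \<open>i\<close> and \<open>j\<close> is
  divisible by the smaller of the two resulting powers; the balance \<open>w i \<le> 2 * x i\<close> is optimal, which explains the
  proportion \<open>2 / 3\<close> in \<open>cweight\<close>.\<close>
lemma cyclotomic_power_dvd_qhankel:
  assumes prim: "prim_root L z"
  shows "[:-z, 1:] ^ (\<Sum>i<n. cweight (i div L)) dvd qhankel a l \<mu> s n"
proof -
  have L: "0 < L" using prim by (simp add: prim_root_def)
  obtain c where c: "\<And>i b n. [:-z, 1:] ^ min i ((b + 1) div 2) dvd
    act ((monom 1 L - [:[:a ^ L:]:]) ^ i * (monom 1 L - [:[:c:]:]) ^ b) (qtail a l \<mu>) n"
    using act_shift_ops_dvd[OF prim, of a l \<mu>] by blast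
  let ?A = "monom 1 L - [:[:a ^ L:]:]" and ?B = "monom 1 L - [:[:c:]:]"
  define w where "w i = cweight (i div L)" for i
  define x where "x i = i div L - w i" for i
  have wx: "w i + x i = i div L" "w i \<le> 2 * x i" for i
  proof -
    have "3 * cweight (i div L) \<le> 2 * (i div L)" by (rule cweight_le)
    then show "w i + x i = i div L" "w i \<le> 2 * x i" unfolding x_def w_def by linarith+
  qed
  define P where "P i = monom 1 (i mod L) * (?A ^ x i * ?B ^ w i)" for i
  have mon: "degree (monom 1 L - [:d:]) = L \<and> lead_coeff (monom 1 L - [:d:]) = 1" for d :: "complex poly"
  proof -
    have "degree (monom 1 L - [:d:]) = L"
      using L unfolding diff_conv_add_uminus by (subst degree_add_eq_left) (auto simp: degree_monom_eq)
    then show ?thesis using L by (simp add: coeff_pCons split: nat.split)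
  qed
  have P: "degree (P i) = i \<and> lead_coeff (P i) = 1" for i
  proof -
    have "?A ^ x i \<noteq> 0" "?B ^ w i \<noteq> 0" using mon by (metis leading_coeff_0_iff power_not_zero zero_neq_one)+
    moreover have "degree (?A ^ x i) = L * x i" "degree (?B ^ w i) = L * w i"
      using mon by (metis degree_power_eq leading_coeff_0_iff mult.commute zero_neq_one)+
    ultimately have "degree (?A ^ x i * ?B ^ w i) = L * (w i + x i)"
      by (simp add: degree_mult_eq algebra_simps)
    moreover have "lead_coeff (?A ^ x i * ?B ^ w i) = 1"
      unfolding lead_coeff_mult lead_coeff_power conjunct2[OF mon] by simp
    ultimately show ?thesis
      unfolding P_def using monic_monom_mult[of "?A ^ x i * ?B ^ w i" _ "i mod L"] wx(1)[of i] by auto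
  qed
  have "qhankel a l \<mu> s n = ndet n (\<lambda>i j. act (P i * P j) (\<lambda>i. qtail a l \<mu> (i + s)) 0)"
    unfolding qhankel_def by (rule hankel_ndet_change_basis; rule P)
  moreover have "[:-z, 1:] ^ (\<Sum>i<n. w i) dvd ndet n (\<lambda>i j. act (P i * P j) (\<lambda>i. qtail a l \<mu> (i + s)) 0)"
  proof (rule power_dvd_ndet[where m = "\<lambda>i j. (w i + w j + 1) div 2"])
    fix i j
    have "P i * P j = monom 1 (i mod L) * (monom 1 (j mod L) * (?A ^ (x i + x j) * ?B ^ (w i + w j)))"
      unfolding P_def power_add by (simp only: mult_ac)
    then have "act (P i * P j) (\<lambda>i. qtail a l \<mu> (i + s)) 0
        = act (?A ^ (x i + x j) * ?B ^ (w i + w j)) (\<lambda>i. qtail a l \<mu> (i + s)) (0 + i mod L + j mod L)"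
      by (simp only: act_monom_mult)
    also have "\<dots> = act (?A ^ (x i + x j) * ?B ^ (w i + w j)) (qtail a l \<mu>) (0 + i mod L + j mod L + s)"
      by (rule act_shift[symmetric])
    finally have "[:-z, 1:] ^ min (x i + x j) ((w i + w j + 1) div 2) dvd act (P i * P j) (\<lambda>i. qtail a l \<mu> (i + s)) 0"
      using c by simp
    moreover have "min (x i + x j) ((w i + w j + 1) div 2) = (w i + w j + 1) div 2"
      using wx(2)[of i] wx(2)[of j] by linarith
    ultimately show "[:-z, 1:] ^ ((w i + w j + 1) div 2) dvd act (P i * P j) (\<lambda>i. qtail a l \<mu> (i + s)) 0" by simp
  next
    fix p assume p: "p permutes {0..<n}"
    have "2 * (\<Sum>i<n. w i) = (\<Sum>i<n. w i + w (p i))"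
      using sum.permute[OF p, of w] by (simp add: sum.distrib o_def lessThan_atLeast0)
    also have "\<dots> \<le> (\<Sum>i<n. 2 * ((w i + w (p i) + 1) div 2))"
      by (rule sum_mono) linarith
    finally show "(\<Sum>i<n. w i) \<le> (\<Sum>i<n. (w i + w (p i) + 1) div 2)"
      by (simp add: sum_distrib_left[symmetric])
  qed
  ultimately show ?thesis unfolding w_def by simp
qed

section \<open>Cyclotomic polynomials\<close>

lemma prod_linear_power_dvd:
  fixes p :: "complex poly"
  assumes "finite S" "\<And>z. z \<in> S \<Longrightarrow> [:-z, 1:] ^ e z dvd p"
  shows "(\<Prod>z\<in>S. [:-z, 1:] ^ e z) dvd p"
  using assms
proof (induction S rule: finite_induct)
  case (insert z S)
  let ?P = "\<Prod>z\<in>S. [:-z, 1:] ^ e z"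
  from insert obtain r where r: "p = ?P * r" by (auto elim!: dvdE)
  show ?case
  proof (cases "r = 0")
    case False
    have P: "poly ?P z \<noteq> 0" using insert(1,2) by (auto simp: poly_prod)
    then have "?P \<noteq> 0" by auto
    with False have "order z p = order z ?P + order z r" unfolding r by (intro order_mult) simp
    moreover have "order z ?P = 0" using P by (simp add: order_root)
    moreover have "p \<noteq> 0" using r False \<open>?P \<noteq> 0\<close> by simp
    moreover have "[:-z, 1:] ^ e z dvd p" using insert by simp
    ultimately have "[:-z, 1:] ^ e z dvd r" using False by (simp add: order_divides)
    then show ?thesis unfolding r prod.insert[OF insert(1,2)] by (subst mult.commute) (intro mult_dvd_mono dvd_refl)
  qed (simp add: r)
qed simp

text \<open>The cyclotomic polynomial of order \<open>L\<close>.\<close>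
definition cyclo :: "nat \<Rightarrow> complex poly" where
  "cyclo L = (\<Prod>z | prim_root L z. [:-z, 1:])"

lemma finite_prim_roots: "finite {z. prim_root L z}"
proof (cases "L = 0")
  case False
  have "{z. prim_root L z} \<subseteq> {z. z ^ L = 1}" by (auto simp: prim_root_def)
  moreover have "finite {z::complex. z ^ L = 1}" using False by (simp add: finite_roots_unity)
  ultimately show ?thesis by (rule finite_subset)
qed (simp add: prim_root_def)

lemma prim_root_unique: "prim_root L z \<Longrightarrow> prim_root M z \<Longrightarrow> L = M"
  unfolding prim_root_def using linorder_neqE_nat by blast

lemma prim_root_dvd: "prim_root L z \<Longrightarrow> z ^ m = 1 \<longleftrightarrow> L dvd m"
proof
  assume p: "prim_root L z" and m: "z ^ m = 1"
  have "z ^ (m mod L) = 1"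
  proof -
    have "z ^ m = z ^ (L * (m div L) + m mod L)" by simp
    also have "\<dots> = z ^ (m mod L)" unfolding power_add power_mult using p by (simp add: prim_root_def)
    finally show ?thesis using m by simp
  qed
  moreover have "m mod L < L" "\<forall>k. 0 < k \<and> k < L \<longrightarrow> z ^ k \<noteq> 1" using p by (auto simp: prim_root_def)
  ultimately have "m mod L = 0" by auto
  then show "L dvd m" by auto
qed (auto simp: prim_root_def power_mult elim!: dvdE)

lemma prim_root_exists:
  assumes "z ^ m = 1" "0 < m"
  shows "\<exists>L. prim_root L z"
proof -
  define L where "L = (LEAST k. 0 < k \<and> z ^ k = 1)"
  have "0 < L \<and> z ^ L = 1" unfolding L_def by (rule LeastI[of _ m]) (use assms in simp)
  moreover have "z ^ k \<noteq> 1" if "0 < k" "k < L" for k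
    using not_less_Least[of k "\<lambda>k. 0 < k \<and> z ^ k = 1"] that unfolding L_def by auto
  ultimately show ?thesis unfolding prim_root_def by blast
qed

lemma lead_coeff_cyclo: "lead_coeff (cyclo L) = 1"
  unfolding cyclo_def by (subst lead_coeff_prod) simp

lemma prod_cyclo:
  assumes "0 < m"
  shows "(\<Prod>L | L dvd m. cyclo L) = monom 1 m - 1"
proof -
  let ?Z = "{z::complex. z ^ m = 1}"
  have fin: "finite ?Z" using assms by (simp add: finite_roots_unity)
  have "?Z = (\<Union>L\<in>{L. L dvd m}. {z. prim_root L z})"
  proof (intro Set.set_eqI iffI)
    fix z assume "z \<in> ?Z"
    then obtain L where "prim_root L z" using prim_root_exists[of z m] assms by auto
    then show "z \<in> (\<Union>L\<in>{L. L dvd m}. {z. prim_root L z})" using prim_root_dvd[of L z m] \<open>z \<in> ?Z\<close> by auto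
  next
    fix z :: complex assume "z \<in> (\<Union>L\<in>{L. L dvd m}. {z. prim_root L z})"
    then obtain L where "prim_root L z" "L dvd m" by auto
    then show "z \<in> ?Z" using prim_root_dvd[of L z m] by simp
  qed
  then have 1: "(\<Prod>L | L dvd m. cyclo L) = (\<Prod>z\<in>?Z. [:-z, 1:])"
  proof -
    have "\<forall>L\<in>{L. L dvd m}. \<forall>M\<in>{L. L dvd m}. L \<noteq> M \<longrightarrow> {z. prim_root L z} \<inter> {z. prim_root M z} = {}"
      by (auto dest: prim_root_unique)
    moreover have "finite {L. L dvd m}" using assms by simp
    ultimately show ?thesis
      unfolding cyclo_def \<open>?Z = _\<close> using finite_prim_roots by (subst prod.UNION_disjoint) simp_all
  qed
  have "(\<Prod>z\<in>?Z. [:-z, 1:] ^ 1) dvd monom 1 m - 1"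
    by (rule prod_linear_power_dvd[OF fin]) (simp add: poly_eq_0_iff_dvd[symmetric] poly_monom)
  then obtain r where r: "monom 1 m - 1 = (\<Prod>z\<in>?Z. [:-z, 1:]) * r" by (auto elim!: dvdE)
  have deg: "degree (monom 1 m - (1 :: complex poly)) = m" "lead_coeff (monom 1 m - (1 :: complex poly)) = 1"
  proof -
    show "degree (monom 1 m - (1 :: complex poly)) = m"
      using assms unfolding diff_conv_add_uminus by (subst degree_add_eq_left) (auto simp: degree_monom_eq)
    then show "lead_coeff (monom 1 m - (1 :: complex poly)) = 1" using assms by simp
  qed
  have "degree (\<Prod>z\<in>?Z. [:-z, 1:]) = m"
    using card_roots_unity_eq[OF assms] by (simp add: degree_prod_eq_sum_degree)
  moreover have "r \<noteq> 0" using r deg(2) by auto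
  moreover have "(\<Prod>z\<in>?Z. [:-z, 1:]) \<noteq> 0" using fin by auto
  ultimately have "degree r = 0" using deg(1) unfolding r by (simp add: degree_mult_eq)
  then obtain c where c: "r = [:c:]" by (rule degree_eq_zeroE)
  have "lead_coeff (\<Prod>z\<in>?Z. [:-z, 1:]) * lead_coeff r = 1"
    using deg(2) unfolding r lead_coeff_mult .
  then have "r = 1" unfolding c lead_coeff_prod by (simp add: one_pCons)
  then show ?thesis using 1 r by simp
qed

lemma poly_cyclo_nonzero: "norm q > 1 \<Longrightarrow> poly (cyclo L) q \<noteq> 0"
proof
  assume q: "norm q > 1" and "poly (cyclo L) q = 0"
  then have "prim_root L q"
    unfolding cyclo_def poly_prod using finite_prim_roots by (auto simp: prod_zero_iff)
  then have "norm q ^ L = 1" "0 < L" by (auto simp: prim_root_def norm_power[symmetric])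
  then show False using q one_less_power[of "norm q" L] by simp
qed

section \<open>Averages over divisors\<close>

text \<open>Both sides sum over the pairs \<open>(e, L)\<close> with \<open>e * L \<le> y\<close>.\<close>
lemma sum_floor_quotients:
  fixes g :: "nat \<Rightarrow> real"
  shows "(\<Sum>e=1..y. \<Sum>L=1..y div e. g L) = (\<Sum>d=1..y. \<Sum>L | L dvd d. g L)"
proof -
  have "(\<Sum>e=1..y. \<Sum>L=1..y div e. g L) = (\<Sum>(e, L)\<in>(SIGMA e:{1..y}. {1..y div e}). g L)"
    by (rule sum.Sigma) auto
  also have "\<dots> = (\<Sum>(d, L)\<in>(SIGMA d:{1..y}. {L. L dvd d}). g L)"
  proof (rule sum.reindex_bij_witness[where i = "\<lambda>(d, L). (d div L, L)" and j = "\<lambda>(e, L). (e * L, L)"])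
    fix a assume "a \<in> (SIGMA e:{1..y}. {1..y div e})"
    then obtain e L where a: "a = (e, L)" "1 \<le> e" "1 \<le> L" "L \<le> y div e" by auto
    then have "e * L \<le> y" by (metis less_eq_div_iff_mult_less_eq mult.commute zero_less_one_class.zero_less_one order_less_le_trans)
    then show "(case a of (e, L) \<Rightarrow> (e * L, L)) \<in> (SIGMA d:{1..y}. {L. L dvd d})" using a by auto
    show "(case case a of (e, L) \<Rightarrow> (e * L, L) of (d, L) \<Rightarrow> (d div L, L)) = a" using a by auto
    show "(case case a of (e, L) \<Rightarrow> (e * L, L) of (d, L) \<Rightarrow> g L) = (case a of (e, L) \<Rightarrow> g L)" using a by auto
  next
    fix b assume "b \<in> (SIGMA d:{1..y}. {L. L dvd d})"
    then obtain d L where b: "b = (d, L)" "1 \<le> d" "d \<le> y" "L dvd d" by auto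
    then obtain e where e: "d = e * L" by (auto elim!: dvdE simp: mult.commute)
    then have "1 \<le> e" "1 \<le> L" using b(2) by (auto simp: Suc_le_eq)
    moreover have "L \<le> y div e" using b(3) e calculation by (simp add: less_eq_div_iff_mult_less_eq mult.commute)
    moreover have "e \<le> y"
    proof -
      have "e \<le> e * L" using \<open>1 \<le> L\<close> by (cases L) auto
      then show ?thesis using b(3) unfolding e by (rule order.trans)
    qed
    ultimately show "(case b of (d, L) \<Rightarrow> (d div L, L)) \<in> (SIGMA e:{1..y}. {1..y div e})"
      "(case case b of (d, L) \<Rightarrow> (d div L, L) of (e, L) \<Rightarrow> (e * L, L)) = b"
      using b e by auto
  qed
  also have "\<dots> = (\<Sum>d=1..y. \<Sum>L | L dvd d. g L)"
    by (rule sum.Sigma[symmetric]) auto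
  finally show ?thesis .
qed

lemma sum_inverse_le_sqrt: "(\<Sum>e=1..y. 1 / real e) \<le> 2 * sqrt (real y)"
proof (induction y)
  case (Suc y)
  have "1 / real (Suc y) \<le> 2 * sqrt (real (Suc y)) - 2 * sqrt (real y)"
  proof -
    define a b where "a = sqrt (real (Suc y))" and "b = sqrt (real y)"
    have ab: "1 \<le> a" "0 \<le> b" "b \<le> a" "a * a = real y + 1" "b * b = real y" unfolding a_def b_def by auto
    have "1 = (a - b) * (a + b)" using ab(4,5) by (simp add: algebra_simps)
    also have "\<dots> \<le> (a - b) * (2 * a)" using ab(3) by (intro mult_left_mono) simp_all
    also have "\<dots> \<le> (a - b) * (2 * (a * a))"
      using ab(1,3) by (intro mult_left_mono) simp_all
    finally have "1 \<le> 2 * (a - b) * (a * a)" by (simp only: mult_ac)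
    moreover have "0 < a * a" using ab(1) by (intro mult_pos_pos) linarith+
    ultimately have "1 / (a * a) \<le> 2 * (a - b)" by (simp only: pos_divide_le_eq)
    moreover have "real (Suc y) = a * a" using ab(4) by simp
    ultimately have "1 / real (Suc y) \<le> 2 * (a - b)" by (simp only:)
    then show ?thesis unfolding a_def b_def by (simp only: right_diff_distrib)
  qed
  then show ?case using Suc by simp
qed simp

lemma sum_inverse_squares_from_2_le: "(\<Sum>e=2..y. 1 / (real e)\<^sup>2) \<le> 3 / 4"
proof (cases "2 \<le> y")
  case True
  then have "(\<Sum>e=2..y. 1 / (real e)\<^sup>2) \<le> 3 / 4 - 1 / real y"
  proof (induction y rule: nat_induct_at_least)
    case (Suc n)
    have "1 / (real (Suc n))\<^sup>2 \<le> 1 / real n - 1 / real (Suc n)"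
      using Suc(1) by (simp add: divide_simps power2_eq_square)
    then show ?case using Suc by simp
  qed simp
  then show ?thesis using order.trans[of _ "3 / 4 - 1 / real y" "3 / 4"] by simp
qed simp

lemma sqrt_growth: "\<eta> > 0 \<Longrightarrow> real y * sqrt (real y) \<le> \<eta> * (real y)\<^sup>2 + 1 / \<eta> ^ 3"
proof -
  assume \<eta>: "\<eta> > 0"
  define s where "s = sqrt (real y)"
  have s: "0 \<le> s" "s\<^sup>2 = real y" unfolding s_def by auto
  have "s ^ 3 \<le> \<eta> * s ^ 4 + 1 / \<eta> ^ 3"
  proof (cases "s \<ge> 1 / \<eta>")
    case True
    then have "1 \<le> \<eta> * s" using \<eta> by (simp add: field_simps)
    then have "1 * s ^ 3 \<le> (\<eta> * s) * s ^ 3" using s(1) by (intro mult_right_mono) auto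
    also have "\<dots> = \<eta> * s ^ 4" by (simp add: power_numeral_reduce)
    finally show ?thesis using \<eta> by (smt (verit) divide_pos_pos zero_less_power)
  next
    case False
    then have "s ^ 3 \<le> (1 / \<eta>) ^ 3" using s(1) by (intro power_mono) auto
    moreover have "0 \<le> \<eta> * s ^ 4" using \<eta> s(1) by simp
    ultimately show ?thesis by (simp add: power_divide)
  qed
  moreover have "real y * sqrt (real y) = s ^ 3"
  proof -
    have "real y * sqrt (real y) = s\<^sup>2 * s" by (simp only: s(2) s_def[symmetric])
    then show ?thesis by (simp only: power2_eq_square power3_eq_cube)
  qed
  moreover have "(real y)\<^sup>2 = s ^ 4"
  proof -
    have "(real y)\<^sup>2 = (s\<^sup>2)\<^sup>2" by (simp only: s(2))
    then show ?thesis by (simp only: power2_eq_square power4_eq_xxxx mult.assoc)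
  qed
  ultimately show ?thesis by (simp only:)
qed

lemma inverse_squares_tail: "\<bar>pi\<^sup>2 / 6 - (\<Sum>e=1..y. 1 / (real e)\<^sup>2)\<bar> * (real y)\<^sup>2 \<le> real y"
proof (cases "y = 0")
  case False
  define f where "f n = 1 / (real (Suc n))\<^sup>2" for n
  have f: "f sums (pi\<^sup>2 / 6)" using inverse_squares_sums unfolding f_def by (simp add: add.commute)
  have s: "(\<Sum>e=1..y. 1 / (real e)\<^sup>2) = (\<Sum>n<y. f n)"
    unfolding f_def by (rule sum.reindex_bij_witness[of _ Suc "\<lambda>e. e - 1"]) auto
  have t: "(\<lambda>n. f (n + y)) sums (pi\<^sup>2 / 6 - (\<Sum>n<y. f n))" using sums_split_initial_segment[OF f] .
  have "(\<lambda>n. 1 / (real (n + y)) - 1 / real (Suc n + y)) sums (1 / real (0 + y) - 0)"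
    by (rule telescope_sums') (rule LIMSEQ_ignore_initial_segment[OF lim_1_over_n])
  then have u: "(\<lambda>n. 1 / (real (n + y)) - 1 / real (Suc n + y)) sums (1 / real y)" by simp
  have "f (n + y) \<le> 1 / (real (n + y)) - 1 / real (Suc n + y)" for n
    using False unfolding f_def by (simp add: divide_simps power2_eq_square)
  then have "pi\<^sup>2 / 6 - (\<Sum>n<y. f n) \<le> 1 / real y" using t u by (rule sums_le)
  moreover have "0 \<le> pi\<^sup>2 / 6 - (\<Sum>n<y. f n)"
    by (rule sums_le[OF _ sums_zero t]) (simp add: f_def)
  ultimately have "\<bar>pi\<^sup>2 / 6 - (\<Sum>n<y. f n)\<bar> * (real y)\<^sup>2 \<le> 1 / real y * (real y)\<^sup>2" by (intro mult_right_mono) auto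
  then show ?thesis unfolding s using False by (simp add: power2_eq_square)
qed simp

text \<open>Removing the floors costs \<open>2 * y / e\<close> in each term. The harmonic sum is estimated by a square root,
  which is weaker than a logarithm but sufficient.\<close>
lemma sum_quotient_squares:
  "\<bar>(\<Sum>e=1..y. (real (y div e))\<^sup>2) - pi\<^sup>2 / 6 * (real y)\<^sup>2\<bar> \<le> 5 * (real y * sqrt (real y))"
proof -
  have "\<bar>(real (y div e))\<^sup>2 - (real y)\<^sup>2 / (real e)\<^sup>2\<bar> \<le> 2 * real y * (1 / real e)" if "e \<in> {1..y}" for e
  proof -
    define a b where "a = real (y div e)" and "b = real y / real e"
    have a: "a \<le> b" "b - 1 \<le> a" "0 \<le> a"
    proof -
      have e: "0 < real e" using that by simp
      have "y \<le> (y div e + 1) * e"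
      proof -
        have "y mod e \<le> e" using that by simp
        then have "y div e * e + y mod e \<le> (y div e + 1) * e"
          by (simp only: add_mult_distrib mult_1 add_le_cancel_left)
        then show ?thesis by (simp only: div_mult_mod_eq)
      qed
      then have "real y \<le> real ((y div e + 1) * e)" by (simp only: of_nat_le_iff)
      then have "real y \<le> (a + 1) * real e" unfolding a_def by (simp only: of_nat_mult of_nat_add of_nat_1)
      then have "b \<le> a + 1" unfolding b_def using e by (simp only: pos_divide_le_eq)
      then show "b - 1 \<le> a" by simp
      show "a \<le> b" "0 \<le> a" unfolding a_def b_def by (simp_all add: of_nat_div_le_of_nat)
    qed
    have "b\<^sup>2 - a\<^sup>2 = (b - a) * (b + a)" by (simp add: power2_eq_square algebra_simps)
    moreover have "(b - a) * (b + a) \<le> 1 * (2 * b)" using a by (intro mult_mono) auto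
    moreover have "0 \<le> (b - a) * (b + a)" using a by auto
    ultimately have "\<bar>a\<^sup>2 - b\<^sup>2\<bar> \<le> 2 * b" by linarith
    then show ?thesis unfolding a_def b_def by (simp add: power_divide)
  qed
  then have "(\<Sum>e=1..y. \<bar>(real (y div e))\<^sup>2 - (real y)\<^sup>2 / (real e)\<^sup>2\<bar>) \<le> (\<Sum>e=1..y. 2 * real y * (1 / real e))"
    by (rule sum_mono)
  also have "\<dots> = 2 * real y * (\<Sum>e=1..y. 1 / real e)" by (simp add: sum_distrib_left)
  also have "\<dots> \<le> 2 * real y * (2 * sqrt (real y))" by (intro mult_left_mono sum_inverse_le_sqrt) auto
  finally have 1: "\<bar>\<Sum>e=1..y. (real (y div e))\<^sup>2 - (real y)\<^sup>2 / (real e)\<^sup>2\<bar> \<le> 4 * (real y * sqrt (real y))"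
    using sum_abs[of "\<lambda>e. (real (y div e))\<^sup>2 - (real y)\<^sup>2 / (real e)\<^sup>2" "{1..y}"] by linarith
  have "(\<Sum>e=1..y. (real y)\<^sup>2 / (real e)\<^sup>2) = (\<Sum>e=1..y. 1 / (real e)\<^sup>2) * (real y)\<^sup>2" by (simp add: sum_distrib_right)
  then have 2: "\<bar>(\<Sum>e=1..y. (real y)\<^sup>2 / (real e)\<^sup>2) - pi\<^sup>2 / 6 * (real y)\<^sup>2\<bar> \<le> real y"
  proof -
    have "\<bar>(\<Sum>e=1..y. 1 / (real e)\<^sup>2) * (real y)\<^sup>2 - pi\<^sup>2 / 6 * (real y)\<^sup>2\<bar>
      = \<bar>pi\<^sup>2 / 6 - (\<Sum>e=1..y. 1 / (real e)\<^sup>2)\<bar> * (real y)\<^sup>2"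
      unfolding left_diff_distrib[symmetric] abs_mult abs_power2 by (simp only: abs_minus_commute)
    then show ?thesis using inverse_squares_tail[of y] \<open>(\<Sum>e=1..y. (real y)\<^sup>2 / (real e)\<^sup>2) = _\<close> by simp
  qed
  have 3: "real y \<le> real y * sqrt (real y)" by (cases "y = 0") auto
  show ?thesis using 1 2 3 unfolding sum_subtractf by linarith
qed

text \<open>Isolating the term \<open>e = 1\<close> bounds \<open>R y\<close> by the transform and the terms with \<open>e \<ge> 2\<close>, whose total weight
  \<open>\<Sum>e\<ge>2. 1 / e\<^sup>2\<close> is at most \<open>3 / 4\<close>. So a bound with constant \<open>\<kappa>\<close> improves to one with a smaller constant.\<close>
lemma tauberian_step:
  fixes R :: "nat \<Rightarrow> real"
  assumes R: "\<And>\<eta>. \<eta> > 0 \<Longrightarrow> \<exists>C. \<forall>y. \<bar>\<Sum>e=1..y. R (y div e)\<bar> \<le> \<eta> * (real y)\<^sup>2 + C"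
    and \<kappa>: "\<kappa> > 0" "\<And>y. \<bar>R y\<bar> \<le> \<kappa> * (real y)\<^sup>2 + C0"
  shows "\<exists>C. \<forall>y. \<bar>R y\<bar> \<le> 7 / 8 * \<kappa> * (real y)\<^sup>2 + C"
proof -
  (* The losses 1 / 16 here and 1 / 16 for the linear term below bring 3 / 4 up to 7 / 8. *)
  obtain C1 where C1: "\<And>y. \<bar>\<Sum>e=1..y. R (y div e)\<bar> \<le> \<kappa> / 16 * (real y)\<^sup>2 + C1" using R[of "\<kappa> / 16"] \<kappa>(1) by auto
  have "\<bar>R y\<bar> \<le> 7 / 8 * \<kappa> * (real y)\<^sup>2 + (\<bar>C1\<bar> + 4 * C0\<^sup>2 / \<kappa> + \<bar>R 0\<bar>)" for y
  proof (cases "y = 0")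
    case False
    have "(\<Sum>e=1..y. R (y div e)) = R y + (\<Sum>e=2..y. R (y div e))"
      using False by (subst sum.atLeast_Suc_atMost) (auto simp: numeral_2_eq_2)
    then have "\<bar>R y\<bar> \<le> \<bar>\<Sum>e=1..y. R (y div e)\<bar> + \<bar>\<Sum>e=2..y. R (y div e)\<bar>" by linarith
    also have "\<bar>\<Sum>e=2..y. R (y div e)\<bar> \<le> (\<Sum>e=2..y. \<kappa> * (real y)\<^sup>2 * (1 / (real e)\<^sup>2) + \<bar>C0\<bar>)"
    proof (rule order.trans[OF sum_abs sum_mono])
      fix e assume "e \<in> {2..y}"
      have "(real (y div e))\<^sup>2 \<le> (real y / real e)\<^sup>2" by (intro power_mono of_nat_div_le_of_nat) auto
      then have "\<kappa> * (real (y div e))\<^sup>2 \<le> \<kappa> * ((real y)\<^sup>2 * (1 / (real e)\<^sup>2))" 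
        by (intro mult_left_mono) (use \<kappa>(1) in \<open>auto simp: power_divide\<close>)
      then show "\<bar>R (y div e)\<bar> \<le> \<kappa> * (real y)\<^sup>2 * (1 / (real e)\<^sup>2) + \<bar>C0\<bar>" using \<kappa>(2)[of "y div e"] by linarith
    qed
    also have "\<dots> = \<kappa> * (real y)\<^sup>2 * (\<Sum>e=2..y. 1 / (real e)\<^sup>2) + real (y - 1) * \<bar>C0\<bar>"
      using False by (simp add: sum.distrib sum_distrib_left)
    also have "\<dots> \<le> \<kappa> * (real y)\<^sup>2 * (3 / 4) + real y * \<bar>C0\<bar>"
      using \<kappa>(1) by (intro add_mono mult_left_mono mult_right_mono sum_inverse_squares_from_2_le) auto
    finally have "\<bar>R y\<bar> \<le> 13 / 16 * \<kappa> * (real y)\<^sup>2 + C1 + real y * \<bar>C0\<bar>" using C1[of y] by linarith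
    moreover have "real y * \<bar>C0\<bar> \<le> \<kappa> / 16 * (real y)\<^sup>2 + 4 * C0\<^sup>2 / \<kappa>"
    proof -
      (* Arithmetic-geometric mean: the linear term is absorbed by y\<^sup>2. *)
      define A where "A = \<bar>C0\<bar>"
      have "0 \<le> (\<kappa> * real y / 4 - 2 * A)\<^sup>2" by simp
      then have "\<kappa> * (real y * A) \<le> \<kappa> * (\<kappa> / 16 * (real y)\<^sup>2) + 4 * A\<^sup>2"
        by (simp add: power2_eq_square algebra_simps)
      also have "\<dots> = \<kappa> * (\<kappa> / 16 * (real y)\<^sup>2 + 4 * A\<^sup>2 / \<kappa>)"
        using \<kappa>(1) by (simp add: distrib_left)
      finally have "real y * A \<le> \<kappa> / 16 * (real y)\<^sup>2 + 4 * A\<^sup>2 / \<kappa>"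
        using \<kappa>(1) by (rule mult_left_le_imp_le)
      then show ?thesis unfolding A_def by simp
    qed
    ultimately show ?thesis by linarith
  qed (use \<kappa> in auto)
  then show ?thesis by blast
qed

text \<open>The transform \<open>G \<mapsto> (\<lambda>y. \<Sum>e=1..y. G (y div e))\<close> multiplies \<open>y\<^sup>2\<close> by \<open>\<pi>\<^sup>2 / 6\<close> up to lower order. It can be
  inverted because the terms with \<open>e \<ge> 2\<close> carry total weight less than \<open>1\<close>: iterating the improvement step drives
  the constant in the error below any \<open>\<eta>\<close>.\<close>
lemma floor_transform_tauberian:
  fixes G :: "nat \<Rightarrow> real"
  assumes G0: "G 0 = 0" and G: "\<And>y. \<bar>(\<Sum>e=1..y. G (y div e)) - c * (real y)\<^sup>2\<bar> \<le> K * real y"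
    and \<eta>: "\<eta> > 0"
  shows "\<exists>C. \<forall>y. \<bar>G y - 6 / pi\<^sup>2 * c * (real y)\<^sup>2\<bar> \<le> \<eta> * (real y)\<^sup>2 + C"
proof -
  define R where "R y = G y - 6 / pi\<^sup>2 * c * (real y)\<^sup>2" for y
  define K' where "K' = \<bar>K\<bar> + 5 * \<bar>6 / pi\<^sup>2 * c\<bar>"
  have K': "0 \<le> K'" unfolding K'_def by auto
  have R1: "\<bar>\<Sum>e=1..y. R (y div e)\<bar> \<le> K' * (real y * sqrt (real y))" for y
  proof -
    have alg: "(p + 5 * r) * x = p * x + r * (5 * x)" for p r x :: real by (simp add: algebra_simps)
    have c: "6 / pi\<^sup>2 * c * (pi\<^sup>2 / 6 * (real y)\<^sup>2) = c * (real y)\<^sup>2" by simp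
    have e: "(\<Sum>e=1..y. R (y div e)) = ((\<Sum>e=1..y. G (y div e)) - c * (real y)\<^sup>2)
      - 6 / pi\<^sup>2 * c * ((\<Sum>e=1..y. (real (y div e))\<^sup>2) - pi\<^sup>2 / 6 * (real y)\<^sup>2)"
      unfolding R_def sum_subtractf sum_distrib_left[symmetric] right_diff_distrib c by simp
    have "\<bar>6 / pi\<^sup>2 * c * ((\<Sum>e=1..y. (real (y div e))\<^sup>2) - pi\<^sup>2 / 6 * (real y)\<^sup>2)\<bar>
      \<le> \<bar>6 / pi\<^sup>2 * c\<bar> * (5 * (real y * sqrt (real y)))"
      unfolding abs_mult[of "6 / pi\<^sup>2 * c"] by (intro mult_left_mono sum_quotient_squares) auto
    moreover have "K * real y \<le> \<bar>K\<bar> * (real y * sqrt (real y))"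
    proof -
      have "real y \<le> real y * sqrt (real y)" by (cases "y = 0") auto
      then show ?thesis by (intro mult_mono) auto
    qed
    moreover have "K' * (real y * sqrt (real y)) = \<bar>K\<bar> * (real y * sqrt (real y))
        + \<bar>6 / pi\<^sup>2 * c\<bar> * (5 * (real y * sqrt (real y)))"
      unfolding K'_def by (rule alg)
    ultimately show ?thesis unfolding e using G[of y] by linarith
  qed
  have R2: "\<exists>C. \<forall>y. \<bar>\<Sum>e=1..y. R (y div e)\<bar> \<le> \<eta> * (real y)\<^sup>2 + C" if "\<eta> > 0" for \<eta>
  proof -
    define \<delta> where "\<delta> = \<eta> / (K' + 1)"
    have \<delta>: "\<delta> > 0" unfolding \<delta>_def using that K' by simp
    have "K' * \<delta> \<le> \<eta>" using that K' unfolding \<delta>_def by (simp add: field_simps)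
    have "\<bar>\<Sum>e=1..y. R (y div e)\<bar> \<le> \<eta> * (real y)\<^sup>2 + K' * (1 / \<delta> ^ 3)" for y
    proof -
      have "K' * (real y * sqrt (real y)) \<le> K' * (\<delta> * (real y)\<^sup>2 + 1 / \<delta> ^ 3)"
        using K' by (intro mult_left_mono sqrt_growth \<delta>)
      also have "\<dots> \<le> \<eta> * (real y)\<^sup>2 + K' * (1 / \<delta> ^ 3)"
        using mult_right_mono[OF \<open>K' * \<delta> \<le> \<eta>\<close>, of "(real y)\<^sup>2"] by (simp add: algebra_simps)
      finally show ?thesis using R1[of y] by linarith
    qed
    then show ?thesis by blast
  qed
  (* A first quadratic bound: 4 * K' + 1 solves K' + 3 / 4 * x \<le> x. *)
  have R3: "\<bar>R y\<bar> \<le> (4 * K' + 1) * (real y)\<^sup>2" for y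
  proof (induction y rule: less_induct)
    case (less y)
    show ?case
    proof (cases "y = 0")
      case False
      have "(\<Sum>e=1..y. R (y div e)) = R y + (\<Sum>e=2..y. R (y div e))"
        using False by (subst sum.atLeast_Suc_atMost) (auto simp: numeral_2_eq_2)
      then have "\<bar>R y\<bar> \<le> \<bar>\<Sum>e=1..y. R (y div e)\<bar> + \<bar>\<Sum>e=2..y. R (y div e)\<bar>" by linarith
      also have "\<bar>\<Sum>e=2..y. R (y div e)\<bar> \<le> (\<Sum>e=2..y. (4 * K' + 1) * (real y)\<^sup>2 * (1 / (real e)\<^sup>2))"
      proof (rule order.trans[OF sum_abs sum_mono])
        fix e assume e: "e \<in> {2..y}"
        have "(real (y div e))\<^sup>2 \<le> (real y / real e)\<^sup>2" by (intro power_mono of_nat_div_le_of_nat) auto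
        then have "(4 * K' + 1) * (real (y div e))\<^sup>2 \<le> (4 * K' + 1) * ((real y)\<^sup>2 * (1 / (real e)\<^sup>2))"
          using K' by (intro mult_left_mono) (auto simp: power_divide)
        moreover have "y div e < y" using e by (intro div_less_dividend) auto
        ultimately show "\<bar>R (y div e)\<bar> \<le> (4 * K' + 1) * (real y)\<^sup>2 * (1 / (real e)\<^sup>2)" using less[of "y div e"] by linarith
      qed
      also have "\<dots> = (4 * K' + 1) * (real y)\<^sup>2 * (\<Sum>e=2..y. 1 / (real e)\<^sup>2)" by (simp add: sum_distrib_left)
      also have "\<dots> \<le> (4 * K' + 1) * (real y)\<^sup>2 * (3 / 4)"
        using K' by (intro mult_left_mono sum_inverse_squares_from_2_le) auto
      finally have "\<bar>R y\<bar> \<le> K' * (real y * sqrt (real y)) + (4 * K' + 1) * (real y)\<^sup>2 * (3 / 4)" using R1[of y] by linarith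
      moreover have "K' * (real y * sqrt (real y)) \<le> K' * (real y)\<^sup>2"
      proof -
        have "sqrt (real y) \<le> sqrt ((real y)\<^sup>2)" using False by (intro real_sqrt_le_mono self_le_power) auto
        then have "sqrt (real y) \<le> real y" by simp
        then show ?thesis using K' by (intro mult_left_mono) (auto simp: power2_eq_square intro: mult_left_mono)
      qed
      moreover have "K' * (real y)\<^sup>2 + (4 * K' + 1) * (real y)\<^sup>2 * (3 / 4) \<le> (4 * K' + 1) * (real y)\<^sup>2"
        by (simp add: algebra_simps)
      ultimately show ?thesis by linarith
    qed (simp add: R_def G0)
  qed
  have iter: "\<exists>C. \<forall>y. \<bar>R y\<bar> \<le> (7 / 8) ^ k * (4 * K' + 1) * (real y)\<^sup>2 + C" for k
  proof (induction k)
    case 0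
    show ?case by (rule exI[of _ 0]) (use R3 in auto)
  next
    case (Suc k)
    then obtain C where C: "\<And>y. \<bar>R y\<bar> \<le> (7 / 8) ^ k * (4 * K' + 1) * (real y)\<^sup>2 + C" by blast
    have "(7 / 8) ^ k * (4 * K' + 1) > 0" using K' by simp
    from tauberian_step[OF R2 this C] show ?case by (simp add: mult.assoc)
  qed
  have "(\<lambda>k. (7 / 8 :: real) ^ k * (4 * K' + 1)) \<longlonglongrightarrow> 0 * (4 * K' + 1)"
    by (intro tendsto_mult tendsto_const LIMSEQ_power_zero) simp
  then have "eventually (\<lambda>k. (7 / 8 :: real) ^ k * (4 * K' + 1) < \<eta>) sequentially"
    using \<eta> by (intro order_tendstoD(2)[of _ 0]) auto
  then obtain k where k: "(7 / 8 :: real) ^ k * (4 * K' + 1) < \<eta>" by (auto simp: eventually_sequentially)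
  from iter[of k] obtain C where C: "\<And>y. \<bar>R y\<bar> \<le> (7 / 8) ^ k * (4 * K' + 1) * (real y)\<^sup>2 + C" by blast
  have "\<bar>R y\<bar> \<le> \<eta> * (real y)\<^sup>2 + C" for y
    using C[of y] mult_right_mono[OF less_imp_le[OF k], of "(real y)\<^sup>2"] by simp
  then show ?thesis unfolding R_def by blast
qed

section \<open>The common divisor and its size\<close>

text \<open>The values \<open>J\<close> at which \<open>cweight\<close> increases, cut off at \<open>N\<close>. The cutoff makes the sums over \<open>J\<close> finite, so the
  errors of the Tauberian theorem add up; the loss disappears for \<open>N \<rightarrow> \<infinity>\<close>.\<close>
definition jset :: "nat \<Rightarrow> nat set" where
  "jset N = {J \<in> {2..N}. J mod 3 \<noteq> 1}"

definition cexp :: "nat \<Rightarrow> nat \<Rightarrow> nat \<Rightarrow> nat" where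
  "cexp N n L = (\<Sum>i<n. card {J \<in> jset N. J * L \<le> i})"

definition psi :: "nat \<Rightarrow> nat \<Rightarrow> nat \<Rightarrow> complex poly" where
  "psi A N n = monom 1 A * (\<Prod>L=1..n. cyclo L ^ cexp N n L)"

lemma finite_jset [simp]: "finite (jset N)"
  by (simp add: jset_def)

lemma card_jset_eq_cweight: "card (jset t) = cweight t"
proof (induction t)
  case (Suc t)
  show ?case
  proof (cases "Suc t \<ge> 2 \<and> Suc t mod 3 \<noteq> 1")
    case True
    then have "jset (Suc t) = insert (Suc t) (jset t)" by (auto simp: jset_def)
    moreover have "Suc t \<notin> jset t" by (simp add: jset_def)
    moreover have "cweight (Suc t) = Suc (cweight t)" using True unfolding cweight_def by presburger
    ultimately show ?thesis using Suc by simp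
  next
    case False
    then have "J \<noteq> Suc t" if "J \<in> jset (Suc t)" for J using that by (auto simp: jset_def)
    then have "jset (Suc t) = jset t" by (force simp: jset_def)
    moreover have "cweight (Suc t) = cweight t" using False unfolding cweight_def by presburger
    ultimately show ?thesis using Suc by simp
  qed
qed (simp add: jset_def cweight_def)

lemma cexp_le: "0 < L \<Longrightarrow> cexp N n L \<le> (\<Sum>i<n. cweight (i div L))"
  unfolding cexp_def
proof (rule sum_mono)
  fix i assume L: "0 < L"
  have "{J \<in> jset N. J * L \<le> i} \<subseteq> jset (i div L)"
    using L by (auto simp: jset_def less_eq_div_iff_mult_less_eq)
  then have "card {J \<in> jset N. J * L \<le> i} \<le> card (jset (i div L))" by (rule card_mono[rotated]) simp
  then show "card {J \<in> jset N. J * L \<le> i} \<le> cweight (i div L)" by (simp add: card_jset_eq_cweight)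
qed

text \<open>The prime powers at \<open>0\<close> and at the roots of unity of order at most \<open>n\<close> are pairwise coprime.\<close>
lemma psi_dvd_qhankel:
  assumes A: "monom 1 A dvd qhankel a l \<mu> s n"
  shows "psi A N n dvd qhankel a l \<mu> s n"
proof -
  let ?V = "qhankel a l \<mu> s n"
  define P where "P L = {z. prim_root L z}" for L
  define U where "U = (\<Union>L\<in>{1..n}. P L)"
  define e where "e z = (if z = 0 then A else cexp N n (THE L. prim_root L z))" for z
  have e: "e z = cexp N n L" if "prim_root L z" for L z
  proof -
    have "z \<noteq> 0" using that by (auto simp: prim_root_def power_0_left)
    moreover have "(THE L. prim_root L z) = L"
    proof (rule the_equality)
      show "M = L" if "prim_root M z" for M
        using that \<open>prim_root L z\<close> by (rule prim_root_unique)
    qed (rule that)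
    ultimately show ?thesis unfolding e_def by simp
  qed
  have fin: "finite U" unfolding U_def P_def using finite_prim_roots by simp
  have U0: "0 \<notin> U" unfolding U_def P_def by (auto simp: prim_root_def power_0_left)
  have "(\<Prod>z\<in>insert 0 U. [:-z, 1:] ^ e z) dvd ?V"
  proof (rule prod_linear_power_dvd)
    fix z assume "z \<in> insert 0 U"
    then consider "z = 0" | L where "L \<in> {1..n}" "prim_root L z" unfolding U_def P_def by auto
    then show "[:-z, 1:] ^ e z dvd ?V"
    proof cases
      case 1
      then show ?thesis using A by (simp add: e_def monom_altdef)
    next
      case 2
      have "[:-z, 1:] ^ e z dvd [:-z, 1:] ^ (\<Sum>i<n. cweight (i div L))"
        unfolding e[OF 2(2)] by (intro le_imp_power_dvd cexp_le) (use 2(1) in simp)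
      then show ?thesis using cyclotomic_power_dvd_qhankel[OF 2(2)] by (rule dvd_trans)
    qed
  qed (simp add: fin)
  also have "(\<Prod>z\<in>insert 0 U. [:-z, 1:] ^ e z) = monom 1 A * (\<Prod>z\<in>U. [:-z, 1:] ^ e z)"
    using fin U0 by (simp add: e_def monom_altdef)
  also have "(\<Prod>z\<in>U. [:-z, 1:] ^ e z) = (\<Prod>L=1..n. \<Prod>z\<in>P L. [:-z, 1:] ^ e z)"
    unfolding U_def
  proof (rule prod.UNION_disjoint)
    show "\<forall>L\<in>{1..n}. \<forall>M\<in>{1..n}. L \<noteq> M \<longrightarrow> P L \<inter> P M = {}"
    proof (intro ballI impI equals0I)
      fix L M z assume "L \<noteq> M" "z \<in> P L \<inter> P M"
      then show False unfolding P_def using prim_root_unique[of L z M] by simp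
    qed
  qed (simp_all add: P_def finite_prim_roots)
  also have "\<dots> = (\<Prod>L=1..n. cyclo L ^ cexp N n L)"
    unfolding cyclo_def P_def prod_power_distrib by (intro prod.cong refl) (simp add: e)
  finally show ?thesis unfolding psi_def .
qed

text \<open>The exponent of the factor of order \<open>L\<close> counts the pairs \<open>(i, J)\<close> with \<open>L \<le> i div J\<close>; exchanging the sums reduces the
  size of \<open>psi\<close> to summatory functions over \<open>L\<close>.\<close>
lemma sum_cexp:
  fixes g :: "nat \<Rightarrow> real"
  shows "(\<Sum>L=1..n. real (cexp N n L) * g L) = (\<Sum>J\<in>jset N. \<Sum>i<n. \<Sum>L=1..i div J. g L)"
proof -
  have "(\<Sum>L=1..n. real (cexp N n L) * g L) = (\<Sum>L=1..n. \<Sum>i<n. \<Sum>J\<in>jset N. if J * L \<le> i then g L else 0)"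
    unfolding cexp_def of_nat_sum sum_distrib_right
  proof (rule sum.cong[OF refl], rule sum.cong[OF refl])
    fix L i
    have "(\<Sum>J\<in>jset N. if J * L \<le> i then g L else 0) = (\<Sum>J | J \<in> jset N \<and> J * L \<le> i. g L)"
      by (rule sum.inter_filter[symmetric]) simp
    then show "real (card {J \<in> jset N. J * L \<le> i}) * g L = (\<Sum>J\<in>jset N. if J * L \<le> i then g L else 0)"
      by (simp only: sum_constant)
  qed
  also have "\<dots> = (\<Sum>i<n. \<Sum>L=1..n. \<Sum>J\<in>jset N. if J * L \<le> i then g L else 0)" by (rule sum.swap)
  also have "\<dots> = (\<Sum>i<n. \<Sum>J\<in>jset N. \<Sum>L=1..n. if J * L \<le> i then g L else 0)"
    by (rule sum.cong[OF refl], rule sum.swap)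
  also have "\<dots> = (\<Sum>J\<in>jset N. \<Sum>i<n. \<Sum>L=1..n. if J * L \<le> i then g L else 0)" by (rule sum.swap)
  also have "\<dots> = (\<Sum>J\<in>jset N. \<Sum>i<n. \<Sum>L=1..i div J. g L)"
  proof (rule sum.cong[OF refl], rule sum.cong[OF refl])
    fix J i assume J: "J \<in> jset N" and i: "i \<in> {..<n}"
    have J0: "0 < J" using J by (auto simp: jset_def)
    have "L \<le> n" if "L \<le> i div J" for L
      using le_trans[OF that div_le_dividend] i by simp
    moreover have "J * L \<le> i \<longleftrightarrow> L \<le> i div J" for L
      using J0 by (simp add: less_eq_div_iff_mult_less_eq mult.commute)
    ultimately have e: "{L \<in> {1..n}. J * L \<le> i} = {1..i div J}"
      unfolding Set.set_eq_iff mem_Collect_eq atLeastAtMost_iff by blast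
    have "(\<Sum>L=1..n. if J * L \<le> i then g L else 0) = (\<Sum>L | L \<in> {1..n} \<and> J * L \<le> i. g L)"
      by (rule sum.inter_filter[symmetric]) simp
    then show "(\<Sum>L=1..n. if J * L \<le> i then g L else 0) = (\<Sum>L=1..i div J. g L)" unfolding e .
  qed
  finally show ?thesis .
qed

text \<open>Replacing \<open>i div J\<close> by \<open>i / J\<close> costs only a linear term in \<open>i\<close>.\<close>
lemma sum_floor_quotient_ge:
  fixes G :: "nat \<Rightarrow> real"
  assumes G: "\<And>\<eta>. \<eta> > 0 \<Longrightarrow> \<exists>C. \<forall>y. \<bar>G y - c * (real y)\<^sup>2\<bar> \<le> \<eta> * (real y)\<^sup>2 + C"
    and c: "0 \<le> c" and J: "0 < J" and \<eta>: "\<eta> > 0"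
  shows "\<exists>C. \<forall>n. c / 3 * (1 / (real J)\<^sup>2) * real n ^ 3 - \<eta> * real n ^ 3 - C * (real n)\<^sup>2 \<le> (\<Sum>i<n. G (i div J))"
proof -
  obtain C where C: "\<And>y. \<bar>G y - c * (real y)\<^sup>2\<bar> \<le> \<eta> * (real y)\<^sup>2 + C" using G[OF \<eta>] by blast
  define D where "D = \<bar>C\<bar>"
  have D: "0 \<le> D" "C \<le> D" unfolding D_def by auto
  have tm: "c / (real J)\<^sup>2 * (real i)\<^sup>2 - 2 * c * real i - \<eta> * (real i)\<^sup>2 - D \<le> G (i div J)" for i
  proof -
    define a b where "a = real (i div J)" and "b = real i / real J"
    have J1: "1 \<le> real J" using J by simp
    have "i \<le> (i div J + 1) * J"
    proof -
      have "i mod J \<le> J" using J by simp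
      then have "i div J * J + i mod J \<le> (i div J + 1) * J"
        by (simp only: add_mult_distrib mult_1 add_le_cancel_left)
      then show ?thesis by (simp only: div_mult_mod_eq)
    qed
    then have "real i \<le> real ((i div J + 1) * J)" by (simp only: of_nat_le_iff)
    then have "real i \<le> (a + 1) * real J" unfolding a_def by (simp only: of_nat_mult of_nat_add of_nat_1)
    then have ba: "b \<le> a + 1" unfolding b_def using J by (simp add: pos_divide_le_eq)
    have ab: "a \<le> b" unfolding a_def b_def by (rule of_nat_div_le_of_nat)
    have a0: "0 \<le> a" unfolding a_def by simp
    have bi: "b \<le> real i" "0 \<le> b" unfolding b_def using J1 by (simp_all add: divide_le_eq mult_le_cancel_left1)
    have "b\<^sup>2 - a\<^sup>2 = (b - a) * (b + a)" by (simp add: power2_eq_square algebra_simps)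
    also have "\<dots> \<le> 1 * (2 * b)" using ab ba a0 by (intro mult_mono) auto
    finally have "b\<^sup>2 - 2 * real i \<le> a\<^sup>2" using bi by linarith
    then have "c * (b\<^sup>2 - 2 * real i) \<le> c * a\<^sup>2" using c by (rule mult_left_mono)
    moreover have "c * (b\<^sup>2 - 2 * real i) = c / (real J)\<^sup>2 * (real i)\<^sup>2 - 2 * c * real i"
      unfolding b_def by (simp add: power_divide right_diff_distrib)
    moreover have "\<eta> * a\<^sup>2 \<le> \<eta> * (real i)\<^sup>2"
      using \<eta> ab bi a0 by (intro mult_left_mono power_mono) auto
    ultimately show ?thesis using C[of "i div J"] D unfolding a_def[symmetric] by linarith
  qed
  have "c / 3 * (1 / (real J)\<^sup>2) * real n ^ 3 - \<eta> * real n ^ 3 - (c / (real J)\<^sup>2 + 2 * c + D) * (real n)\<^sup>2 \<le> (\<Sum>i<n. G (i div J))" for n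
  proof -
    define k where "k = c / (real J)\<^sup>2"
    have k: "0 \<le> k" unfolding k_def using c by simp
    have s2: "(\<Sum>i<n. (real i)\<^sup>2) \<ge> real n ^ 3 / 3 - (real n)\<^sup>2" "(\<Sum>i<n. (real i)\<^sup>2) \<le> real n ^ 3"
      "(\<Sum>i<n. real i) \<le> (real n)\<^sup>2" "real n \<le> (real n)\<^sup>2"
    proof -
      show "(\<Sum>i<n. (real i)\<^sup>2) \<ge> real n ^ 3 / 3 - (real n)\<^sup>2"
        unfolding sum_lessThan_real_square by (simp add: field_simps power2_eq_square power3_eq_cube)
      have "(\<Sum>i<n. (real i)\<^sup>2) \<le> (\<Sum>i<n. (real n)\<^sup>2)" by (intro sum_mono power_mono) auto
      then show "(\<Sum>i<n. (real i)\<^sup>2) \<le> real n ^ 3" by (simp add: power2_eq_square power3_eq_cube)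
      have "(\<Sum>i<n. real i) \<le> (\<Sum>i<n. real n)" by (intro sum_mono) auto
      then show "(\<Sum>i<n. real i) \<le> (real n)\<^sup>2" by (simp add: power2_eq_square)
      show "real n \<le> (real n)\<^sup>2" by (cases n) (auto simp: power2_eq_square)
    qed
    have "k * (real n ^ 3 / 3 - (real n)\<^sup>2) \<le> k * (\<Sum>i<n. (real i)\<^sup>2)" by (intro mult_left_mono s2 k)
    moreover have "\<eta> * (\<Sum>i<n. (real i)\<^sup>2) \<le> \<eta> * real n ^ 3" using \<eta> by (intro mult_left_mono s2) auto
    moreover have "2 * c * (\<Sum>i<n. real i) \<le> 2 * c * (real n)\<^sup>2" using c by (intro mult_left_mono s2) auto
    moreover have "D * real n \<le> D * (real n)\<^sup>2" by (intro mult_left_mono s2 D)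
    moreover have "(\<Sum>i<n. k * (real i)\<^sup>2 - 2 * c * real i - \<eta> * (real i)\<^sup>2 - D) \<le> (\<Sum>i<n. G (i div J))"
      by (rule sum_mono) (use tm in \<open>simp add: k_def\<close>)
    moreover have "(\<Sum>i<n. k * (real i)\<^sup>2 - 2 * c * real i - \<eta> * (real i)\<^sup>2 - D)
      = k * (\<Sum>i<n. (real i)\<^sup>2) - 2 * c * (\<Sum>i<n. real i) - \<eta> * (\<Sum>i<n. (real i)\<^sup>2) - D * real n"
      by (simp add: sum_subtractf sum_distrib_left)
    moreover have "c / 3 * (1 / (real J)\<^sup>2) * real n ^ 3 = k * (real n ^ 3 / 3)" by (simp add: k_def)
    moreover have "k * (real n ^ 3 / 3 - (real n)\<^sup>2) = k * (real n ^ 3 / 3) - k * (real n)\<^sup>2"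
      by (rule right_diff_distrib)
    moreover have "(k + 2 * c + D) * (real n)\<^sup>2 = k * (real n)\<^sup>2 + 2 * c * (real n)\<^sup>2 + D * (real n)\<^sup>2"
      by (simp only: distrib_right)
    ultimately show ?thesis unfolding k_def[symmetric] by linarith
  qed
  then show ?thesis by blast
qed

lemma sum_jset_floor_quotient_ge:
  fixes G :: "nat \<Rightarrow> real"
  assumes G: "\<And>\<eta>. \<eta> > 0 \<Longrightarrow> \<exists>C. \<forall>y. \<bar>G y - c * (real y)\<^sup>2\<bar> \<le> \<eta> * (real y)\<^sup>2 + C"
    and c: "0 \<le> c" and fin: "finite \<J>" and pos: "\<And>J. J \<in> \<J> \<Longrightarrow> 0 < J" and \<eta>: "\<eta> > 0"
  shows "\<exists>C. \<forall>n. c / 3 * (\<Sum>J\<in>\<J>. 1 / (real J)\<^sup>2) * real n ^ 3 - \<eta> * real n ^ 3 - C * (real n)\<^sup>2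
    \<le> (\<Sum>J\<in>\<J>. \<Sum>i<n. G (i div J))"
  using fin pos \<eta>
proof (induction \<J> arbitrary: \<eta> rule: finite_induct)
  case empty
  show ?case by (rule exI[of _ 0]) (use empty in simp)
next
  case (insert J \<J>)
  obtain C1 where C1: "\<And>n. c / 3 * (\<Sum>J\<in>\<J>. 1 / (real J)\<^sup>2) * real n ^ 3 - \<eta> / 2 * real n ^ 3 - C1 * (real n)\<^sup>2
      \<le> (\<Sum>J\<in>\<J>. \<Sum>i<n. G (i div J))"
    using insert.IH[of "\<eta> / 2"] insert.prems by auto
  obtain C2 where C2: "\<And>n. c / 3 * (1 / (real J)\<^sup>2) * real n ^ 3 - \<eta> / 2 * real n ^ 3 - C2 * (real n)\<^sup>2 \<le> (\<Sum>i<n. G (i div J))"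
    using sum_floor_quotient_ge[OF G c, of J "\<eta> / 2"] insert.prems by auto
  have "c / 3 * (\<Sum>J\<in>insert J \<J>. 1 / (real J)\<^sup>2) * real n ^ 3 - \<eta> * real n ^ 3 - (C1 + C2) * (real n)\<^sup>2
    \<le> (\<Sum>J\<in>insert J \<J>. \<Sum>i<n. G (i div J))" for n
  proof -
    have "c / 3 * (\<Sum>J\<in>insert J \<J>. 1 / (real J)\<^sup>2) * real n ^ 3
      = c / 3 * (1 / (real J)\<^sup>2) * real n ^ 3 + c / 3 * (\<Sum>J\<in>\<J>. 1 / (real J)\<^sup>2) * real n ^ 3"
      using insert(1,2) by (simp add: distrib_left distrib_right)
    moreover have "(C1 + C2) * (real n)\<^sup>2 = C1 * (real n)\<^sup>2 + C2 * (real n)\<^sup>2" by (rule distrib_right)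
    moreover have "(\<Sum>J\<in>insert J \<J>. \<Sum>i<n. G (i div J)) = (\<Sum>i<n. G (i div J)) + (\<Sum>J\<in>\<J>. \<Sum>i<n. G (i div J))"
      using insert(1,2) by simp
    ultimately show ?thesis using C1[of n] C2[of n] by linarith
  qed
  then show ?case by blast
qed

text \<open>The sum of \<open>g L\<close> over all \<open>L \<le> y div e\<close> and all \<open>e\<close> equals the sum of the divisor sums \<open>f d\<close> for \<open>d \<le> y\<close>, which
  is \<open>b / 2 * y\<^sup>2\<close> up to \<open>O(y)\<close>; the Tauberian theorem recovers the summatory function of \<open>g\<close>.\<close>
lemma summatory_divisor_tauberian:
  fixes g f :: "nat \<Rightarrow> real"
  assumes g: "\<And>d. 0 < d \<Longrightarrow> (\<Sum>L | L dvd d. g L) = f d" and f: "\<And>d. 0 < d \<Longrightarrow> \<bar>f d - b * real d\<bar> \<le> K"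
    and \<eta>: "\<eta> > 0"
  shows "\<exists>C. \<forall>y. \<bar>(\<Sum>L=1..y. g L) - 3 / pi\<^sup>2 * b * (real y)\<^sup>2\<bar> \<le> \<eta> * (real y)\<^sup>2 + C"
proof -
  have "\<bar>(\<Sum>e=1..y. \<Sum>L=1..y div e. g L) - b / 2 * (real y)\<^sup>2\<bar> \<le> (K + \<bar>b\<bar> / 2) * real y" for y
  proof -
    have "(\<Sum>e=1..y. \<Sum>L=1..y div e. g L) = (\<Sum>d=1..y. f d)"
      unfolding sum_floor_quotients by (intro sum.cong refl g) auto
    moreover have "\<bar>(\<Sum>d=1..y. f d) - (\<Sum>d=1..y. b * real d)\<bar> \<le> K * real y"
    proof -
      have "\<bar>\<Sum>d=1..y. f d - b * real d\<bar> \<le> (\<Sum>d=1..y. K)"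
        by (rule order.trans[OF sum_abs sum_mono]) (use f in auto)
      then show ?thesis unfolding sum_subtractf by (simp add: mult.commute)
    qed
    moreover have "(\<Sum>d=1..y. b * real d) = b / 2 * (real y)\<^sup>2 + b / 2 * real y"
    proof -
      have "(\<Sum>d=1..y. real d) = (real y)\<^sup>2 / 2 + real y / 2"
        by (induction y) (simp_all add: power2_eq_square field_simps)
      then show ?thesis unfolding sum_distrib_left[symmetric] by (simp add: distrib_left)
    qed
    moreover have "\<bar>b / 2 * real y\<bar> = \<bar>b\<bar> / 2 * real y" by (simp add: abs_mult)
    moreover have "(K + \<bar>b\<bar> / 2) * real y = K * real y + \<bar>b\<bar> / 2 * real y" by (rule distrib_right)
    ultimately show ?thesis by linarith
  qed
  moreover have "6 / pi\<^sup>2 * (b / 2) = 3 / pi\<^sup>2 * b" by simp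
  ultimately show ?thesis
    using floor_transform_tauberian[of "\<lambda>y. \<Sum>L=1..y. g L" "b / 2" "K + \<bar>b\<bar> / 2" \<eta>] \<eta> by (simp only:) simp
qed

lemma sum_degree_cyclo: "0 < d \<Longrightarrow> (\<Sum>L | L dvd d. real (degree (cyclo L))) = real d"
proof -
  assume d: "0 < d"
  have "cyclo L \<noteq> 0" for L using lead_coeff_cyclo[of L] by auto
  then have "(\<Sum>L | L dvd d. degree (cyclo L)) = degree (\<Prod>L | L dvd d. cyclo L)"
    by (subst degree_prod_eq_sum_degree) auto
  also have "\<dots> = d"
    unfolding prod_cyclo[OF d] diff_conv_add_uminus
    by (subst degree_add_eq_left) (use d in \<open>auto simp: degree_monom_eq\<close>)
  finally show ?thesis by (simp flip: of_nat_sum)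
qed

text \<open>Same principle as for the degrees: \<open>X ^ d - 1\<close> is the product of the cyclotomic polynomials for the
  divisors of \<open>d\<close>.\<close>
lemma sum_ln_cyclo:
  assumes q: "norm q > 1" and d: "0 < d"
  shows "(\<Sum>L | L dvd d. ln (norm (poly (cyclo L) q))) = ln (norm (q ^ d - 1))"
proof -
  have "(\<Sum>L | L dvd d. ln (norm (poly (cyclo L) q))) = ln (\<Prod>L | L dvd d. norm (poly (cyclo L) q))"
    by (rule ln_prod[symmetric]) (use d poly_cyclo_nonzero[OF q] in auto)
  also have "(\<Prod>L | L dvd d. norm (poly (cyclo L) q)) = norm (poly (\<Prod>L | L dvd d. cyclo L) q)"
    by (simp add: poly_prod prod_norm)
  finally show ?thesis unfolding prod_cyclo[OF d] by (simp add: poly_monom)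
qed

lemma ln_norm_power_minus_1:
  assumes q: "norm (q :: complex) > 1" and d: "0 < d"
  shows "\<bar>ln (norm (q ^ d - 1)) - ln (norm q) * real d\<bar> \<le> \<bar>ln (1 - 1 / norm q)\<bar> + ln 2"
proof -
  define r w where "r = norm q" and "w = norm (q ^ d - 1)"
  define t where "t = w / r ^ d"
  have r1: "1 < r" "0 < r" using q unfolding r_def by linarith+
  have rd: "r \<le> r ^ d" using r1 d by (intro self_le_power) auto
  then have rd1: "1 < r ^ d" "0 < r ^ d" using r1 by linarith+
  have up: "w \<le> r ^ d + 1" unfolding w_def r_def using norm_triangle_ineq4[of "q ^ d" 1] by (simp add: norm_power)
  have lo: "r ^ d - 1 \<le> w" unfolding w_def r_def using norm_triangle_ineq2[of "q ^ d" 1] by (simp add: norm_power)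
  have w: "0 < w" using lo rd1 by linarith
  have t2: "t \<le> 2" unfolding t_def using up rd1 by (simp add: divide_le_eq)
  have "1 - 1 / r \<le> 1 - 1 / r ^ d" using rd r1 by (simp add: frac_le)
  also have "\<dots> = (r ^ d - 1) / r ^ d" using rd1 r1 by (simp add: diff_divide_distrib)
  also have "\<dots> \<le> t" unfolding t_def using lo rd1 by (intro divide_right_mono) auto
  finally have t1: "1 - 1 / r \<le> t" .
  have r: "0 < 1 - 1 / r" using r1 by simp
  have "ln w - ln r * real d = ln t"
    unfolding t_def using r1 w by (simp add: ln_div ln_realpow)
  moreover have "ln (1 - 1 / r) \<le> ln t" using r t1 by simp
  moreover have "ln t \<le> ln 2" using r t1 t2 by simp
  moreover have "0 \<le> ln (2::real)" by simp
  ultimately show ?thesis unfolding r_def[symmetric] w_def[symmetric] by linarith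
qed

lemma psi_monic: "lead_coeff (psi A N n) = 1"
  unfolding psi_def lead_coeff_mult lead_coeff_prod lead_coeff_power lead_coeff_cyclo
  by (simp add: degree_monom_eq)

lemma psi_degree_ge:
  assumes \<eta>: "\<eta> > 0"
  shows "\<exists>C. \<forall>n A. real A + 1 / pi\<^sup>2 * (\<Sum>J\<in>jset N. 1 / (real J)\<^sup>2) * real n ^ 3 - \<eta> * real n ^ 3 - C * (real n)\<^sup>2
    \<le> real (degree (psi A N n))"
proof -
  let ?g = "\<lambda>L. real (degree (cyclo L))"
  have t: "\<exists>C. \<forall>y. \<bar>(\<Sum>L=1..y. ?g L) - 3 / pi\<^sup>2 * (real y)\<^sup>2\<bar> \<le> \<eta> * (real y)\<^sup>2 + C" if "\<eta> > 0" for \<eta>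
    using summatory_divisor_tauberian[of ?g real 1 0, OF sum_degree_cyclo _ that] by simp
  obtain C where C: "\<And>n. 3 / pi\<^sup>2 / 3 * (\<Sum>J\<in>jset N. 1 / (real J)\<^sup>2) * real n ^ 3 - \<eta> * real n ^ 3 - C * (real n)\<^sup>2
      \<le> (\<Sum>J\<in>jset N. \<Sum>i<n. \<Sum>L=1..i div J. ?g L)"
    using sum_jset_floor_quotient_ge[of "\<lambda>y. \<Sum>L=1..y. ?g L" "3 / pi\<^sup>2" "jset N", OF t _ _ _ \<eta>]
    by (auto simp: jset_def)
  have "real (degree (psi A N n)) = real A + (\<Sum>J\<in>jset N. \<Sum>i<n. \<Sum>L=1..i div J. ?g L)" for A n
  proof -
    have nz: "cyclo L \<noteq> 0" for L using lead_coeff_cyclo[of L] by auto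
    have "degree (psi A N n) = A + (\<Sum>L=1..n. cexp N n L * degree (cyclo L))"
      unfolding psi_def using nz
      by (subst degree_mult_eq) (auto simp: degree_monom_eq degree_prod_eq_sum_degree degree_power_eq)
    then show ?thesis unfolding sum_cexp[symmetric] by simp
  qed
  then have "real A + 1 / pi\<^sup>2 * (\<Sum>J\<in>jset N. 1 / (real J)\<^sup>2) * real n ^ 3 - \<eta> * real n ^ 3 - C * (real n)\<^sup>2
    \<le> real (degree (psi A N n))" for A n
    using C[of n] by simp
  then show ?thesis by blast
qed

lemma ln_psi_ge:
  assumes q: "norm q > 1" and \<eta>: "\<eta> > 0"
  shows "\<exists>C. \<forall>n A. (real A + 1 / pi\<^sup>2 * (\<Sum>J\<in>jset N. 1 / (real J)\<^sup>2) * real n ^ 3) * ln (norm q) - \<eta> * real n ^ 3 - C * (real n)\<^sup>2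
    \<le> ln (norm (poly (psi A N n) q)) \<and> poly (psi A N n) q \<noteq> 0"
proof -
  let ?g = "\<lambda>L. ln (norm (poly (cyclo L) q))" and ?b = "ln (norm q)"
  have b: "0 \<le> ?b" using q by simp
  have t: "\<exists>C. \<forall>y. \<bar>(\<Sum>L=1..y. ?g L) - 3 / pi\<^sup>2 * ?b * (real y)\<^sup>2\<bar> \<le> \<eta> * (real y)\<^sup>2 + C" if "\<eta> > 0" for \<eta>
    using summatory_divisor_tauberian[of ?g "\<lambda>d. ln (norm (q ^ d - 1))" ?b, OF sum_ln_cyclo[OF q] ln_norm_power_minus_1[OF q] that] .
  obtain C where C: "\<And>n. 3 / pi\<^sup>2 * ?b / 3 * (\<Sum>J\<in>jset N. 1 / (real J)\<^sup>2) * real n ^ 3 - \<eta> * real n ^ 3 - C * (real n)\<^sup>2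
      \<le> (\<Sum>J\<in>jset N. \<Sum>i<n. \<Sum>L=1..i div J. ?g L)"
    using sum_jset_floor_quotient_ge[of "\<lambda>y. \<Sum>L=1..y. ?g L" "3 / pi\<^sup>2 * ?b" "jset N", OF t _ _ _ \<eta>] b
    by (auto simp: jset_def)
  have nz: "poly (psi A N n) q \<noteq> 0" for A n
    using q poly_cyclo_nonzero[OF q] unfolding psi_def by (auto simp: poly_prod poly_monom)
  have "ln (norm (poly (psi A N n) q)) = real A * ?b + (\<Sum>J\<in>jset N. \<Sum>i<n. \<Sum>L=1..i div J. ?g L)" for A n
  proof -
    have p: "0 < norm q" "0 < norm (poly (cyclo L) q)" for L using q poly_cyclo_nonzero[OF q] by (auto intro: less_trans[of 0 1])
    have "norm (poly (psi A N n) q) = norm q ^ A * (\<Prod>L=1..n. norm (poly (cyclo L) q) ^ cexp N n L)"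
      unfolding psi_def by (simp add: poly_prod poly_monom norm_mult norm_power flip: prod_norm)
    also have "ln \<dots> = real A * ?b + (\<Sum>L=1..n. real (cexp N n L) * ?g L)"
      using p by (subst ln_mult_pos) (auto simp: ln_prod ln_realpow intro!: prod_pos)
    finally show ?thesis unfolding sum_cexp .
  qed
  note ln_psi = this
  have "(real A + 1 / pi\<^sup>2 * (\<Sum>J\<in>jset N. 1 / (real J)\<^sup>2) * real n ^ 3) * ?b - \<eta> * real n ^ 3 - C * (real n)\<^sup>2
    \<le> ln (norm (poly (psi A N n) q))" for A n
  proof -
    have "(real A + 1 / pi\<^sup>2 * S * x) * y = real A * y + 3 / pi\<^sup>2 * y / 3 * S * x" for S x y :: real
      by (simp add: distrib_right)
    then show ?thesis using C[of n] ln_psi[of A n] by (simp only:)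
  qed
  then show ?thesis using nz by blast
qed

section \<open>The expansion of the tails\<close>

text \<open>The condition on \<open>l\<close> keeps the denominators of the series different from zero, and the last one does the same for
  the coefficients \<open>\<beta> k\<close> below, hence for the determinants.\<close>
locale q_series =
  fixes q \<alpha> l :: complex
  assumes q: "norm q > 1" and \<alpha>: "\<alpha> \<noteq> 0"
    and l: "\<And>k. 0 < k \<Longrightarrow> l \<noteq> q ^ k" and \<alpha>l: "\<And>k. 0 < k \<Longrightarrow> \<alpha> \<noteq> - (l * q ^ k)"
begin

definition c :: "nat \<Rightarrow> complex" where "c n = \<alpha> ^ n / (\<Prod>j=1..n. q ^ j - l)"

text \<open>The tail divided by its leading term.\<close>
definition u :: "nat \<Rightarrow> complex" where "u n = poly (qtail \<alpha> l (F q \<alpha> l) n) q / \<alpha> ^ n"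

text \<open>From such an index on, consecutive terms of the series decrease at least by the factor \<open>1 / 2\<close>, and so do those
  of the expansion in powers of \<open>q ^ (- n)\<close>.\<close>
definition large :: "nat \<Rightarrow> bool" where "large n \<longleftrightarrow> 2 * (norm l + norm \<alpha>) \<le> norm q ^ (n + 1)"

lemma q0: "q \<noteq> 0" using q by auto

lemma inverse_norm_q: "0 < 1 / norm q" "1 / norm q < 1" "1 / norm q \<le> 1"
proof -
  have "0 < norm q" using q by linarith
  then show "0 < 1 / norm q" "1 / norm q < 1" "1 / norm q \<le> 1"
    using q by (simp_all only: pos_divide_less_eq pos_divide_le_eq zero_less_divide_1_iff)
qed

lemma prod_nonzero: "(\<Prod>j=1..n. q ^ j - l) \<noteq> 0"
proof -
  have "q ^ j - l \<noteq> 0" if "j \<in> {1..n}" for j using l[of j] that by auto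
  then show ?thesis unfolding prod_zero_iff[OF finite_atLeastAtMost] by blast
qed

lemma c_nonzero: "c n \<noteq> 0"
  unfolding c_def using \<alpha> prod_nonzero by simp

lemma c_Suc: "c (Suc n) = c n * (\<alpha> / (q ^ Suc n - l))"
  unfolding c_def by simp

lemma large_mono: "large m \<Longrightarrow> m \<le> n \<Longrightarrow> large n"
proof -
  assume "large m" "m \<le> n"
  moreover have "norm q ^ (m + 1) \<le> norm q ^ (n + 1)" using q \<open>m \<le> n\<close> by (intro power_increasing) auto
  ultimately show "large n" unfolding large_def by linarith
qed

lemma eventually_ge_power: "\<exists>m. x \<le> norm q ^ (m + 1)"
proof -
  obtain m where "x < norm q ^ m" using real_arch_pow[OF q] by blast
  also have "\<dots> \<le> norm q ^ (m + 1)" using q by (intro power_increasing) auto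
  finally show ?thesis by (intro exI[of _ m]) simp
qed

lemma norm_factor_ge: "large n \<Longrightarrow> 2 * norm \<alpha> \<le> norm (q ^ Suc n - l)"
proof -
  assume "large n"
  then have "2 * (norm l + norm \<alpha>) \<le> norm (q ^ Suc n)" unfolding large_def by (simp add: norm_power norm_mult)
  moreover have "2 * y \<le> w" if "2 * (x + y) \<le> z" "z - x \<le> w" "0 \<le> x" for x y z w :: real
    using that by (simp add: algebra_simps)
  ultimately show ?thesis using norm_triangle_ineq2[of "q ^ Suc n" l] norm_ge_zero[of l] by blast
qed

lemma norm_ratio_le: "large n \<Longrightarrow> norm (\<alpha> / (q ^ Suc n - l)) \<le> 1 / 2"
proof -
  assume "large n"
  from norm_factor_ge[OF this] \<alpha> have "0 < norm (q ^ Suc n - l)" "norm \<alpha> \<le> 1 / 2 * norm (q ^ Suc n - l)"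
    by (simp_all only: zero_less_norm_iff) (auto intro: less_le_trans[of 0 "2 * norm \<alpha>"])
  then show ?thesis unfolding norm_divide by (simp only: pos_divide_le_eq)
qed

lemma norm_c_add_le: "large n \<Longrightarrow> norm (c (n + m)) \<le> norm (c n) * (1 / 2) ^ m"
proof (induction m)
  case (Suc m)
  have "norm (c (n + Suc m)) = norm (c (n + m)) * norm (\<alpha> / (q ^ Suc (n + m) - l))"
    unfolding add_Suc_right c_Suc norm_mult ..
  also have "\<dots> \<le> (norm (c n) * (1 / 2) ^ m) * (1 / 2)"
    using Suc large_mono[of n "n + m"] by (intro mult_mono norm_ratio_le) auto
  finally show ?case by (simp only: power_Suc mult_ac)
qed simp

lemma summable_c: "summable c"
proof -
  obtain n where n: "large n" unfolding large_def using eventually_ge_power by blast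
  have "summable (\<lambda>m. c (m + n))"
  proof (rule summable_comparison_test')
    show "summable (\<lambda>m. norm (c n) * (1 / 2) ^ m)" by (intro summable_mult summable_geometric) simp
    show "norm (c (m + n)) \<le> norm (c n) * (1 / 2) ^ m" for m
      using norm_c_add_le[OF n, of m] by (simp add: add.commute)
  qed
  then show ?thesis by (simp add: summable_iff_shift)
qed

lemma qtail_eq: "poly (qtail \<alpha> l (F q \<alpha> l) n) q = (\<Prod>j=1..n. q ^ j - l) * (\<Sum>m. c (m + n))"
proof (induction n)
  case 0
  show ?case by (simp add: F_def c_def)
next
  case (Suc n)
  note nz = prod_nonzero[of n]
  have "(\<Sum>m. c (m + n)) = c n + (\<Sum>m. c (m + Suc n))"
    using suminf_split_head[of "\<lambda>m. c (m + n)"] summable_c by (simp add: summable_iff_shift)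
  then have "poly (qtail \<alpha> l (F q \<alpha> l) (Suc n)) q = (q ^ Suc n - l) * ((\<Prod>j=1..n. q ^ j - l) * (c n + (\<Sum>m. c (m + Suc n))) - \<alpha> ^ n)"
    using Suc by (simp add: poly_monom)
  also have "(\<Prod>j=1..n. q ^ j - l) * c n = \<alpha> ^ n" unfolding c_def using nz by simp
  then have "(\<Prod>j=1..n. q ^ j - l) * (c n + (\<Sum>m. c (m + Suc n))) - \<alpha> ^ n = (\<Prod>j=1..n. q ^ j - l) * (\<Sum>m. c (m + Suc n))"
    by (simp add: distrib_left)
  finally show ?case by (simp add: mult_ac)
qed

lemma u_bounded: "large n \<Longrightarrow> norm (u n) \<le> 2"
proof -
  assume n: "large n"
  note nz = prod_nonzero[of n]
  have "u n = (\<Sum>m. c (m + n)) / c n" unfolding u_def qtail_eq c_def[of n] by simp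
  moreover have "norm (\<Sum>m. c (m + n)) \<le> (\<Sum>m. norm (c n) * (1 / 2) ^ m)"
  proof (rule norm_suminf_le)
    show "norm (c (m + n)) \<le> norm (c n) * (1 / 2) ^ m" for m
      using norm_c_add_le[OF n, of m] by (simp add: add.commute)
    show "summable (\<lambda>m. norm (c n) * (1 / 2) ^ m)" by (intro summable_mult summable_geometric) simp
  qed
  moreover have "(\<Sum>m. norm (c n) * (1 / 2 :: real) ^ m) = norm (c n) * 2"
    by (subst suminf_mult) (simp_all add: suminf_geometric summable_geometric)
  ultimately show ?thesis using c_nonzero[of n] by (simp add: norm_divide divide_le_eq)
qed

lemma u_Suc: "\<alpha> * u (Suc n) = (q ^ Suc n - l) * (u n - 1)"
  unfolding u_def using \<alpha> by (simp add: poly_monom field_simps)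

text \<open>The coefficients of the solution \<open>\<Sum>k. \<beta> k * q ^ (- n * k)\<close> of the recurrence satisfied by \<open>u\<close>.\<close>
definition \<beta> :: "nat \<Rightarrow> complex" where
  "\<beta> k = (if k = 0 then 1 else \<alpha> / q ^ k * (\<Prod>i=1..k - 1. l + \<alpha> / q ^ i))"

lemma \<beta>_0: "\<beta> 0 = 1" and \<beta>_1: "\<beta> (Suc 0) = \<alpha> / q"
  by (simp_all add: \<beta>_def)

lemma \<beta>_Suc: "0 < k \<Longrightarrow> \<beta> (Suc k) = \<beta> k * ((l + \<alpha> / q ^ k) / q)"
proof -
  assume "0 < k"
  then obtain j where "k = Suc j" by (cases k) auto
  then show ?thesis by (simp add: \<beta>_def mult_ac)
qed

lemma \<beta>_nonzero: "\<beta> k \<noteq> 0"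
proof -
  have "l + \<alpha> / q ^ i \<noteq> 0" if "0 < i" for i
  proof
    assume "l + \<alpha> / q ^ i = 0"
    then have "(l + \<alpha> / q ^ i) * q ^ i = 0" by simp
    then have "\<alpha> + l * q ^ i = 0" using q0 by (simp add: distrib_right add.commute)
    then have "\<alpha> = - (l * q ^ i)" by (simp only: eq_neg_iff_add_eq_0)
    then show False using \<alpha>l[OF that] by simp
  qed
  then have "(\<Prod>i=1..k - 1. l + \<alpha> / q ^ i) \<noteq> 0" unfolding prod_zero_iff[OF finite_atLeastAtMost] by auto
  then show ?thesis unfolding \<beta>_def using \<alpha> q0 by simp
qed

definition b :: "nat \<Rightarrow> nat \<Rightarrow> complex" where "b m k = \<beta> k / q ^ (m * k)"

text \<open>For \<open>l = 0\<close> the coefficients \<open>\<beta> k\<close> have an extra quadratic decay \<open>q ^ (- k\<^sup>2 / 2)\<close>.\<close>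
definition \<delta> :: nat where "\<delta> = (if l = 0 then 1 else 0)"

lemma b_nonzero: "b m k \<noteq> 0" unfolding b_def using \<beta>_nonzero q0 by simp

lemma b_0: "b m 0 = 1" unfolding b_def by (simp add: \<beta>_0)

lemma b_Suc_le: "norm (b m (Suc k)) \<le> norm (b m k) * ((norm l + norm \<alpha>) / norm q ^ (m + 1) * (1 / norm q) ^ (\<delta> * k))"
proof -
  have q1: "0 < norm q" using q by linarith
  define R where "R = \<beta> (Suc k) / \<beta> k"
  have R: "norm R \<le> (norm l + norm \<alpha>) / norm q * (1 / norm q) ^ (\<delta> * k)"
  proof (cases "k = 0")
    case True
    then show ?thesis unfolding R_def using q1 by (simp add: \<beta>_0 \<beta>_1 norm_divide divide_right_mono)
  next
    case False
    have "R = (l + \<alpha> / q ^ k) / q"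
      unfolding R_def \<beta>_Suc[OF False[unfolded neq0_conv]] by (rule nonzero_mult_div_cancel_left[OF \<beta>_nonzero])
    then have e: "norm R = norm (l + \<alpha> / q ^ k) / norm q" by (simp add: norm_divide)
    have "norm (l + \<alpha> / q ^ k) \<le> (norm l + norm \<alpha>) * (1 / norm q) ^ (\<delta> * k)"
    proof (cases "l = 0")
      case True
      then have "\<delta> = 1" unfolding \<delta>_def by simp
      then show ?thesis unfolding \<open>\<delta> = 1\<close> using True by (simp add: norm_divide norm_power power_divide)
    next
      case False
      have "1 \<le> norm q ^ k" using q by (intro one_le_power) simp
      then have "norm \<alpha> / norm q ^ k \<le> norm \<alpha>" using divide_left_mono[of 1 "norm q ^ k" "norm \<alpha>"] by simp
      then show ?thesis using False norm_triangle_ineq[of l "\<alpha> / q ^ k"] by (simp add: \<delta>_def norm_divide norm_power)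
    qed
    then show ?thesis unfolding e using q1 by (simp add: divide_right_mono)
  qed
  have "b m (Suc k) = b m k * (R / q ^ m)"
  proof -
    have "q ^ (m * Suc k) = q ^ (m * k) * q ^ m" by (simp add: power_add)
    then show ?thesis unfolding b_def R_def using \<beta>_nonzero[of k] q0 by simp
  qed
  then have "norm (b m (Suc k)) = norm (b m k) * (norm R / norm q ^ m)" by (simp add: norm_mult norm_divide norm_power)
  also have "\<dots> \<le> norm (b m k) * (((norm l + norm \<alpha>) / norm q * (1 / norm q) ^ (\<delta> * k)) / norm q ^ m)"
    using R q1 by (intro mult_left_mono divide_right_mono) auto
  finally show ?thesis by (simp add: mult_ac)
qed

lemma b_Suc_le':
  assumes "(norm l + norm \<alpha>) / norm q ^ (m + 1) \<le> \<epsilon>"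
  shows "norm (b m (Suc k)) \<le> norm (b m k) * (\<epsilon> * (1 / norm q) ^ (\<delta> * k))"
  by (rule order.trans[OF b_Suc_le]) (intro mult_left_mono mult_right_mono assms, auto)

lemma large_imp: "large m \<Longrightarrow> (norm l + norm \<alpha>) / norm q ^ (m + 1) \<le> 1 / 2"
proof -
  assume "large m"
  moreover have "0 < norm q ^ (m + 1)" using q by (intro zero_less_power) linarith
  ultimately show ?thesis unfolding large_def by (simp add: pos_divide_le_eq)
qed

lemma b_add_le:
  assumes "(norm l + norm \<alpha>) / norm q ^ (m + 1) \<le> \<epsilon>"
  shows "norm (b m (k + t)) \<le> norm (b m k) * \<epsilon> ^ t"
proof (induction t)
  case (Suc t)
  have \<epsilon>: "0 \<le> \<epsilon>" using order.trans[OF _ assms] by simp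
  have "(1 / norm q) ^ (\<delta> * (k + t)) \<le> 1" using inverse_norm_q by (intro power_le_one) auto
  then have "\<epsilon> * (1 / norm q) ^ (\<delta> * (k + t)) \<le> \<epsilon>" using mult_left_mono[OF _ \<epsilon>, of _ 1] by simp
  then have "norm (b m (k + t)) * (\<epsilon> * (1 / norm q) ^ (\<delta> * (k + t))) \<le> norm (b m (k + t)) * \<epsilon>"
    by (rule mult_left_mono) simp
  with b_Suc_le'[OF assms, of "k + t"] have "norm (b m (Suc (k + t))) \<le> norm (b m (k + t)) * \<epsilon>"
    by (rule order.trans)
  also have "\<dots> \<le> (norm (b m k) * \<epsilon> ^ t) * \<epsilon>" using Suc \<epsilon> by (intro mult_right_mono)
  finally show ?case by (simp add: mult_ac)
qed simp

lemma summable_b: "large m \<Longrightarrow> summable (\<lambda>k. norm (b m k))"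
proof (rule summable_comparison_test')
  assume m: "large m"
  show "summable (\<lambda>k. (1 / 2 :: real) ^ k)" by (rule summable_geometric) simp
  show "norm (norm (b m k)) \<le> (1 / 2) ^ k" for k
    using b_add_le[OF large_imp[OF m], of 0 k] by (simp add: b_0)
qed

definition g :: "nat \<Rightarrow> complex" where "g m = (\<Sum>k. b m k)"

lemma g_bounded: "large m \<Longrightarrow> norm (g m) \<le> 2"
proof -
  assume m: "large m"
  have "norm (g m) \<le> (\<Sum>k. (1 / 2 :: real) ^ k)"
    unfolding g_def
  proof (rule norm_suminf_le)
    show "norm (b m k) \<le> (1 / 2) ^ k" for k
      using b_add_le[OF large_imp[OF m], of 0 k] by (simp add: b_0)
  qed (rule summable_geometric, simp)
  also have "\<dots> = 2" by (subst suminf_geometric) simp_all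
  finally show ?thesis .
qed

lemma g_Suc: "large m \<Longrightarrow> \<alpha> * g (Suc m) = (q ^ Suc m - l) * (g m - 1)"
proof -
  assume m: "large m"
  have s: "summable (b m)" "summable (b (Suc m))"
    using summable_b[OF m] summable_b[OF large_mono[OF m, of "Suc m"]] by (auto intro: summable_norm_cancel)
  have s1: "summable (\<lambda>k. b m (Suc k))" using s(1) by (simp add: summable_Suc_iff)
  have "g m - 1 = (\<Sum>k. b m (Suc k))"
    unfolding g_def using suminf_split_head[OF s(1)] by (simp add: b_0)
  moreover have "q ^ Suc m * (\<Sum>k. b m (Suc k)) = (\<Sum>k. q ^ Suc m * b m (Suc k))"
    by (rule suminf_mult[symmetric, OF s1])
  moreover have "q ^ Suc m * b m (Suc k) = \<alpha> * b (Suc m) k + (if k = 0 then 0 else l * b m k)" for k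
  proof (cases "k = 0")
    case True
    then show ?thesis using q0 by (simp add: b_def \<beta>_0 \<beta>_1)
  next
    case False
    have "b m (Suc k) = b m k * ((l + \<alpha> / q ^ k) / q / q ^ m)"
    proof -
      have "q ^ (m * Suc k) = q ^ (m * k) * q ^ m" by (simp add: power_add)
      then show ?thesis unfolding b_def using \<beta>_Suc[of k] False by simp
    qed
    then have "q ^ Suc m * b m (Suc k) = b m k * (l + \<alpha> / q ^ k)" using q0 by simp
    moreover have "b (Suc m) k = b m k / q ^ k" unfolding b_def by (simp add: power_add)
    ultimately show ?thesis using False by (simp add: distrib_left mult_ac)
  qed
  moreover have "(\<Sum>k. \<alpha> * b (Suc m) k + (if k = 0 then 0 else l * b m k)) = \<alpha> * g (Suc m) + l * (g m - 1)"
  proof -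
    have "(\<lambda>k. b m (Suc k)) sums (g m - 1)"
      using s1 \<open>g m - 1 = _\<close> by (simp add: summable_sums)
    then have "(\<lambda>k. l * b m (Suc k)) sums (l * (g m - 1))" by (rule sums_mult)
    then have "(\<lambda>k. if Suc k = 0 then 0 else l * b m (Suc k)) sums (l * (g m - 1))" by simp
    then have 1: "(\<lambda>k. if k = 0 then 0 else l * b m k) sums (l * (g m - 1))"
      by (subst (asm) sums_Suc_iff) simp
    have 2: "(\<lambda>k. \<alpha> * b (Suc m) k) sums (\<alpha> * g (Suc m))"
      unfolding g_def by (intro sums_mult summable_sums s)
    show ?thesis by (rule sums_unique[symmetric, OF sums_add[OF 2 1]])
  qed
  ultimately show ?thesis by (simp add: algebra_simps)
qed

text \<open>Both sequences satisfy the recurrence of \<open>u_Suc\<close>, which at least doubles any difference of two solutions; bounded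
  solutions therefore agree.\<close>
lemma u_eq_g:
  assumes n: "large n"
  shows "u n = g n"
proof (rule ccontr)
  assume "u n \<noteq> g n"
  then have pos: "0 < norm (u n - g n)" by simp
  have "2 ^ t * norm (u n - g n) \<le> norm (u (n + t) - g (n + t))" for t
  proof (induction t)
    case (Suc t)
    have L: "large (n + t)" using large_mono[OF n] by simp
    have "\<alpha> * (u (Suc (n + t)) - g (Suc (n + t))) = (q ^ Suc (n + t) - l) * (u (n + t) - g (n + t))"
      unfolding right_diff_distrib u_Suc g_Suc[OF L] by (simp add: algebra_simps)
    then have "norm \<alpha> * norm (u (n + Suc t) - g (n + Suc t)) = norm (q ^ Suc (n + t) - l) * norm (u (n + t) - g (n + t))"
      by (simp only: add_Suc_right norm_mult[symmetric])
    moreover have "2 * norm \<alpha> * (2 ^ t * norm (u n - g n)) \<le> norm (q ^ Suc (n + t) - l) * norm (u (n + t) - g (n + t))"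
      using Suc by (intro mult_mono norm_factor_ge[OF L]) auto
    ultimately have "norm \<alpha> * (2 ^ Suc t * norm (u n - g n)) \<le> norm \<alpha> * norm (u (n + Suc t) - g (n + Suc t))"
      by simp
    then show ?case using \<alpha> by (simp add: mult_le_cancel_left_pos)
  qed simp
  moreover have "norm (u (n + t) - g (n + t)) \<le> 4" for t
    using norm_triangle_ineq4[of "u (n + t)" "g (n + t)"] u_bounded[OF large_mono[OF n, of "n + t"]] g_bounded[OF large_mono[OF n, of "n + t"]]
    by simp
  ultimately have le: "2 ^ t * norm (u n - g n) \<le> 4" for t by (rule order.trans)
  obtain t where "4 / norm (u n - g n) < 2 ^ t" using real_arch_pow[of 2] by auto
  then have "4 < 2 ^ t * norm (u n - g n)" using pos by (simp only: pos_divide_less_eq)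
  then show False using le[of t] by linarith
qed

end

section \<open>Size of the determinant\<close>

lemma prod_one_minus_power_ge:
  fixes r :: real
  assumes "0 < r" "r < 1"
  shows "exp (- (r / (1 - r)\<^sup>2)) \<le> (\<Prod>t=1..n. 1 - r ^ t)"
proof -
  have "exp (- (r ^ t / (1 - r))) \<le> 1 - r ^ t" if "t \<in> {1..n}" for t
  proof -
    have rt: "0 < r ^ t" "r ^ t \<le> r" using assms that power_decreasing[of 1 t r] by auto
    have p: "0 < 1 - r ^ t" "0 < 1 - r" using rt assms by linarith+
    have "1 / (1 - r ^ t) = 1 + r ^ t / (1 - r ^ t)" using p by (simp add: field_simps)
    also have "\<dots> \<le> 1 + r ^ t / (1 - r)" using rt p by (intro add_left_mono divide_left_mono) auto
    also have "\<dots> \<le> exp (r ^ t / (1 - r))" by (rule exp_ge_add_one_self)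
    finally have "1 \<le> exp (r ^ t / (1 - r)) * (1 - r ^ t)" using p(1) by (simp only: pos_divide_le_eq)
    then have "exp (- (r ^ t / (1 - r))) * 1 \<le> exp (- (r ^ t / (1 - r))) * (exp (r ^ t / (1 - r)) * (1 - r ^ t))"
      by (intro mult_left_mono) auto
    also have "\<dots> = 1 - r ^ t"
    proof -
      have "exp (- x) * (exp x * y) = y" for x y :: real
        by (simp add: mult.assoc[symmetric] mult_exp_exp)
      then show ?thesis .
    qed
    finally show ?thesis by simp
  qed
  then have "(\<Prod>t=1..n. exp (- (r ^ t / (1 - r)))) \<le> (\<Prod>t=1..n. 1 - r ^ t)" by (intro prod_mono) auto
  moreover have "(\<Prod>t=1..n. exp (- (r ^ t / (1 - r)))) = exp (- ((\<Sum>t=1..n. r ^ t) / (1 - r)))"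
    by (simp add: exp_sum[symmetric] sum_negf sum_divide_distrib)
  moreover have "(\<Sum>t=1..n. r ^ t) \<le> r / (1 - r)"
  proof -
    have "(\<Sum>t=1..n. r ^ t) = r * (\<Sum>t<n. r ^ t)"
      unfolding sum_distrib_left by (rule sum.reindex_bij_witness[of _ Suc "\<lambda>t. t - 1"]) (auto simp: power_eq_if)
    also have "(\<Sum>t<n. r ^ t) = (1 - r ^ n) / (1 - r)" using assms by (simp add: sum_gp_strict)
    also have "r * ((1 - r ^ n) / (1 - r)) \<le> r * (1 / (1 - r))" using assms by (intro mult_left_mono divide_right_mono) auto
    finally show ?thesis by simp
  qed
  then have "(\<Sum>t=1..n. r ^ t) / (1 - r) \<le> r / (1 - r) / (1 - r)" using assms by (intro divide_right_mono) auto
  then have "exp (- (r / (1 - r)\<^sup>2)) \<le> exp (- ((\<Sum>t=1..n. r ^ t) / (1 - r)))" by (simp add: power2_eq_square)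
  ultimately show ?thesis by linarith
qed

lemma prod_one_plus_power_le:
  fixes r :: real
  assumes "0 < r" "r < 1"
  shows "(\<Prod>t=1..n. 1 + r ^ t) \<le> exp (r / (1 - r))"
proof -
  have "(\<Prod>t=1..n. 1 + r ^ t) \<le> (\<Prod>t=1..n. exp (r ^ t))"
    using assms by (intro prod_mono) (auto intro: exp_ge_add_one_self)
  also have "\<dots> = exp (\<Sum>t=1..n. r ^ t)" by (simp add: exp_sum)
  also have "(\<Sum>t=1..n. r ^ t) \<le> r / (1 - r)"
  proof -
    have "(\<Sum>t=1..n. r ^ t) = r * (\<Sum>t<n. r ^ t)"
      unfolding sum_distrib_left by (rule sum.reindex_bij_witness[of _ Suc "\<lambda>t. t - 1"]) (auto simp: power_eq_if)
    also have "(\<Sum>t<n. r ^ t) = (1 - r ^ n) / (1 - r)" using assms by (simp add: sum_gp_strict)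
    also have "r * ((1 - r ^ n) / (1 - r)) \<le> r * (1 / (1 - r))" using assms by (intro mult_left_mono divide_right_mono) auto
    finally show ?thesis by simp
  qed
  finally show ?thesis by simp
qed

lemma prod_subset_ge:
  fixes f :: "nat \<Rightarrow> real"
  assumes "i \<le> k" "\<And>t. t \<in> {1..k} \<Longrightarrow> 0 < f t" "\<And>t. t \<in> {1..k} \<Longrightarrow> f t \<le> 1"
  shows "(\<Prod>t=1..k. f t) \<le> (\<Prod>a<i. f (k - a))"
proof -
  have 1: "(\<Prod>a<i. f (k - a)) = (\<Prod>t\<in>{k - i<..k}. f t)"
    by (rule prod.reindex_bij_witness[of _ "\<lambda>t. k - t" "\<lambda>a. k - a"]) (use assms(1) in auto)
  have "{1..k} = {1..k - i} \<union> {k - i<..k}" using assms(1) by auto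
  then have "(\<Prod>t=1..k. f t) = (\<Prod>t\<in>{1..k - i}. f t) * (\<Prod>t\<in>{k - i<..k}. f t)"
    by (simp only:) (rule prod.union_disjoint, auto)
  also have "\<dots> \<le> 1 * (\<Prod>t\<in>{k - i<..k}. f t)"
    using assms by (intro mult_right_mono prod_le_1 prod_nonneg) (auto simp: less_imp_le)
  finally show ?thesis unfolding 1 by simp
qed

lemma prod_subset_le:
  fixes f :: "nat \<Rightarrow> real"
  assumes "i \<le> k" "\<And>t. t \<in> {1..k} \<Longrightarrow> 1 \<le> f t"
  shows "(\<Prod>a<i. f (k - a)) \<le> (\<Prod>t=1..k. f t)"
proof -
  have 1: "(\<Prod>a<i. f (k - a)) = (\<Prod>t\<in>{k - i<..k}. f t)"
    by (rule prod.reindex_bij_witness[of _ "\<lambda>t. k - t" "\<lambda>a. k - a"]) (use assms(1) in auto)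
  have "1 * (\<Prod>t\<in>{k - i<..k}. f t) \<le> (\<Prod>t\<in>{1..k - i}. f t) * (\<Prod>t\<in>{k - i<..k}. f t)"
    using assms by (intro mult_right_mono prod_ge_1 prod_nonneg) (auto intro: order.trans[of 0 1])
  also have "\<dots> = (\<Prod>t=1..k. f t)"
  proof -
    have "{1..k} = {1..k - i} \<union> {k - i<..k}" using assms(1) by auto
    then show ?thesis by (simp only:) (rule prod.union_disjoint[symmetric], auto)
  qed
  finally show ?thesis unfolding 1 by simp
qed

lemma sum_off_diagonal_powers_le:
  fixes \<kappa> :: real
  assumes \<kappa>: "0 < \<kappa>" "\<kappa> \<le> 1 / 2" and i: "i < n"
  shows "(\<Sum>j\<in>{..<n} - {i}. \<kappa> ^ (max i j - min i j)) \<le> 4 * \<kappa>"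
proof -
  have geo: "(\<Sum>t<m. \<kappa> ^ Suc t) \<le> 2 * \<kappa>" for m
  proof -
    have "(\<Sum>t<m. \<kappa> ^ t) = (1 - \<kappa> ^ m) / (1 - \<kappa>)" using \<kappa> by (simp add: sum_gp_strict)
    also have "\<dots> \<le> 1 / (1 / 2)" using \<kappa> by (intro frac_le) auto
    finally have "\<kappa> * (\<Sum>t<m. \<kappa> ^ t) \<le> \<kappa> * 2" using \<kappa>(1) by (intro mult_left_mono) auto
    moreover have "(\<Sum>t<m. \<kappa> ^ Suc t) = \<kappa> * (\<Sum>t<m. \<kappa> ^ t)"
      unfolding power_Suc by (rule sum_distrib_left[symmetric])
    ultimately show ?thesis by linarith
  qed
  let ?f = "\<lambda>j. \<kappa> ^ (max i j - min i j)"
  have e: "{..<n} - {i} = {..<i} \<union> {i<..<n}" using i by auto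
  have "sum ?f ({..<n} - {i}) = sum ?f {..<i} + sum ?f {i<..<n}"
    unfolding e by (rule sum.union_disjoint) auto
  also have "sum ?f {..<i} = (\<Sum>t<i. \<kappa> ^ Suc t)"
  proof (rule sum.reindex_bij_witness[of _ "\<lambda>t. i - 1 - t" "\<lambda>j. i - 1 - j"])
    fix j assume "j \<in> {..<i}"
    then have "max i j - min i j = Suc (i - 1 - j)" by auto
    then show "\<kappa> ^ Suc (i - 1 - j) = ?f j" by (simp only:)
  qed (simp_all)
  also have "sum ?f {i<..<n} = (\<Sum>t<n - Suc i. \<kappa> ^ Suc t)"
  proof (rule sum.reindex_bij_witness[of _ "\<lambda>t. t + Suc i" "\<lambda>j. j - Suc i"])
    fix j assume "j \<in> {i<..<n}"
    then have "max i j - min i j = Suc (j - Suc i)" by auto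
    then show "\<kappa> ^ Suc (j - Suc i) = ?f j" by (simp only:)
  qed auto
  finally show ?thesis using geo[of i] geo[of "n - Suc i"] by linarith
qed

text \<open>After rescaling by the weights \<open>w\<close> the entries decay geometrically away from the diagonal. A vector in the
  kernel would contradict this in the row where its rescaled entry is largest.\<close>
lemma ndet_nonzero_diag_dominant:
  fixes H :: "nat \<Rightarrow> nat \<Rightarrow> complex" and w :: "nat \<Rightarrow> real"
  assumes w: "\<And>i. 0 < w i" and \<kappa>: "0 < \<kappa>" "\<kappa> \<le> 1 / 2"
    and diag: "\<And>i. i < n \<Longrightarrow> A * (w i * w i) \<le> norm (H i i)"
    and off: "\<And>i j. i < n \<Longrightarrow> j < n \<Longrightarrow> i \<noteq> j \<Longrightarrow> norm (H i j) \<le> B * \<kappa> ^ (max i j - min i j) * (w i * w j)"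
    and B: "0 \<le> B" and AB: "4 * \<kappa> * B < A"
  shows "ndet n H \<noteq> 0"
proof
  assume "ndet n H = 0"
  then obtain c where c: "\<exists>j<n. c j \<noteq> 0" "\<And>i. i < n \<Longrightarrow> (\<Sum>j<n. H i j * c j) = 0"
    using ndet_eq_0_kernel[of n H] by blast
  define y where "y j = norm (c j) * w j" for j
  have n0: "{..<n} \<noteq> {}" using c(1) by auto
  have "Max (y ` {..<n}) \<in> y ` {..<n}" using n0 by (intro Max_in) auto
  then obtain i where i0: "i < n" "y i = Max (y ` {..<n})" by auto
  then have i: "i < n" "\<And>j. j < n \<Longrightarrow> y j \<le> y i" by auto
  have y0: "0 \<le> y j" for j unfolding y_def using w[of j] by simp
  have yi: "0 < y i"
  proof -
    obtain j where "j < n" "c j \<noteq> 0" using c(1) by blast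
    then have "0 < y j" unfolding y_def using w[of j] by simp
    then show ?thesis using i(2)[OF \<open>j < n\<close>] by linarith
  qed
  have "H i i * c i = - (\<Sum>j\<in>{..<n} - {i}. H i j * c j)"
  proof -
    have "(\<Sum>j<n. H i j * c j) = H i i * c i + (\<Sum>j\<in>{..<n} - {i}. H i j * c j)"
      by (rule sum.remove) (use i(1) in auto)
    then show ?thesis using c(2)[OF i(1)] by (simp add: eq_neg_iff_add_eq_0)
  qed
  then have "norm (H i i) * norm (c i) \<le> (\<Sum>j\<in>{..<n} - {i}. norm (H i j) * norm (c j))"
  proof -
    assume e: "H i i * c i = - (\<Sum>j\<in>{..<n} - {i}. H i j * c j)"
    have "norm (H i i) * norm (c i) = norm (\<Sum>j\<in>{..<n} - {i}. H i j * c j)"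
      unfolding norm_mult[symmetric] e by simp
    also have "\<dots> \<le> (\<Sum>j\<in>{..<n} - {i}. norm (H i j * c j))" by (rule norm_sum)
    finally show ?thesis by (simp only: norm_mult)
  qed
  also have "\<dots> \<le> (\<Sum>j\<in>{..<n} - {i}. B * \<kappa> ^ (max i j - min i j) * w i * y i)"
  proof (rule sum_mono)
    fix j assume j: "j \<in> {..<n} - {i}"
    then have "norm (H i j) * norm (c j) \<le> (B * \<kappa> ^ (max i j - min i j) * (w i * w j)) * norm (c j)"
      by (intro mult_right_mono off i) auto
    also have "\<dots> = B * \<kappa> ^ (max i j - min i j) * w i * y j" unfolding y_def by (simp add: mult_ac)
    also have "\<dots> \<le> B * \<kappa> ^ (max i j - min i j) * w i * y i"
      using B \<kappa> w[of i] j by (intro mult_left_mono i) (auto intro!: mult_nonneg_nonneg)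
    finally show "norm (H i j) * norm (c j) \<le> B * \<kappa> ^ (max i j - min i j) * w i * y i" .
  qed
  also have "\<dots> = B * w i * y i * (\<Sum>j\<in>{..<n} - {i}. \<kappa> ^ (max i j - min i j))"
    unfolding sum_distrib_left by (rule sum.cong[OF refl]) (simp only: mult_ac)
  also have "(\<Sum>j\<in>{..<n} - {i}. \<kappa> ^ (max i j - min i j)) \<le> 4 * \<kappa>"
    by (rule sum_off_diagonal_powers_le[OF \<kappa> i(1)])
  finally have up: "norm (H i i) * norm (c i) \<le> B * w i * y i * (4 * \<kappa>)"
    using B w[of i] y0[of i] by (simp add: mult_left_mono)
  have "A * (w i * w i) * norm (c i) \<le> norm (H i i) * norm (c i)"
    by (intro mult_right_mono diag i) auto
  also note up
  finally have "A * (w i * y i) \<le> 4 * \<kappa> * B * (w i * y i)" unfolding y_def by (simp only: mult_ac)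
  moreover have "0 < w i * y i" using w[of i] yi by (rule mult_pos_pos)
  ultimately have "A \<le> 4 * \<kappa> * B" by (simp only: mult_le_cancel_right_pos)
  then show False using AB by linarith
qed

lemma ln_fact_le: "ln (fact n :: real) \<le> (real n)\<^sup>2"
proof (induction n)
  case (Suc n)
  have "ln (fact (Suc n) :: real) = ln (real (Suc n)) + ln (fact n)" by (simp add: ln_mult)
  also have "ln (real (Suc n)) \<le> real n" using ln_le_minus_one[of "real (Suc n)"] by simp
  finally show ?case using Suc by (simp add: power2_eq_square algebra_simps)
qed simp

context q_series
begin

definition r :: real where "r = 1 / norm q"

lemma r: "0 < r" "r < 1" "r \<le> 1"
  unfolding r_def by (rule inverse_norm_q)+

text \<open>The value \<open>\<bar>q\<bar> ^ (- i * (i - 1) / 2)\<close>.\<close>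
definition Qs :: "nat \<Rightarrow> real" where "Qs i = (\<Prod>a<i. r ^ a)"

lemma Qs_pos: "0 < Qs i"
  unfolding Qs_def using r by (intro prod_pos) simp

lemma Qs_Suc: "Qs (Suc i) = Qs i * r ^ i"
  unfolding Qs_def by simp

lemma Qs_antimono: "i \<le> j \<Longrightarrow> Qs j \<le> Qs i"
proof (induction j rule: dec_induct)
  case (step j)
  have "Qs (Suc j) \<le> Qs j * 1"
    unfolding Qs_Suc using r Qs_pos[of j] by (intro mult_left_mono power_le_one) auto
  then show ?case using step by linarith
qed simp

text \<open>The monic polynomial vanishing at the first \<open>i\<close> nodes \<open>q ^ (- a)\<close>.\<close>
definition node_poly :: "nat \<Rightarrow> complex poly" where
  "node_poly i = (\<Prod>a<i. [:- ((1 / q) ^ a), 1:])"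

lemma node_poly_monic: "degree (node_poly i) = i \<and> lead_coeff (node_poly i) = 1"
proof -
  have "degree (node_poly i) = i" unfolding node_poly_def by (subst degree_prod_eq_sum_degree) auto
  moreover have "lead_coeff (node_poly i) = 1" unfolding node_poly_def by (subst lead_coeff_prod) simp
  ultimately show ?thesis by blast
qed

definition p :: "nat \<Rightarrow> nat \<Rightarrow> complex" where "p i k = poly (node_poly i) ((1 / q) ^ k)"

text \<open>Together with \<open>C0\<close>, bounds for the infinite products \<open>\<Prod>t. 1 \<mp> r ^ t\<close>, uniform in \<open>i\<close> and \<open>k\<close>.\<close>
definition c0 :: real where "c0 = exp (- (r / (1 - r)\<^sup>2))"
definition C0 :: real where "C0 = exp (r / (1 - r))"

lemma c0_C0_pos: "0 < c0" "0 < C0" unfolding c0_def C0_def by simp_all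

lemma p_eq: "p i k = (\<Prod>a<i. (1 / q) ^ k - (1 / q) ^ a)"
  unfolding p_def node_poly_def by (simp add: poly_prod)

text \<open>This makes the Gram matrix below nearly diagonal: its entry \<open>(i, j)\<close> only sees the nodes from the
  index \<open>max i j\<close> on.\<close>
lemma p_eq_0: "k < i \<Longrightarrow> p i k = 0"
  unfolding p_eq by (rule prod_zero) auto

lemma norm_p:
  assumes "i \<le> k"
  shows "norm (p i k) = Qs i * (\<Prod>a<i. norm (1 - (1 / q) ^ (k - a)))"
proof -
  have "norm ((1 / q) ^ k - (1 / q) ^ a) = r ^ a * norm (1 - (1 / q) ^ (k - a))" if "a < i" for a
  proof -
    have "(1 / q) ^ k = (1 / q) ^ a * (1 / q) ^ (k - a)"
      using that assms by (simp only: power_add[symmetric]) simp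
    then have "(1 / q) ^ k - (1 / q) ^ a = - ((1 / q) ^ a * (1 - (1 / q) ^ (k - a)))" by (simp only: right_diff_distrib) simp
    then have "norm ((1 / q) ^ k - (1 / q) ^ a) = norm ((1 / q) ^ a) * norm (1 - (1 / q) ^ (k - a))"
      by (simp only: norm_minus_cancel norm_mult)
    then show ?thesis by (simp only: norm_power norm_divide norm_one r_def)
  qed
  then show ?thesis unfolding p_eq Qs_def prod_norm[symmetric] prod.distrib[symmetric] by (intro prod.cong) auto
qed

lemma norm_one_minus: "0 < t \<Longrightarrow> 1 - r ^ t \<le> norm (1 - (1 / q) ^ t) \<and> norm (1 - (1 / q) ^ t) \<le> 1 + r ^ t"
  using norm_triangle_ineq4[of 1 "(1 / q) ^ t"] norm_triangle_ineq2[of 1 "(1 / q) ^ t"]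
  by (simp add: r_def norm_power norm_divide power_divide)

lemma norm_p_ge: "i \<le> k \<Longrightarrow> c0 * Qs i \<le> norm (p i k)"
proof -
  assume ik: "i \<le> k"
  have rt: "0 < r ^ t" "r ^ t < 1" if "t \<in> {1..k}" for t using r that power_strict_mono[of r 1 t] by auto
  have "c0 \<le> (\<Prod>t=1..k. 1 - r ^ t)" unfolding c0_def by (rule prod_one_minus_power_ge) (use r in auto)
  also have "\<dots> \<le> (\<Prod>a<i. 1 - r ^ (k - a))"
    using ik by (rule prod_subset_ge) (use rt in \<open>auto simp: less_imp_le\<close>)
  also have "\<dots> \<le> (\<Prod>a<i. norm (1 - (1 / q) ^ (k - a)))"
  proof (rule prod_mono)
    fix a assume "a \<in> {..<i}"
    then have "0 < k - a" "k - a \<in> {1..k}" using ik by auto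
    then show "0 \<le> 1 - r ^ (k - a) \<and> 1 - r ^ (k - a) \<le> norm (1 - (1 / q) ^ (k - a))"
      using norm_one_minus[of "k - a"] rt[of "k - a"] by simp
  qed
  finally have "c0 * Qs i \<le> (\<Prod>a<i. norm (1 - (1 / q) ^ (k - a))) * Qs i"
    using Qs_pos[of i] by (intro mult_right_mono) auto
  then show ?thesis unfolding norm_p[OF ik] by (simp only: mult.commute)
qed

lemma norm_p_le: "norm (p i k) \<le> C0 * Qs i"
proof (cases "i \<le> k")
  case True
  have "(\<Prod>a<i. norm (1 - (1 / q) ^ (k - a))) \<le> (\<Prod>a<i. 1 + r ^ (k - a))"
  proof (rule prod_mono)
    fix a assume "a \<in> {..<i}"
    then have "0 < k - a" using True by auto
    then show "0 \<le> norm (1 - (1 / q) ^ (k - a)) \<and> norm (1 - (1 / q) ^ (k - a)) \<le> 1 + r ^ (k - a)"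
      using norm_one_minus[of "k - a"] by simp
  qed
  also have "\<dots> \<le> (\<Prod>t=1..k. 1 + r ^ t)" using True by (rule prod_subset_le) (use r in auto)
  also have "\<dots> \<le> C0" unfolding C0_def by (rule prod_one_plus_power_le) (use r in auto)
  finally have "(\<Prod>a<i. norm (1 - (1 / q) ^ (k - a))) * Qs i \<le> C0 * Qs i"
    using Qs_pos[of i] by (intro mult_right_mono) auto
  then show ?thesis unfolding norm_p[OF True] by (simp only: mult.commute)
next
  case False
  then show ?thesis using p_eq_0[of k i] Qs_pos[of i] c0_C0_pos by simp
qed

lemma b_shift: "b (t + s) k = b s k * ((1 / q) ^ k) ^ t"
proof -
  have "q ^ ((t + s) * k) = q ^ (s * k) * (q ^ k) ^ t"
  proof -
    have "(t + s) * k = s * k + k * t" by (simp add: algebra_simps)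
    then show ?thesis by (simp only: power_add power_mult)
  qed
  then show ?thesis unfolding b_def using q0 by (simp add: power_divide)
qed

text \<open>The sequence \<open>g\<close> consists of the moments of the measure with mass \<open>b s k\<close> at \<open>q ^ (- k)\<close>.\<close>
lemma act_g:
  assumes s: "large s"
  shows "(\<lambda>k. b s k * poly P ((1 / q) ^ k)) sums act P (\<lambda>n. g (n + s)) 0"
proof -
  have "(\<lambda>k. \<Sum>t\<le>degree P. coeff P t * (b s k * ((1 / q) ^ k) ^ t)) sums (\<Sum>t\<le>degree P. coeff P t * g (t + s))"
  proof (intro sums_sum sums_mult)
    fix t
    have "summable (b (t + s))" using summable_b[OF large_mono[OF s, of "t + s"]] by (auto intro: summable_norm_cancel)
    then have "b (t + s) sums g (t + s)" unfolding g_def by (rule summable_sums)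
    then show "(\<lambda>k. b s k * ((1 / q) ^ k) ^ t) sums g (t + s)" unfolding b_shift[abs_def] .
  qed
  moreover have "(\<Sum>t\<le>degree P. coeff P t * (b s k * ((1 / q) ^ k) ^ t)) = b s k * poly P ((1 / q) ^ k)" for k
    unfolding poly_altdef sum_distrib_left by (rule sum.cong[OF refl]) (simp only: mult_ac)
  ultimately show ?thesis unfolding act_def by (simp only: add_0)
qed

text \<open>The Gram matrix of the Newton polynomials for this measure.\<close>
definition H :: "nat \<Rightarrow> nat \<Rightarrow> nat \<Rightarrow> complex" where
  "H s i j = act (node_poly i * node_poly j) (\<lambda>n. g (n + s)) 0"

lemma H_sums: "large s \<Longrightarrow> (\<lambda>k. b s k * (p i k * p j k)) sums H s i j"
  using act_g[of s "node_poly i * node_poly j"] unfolding H_def p_def by (simp only: poly_mult)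

lemma tail_bound:
  assumes s: "large s" and f: "(\<lambda>k. b s k * (p i k * p j k)) sums h"
  shows "norm (h - (\<Sum>k<m. b s k * (p i k * p j k))) \<le> 2 * C0\<^sup>2 * (Qs i * Qs j) * norm (b s m)"
proof -
  let ?f = "\<lambda>k. b s k * (p i k * p j k)"
  have sm: "(\<lambda>k. ?f (k + m)) sums (h - (\<Sum>k<m. ?f k))" using sums_split_initial_segment[OF f] .
  let ?D = "C0\<^sup>2 * (Qs i * Qs j) * norm (b s m)"
  have le: "norm (?f (k + m)) \<le> ?D * (1 / 2) ^ k" for k
  proof -
    have "norm (p i (k + m) * p j (k + m)) \<le> (C0 * Qs i) * (C0 * Qs j)"
      unfolding norm_mult using norm_p_le c0_C0_pos Qs_pos[of i] by (intro mult_mono) auto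
    moreover have "norm (b s (m + k)) \<le> norm (b s m) * (1 / 2) ^ k"
      by (rule b_add_le) (rule large_imp[OF s])
    ultimately have "norm (b s (m + k)) * norm (p i (k + m) * p j (k + m))
        \<le> (norm (b s m) * (1 / 2) ^ k) * ((C0 * Qs i) * (C0 * Qs j))"
      by (intro mult_mono) auto
    also have "\<dots> = ?D * (1 / 2) ^ k" by (simp only: power2_eq_square mult_ac)
    finally show ?thesis by (simp only: norm_mult add.commute)
  qed
  have "norm (\<Sum>k. ?f (k + m)) \<le> (\<Sum>k. ?D * (1 / 2) ^ k)"
    by (rule norm_suminf_le[OF le]) (intro summable_mult summable_geometric, simp)
  also have "(\<Sum>k. ?D * (1 / 2 :: real) ^ k) = ?D * (\<Sum>k. (1 / 2) ^ k)"
    by (rule suminf_mult) (rule summable_geometric, simp)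
  also have "(\<Sum>k. (1 / 2 :: real) ^ k) = 2" by (subst suminf_geometric) simp_all
  finally show ?thesis unfolding sums_unique[OF sm] by (simp only: mult_ac)
qed

lemma H_le: "large s \<Longrightarrow> norm (H s i j) \<le> 2 * C0\<^sup>2 * (Qs i * Qs j) * norm (b s (max i j))"
proof -
  assume s: "large s"
  have "b s k * (p i k * p j k) = 0" if "k < max i j" for k
  proof -
    have "k < i \<or> k < j" using that by auto
    then show ?thesis using p_eq_0[of k i] p_eq_0[of k j] by auto
  qed
  then have "(\<Sum>k<max i j. b s k * (p i k * p j k)) = 0" by (intro sum.neutral) auto
  then show ?thesis using tail_bound[OF s H_sums[OF s], of i j "max i j"] by simp
qed

lemma H_diag_ge:
  assumes s: "large s" and \<epsilon>: "(norm l + norm \<alpha>) / norm q ^ (s + 1) \<le> \<epsilon>"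
  shows "(c0\<^sup>2 - 2 * C0\<^sup>2 * \<epsilon>) * ((Qs i)\<^sup>2 * norm (b s i)) \<le> norm (H s i i)"
proof -
  let ?f = "\<lambda>k. b s k * (p i k * p i k)"
  have "(\<Sum>k<i. ?f k) = 0" by (intro sum.neutral) (use p_eq_0 in auto)
  then have "norm (H s i i - ?f i) \<le> 2 * C0\<^sup>2 * (Qs i * Qs i) * norm (b s (Suc i))"
    using tail_bound[OF s H_sums[OF s], of i i "Suc i"] by simp
  also have "norm (b s (Suc i)) \<le> norm (b s i) * \<epsilon>"
    using b_add_le[OF \<epsilon>, of i 1] by simp
  then have "2 * C0\<^sup>2 * (Qs i * Qs i) * norm (b s (Suc i)) \<le> 2 * C0\<^sup>2 * (Qs i * Qs i) * (norm (b s i) * \<epsilon>)"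
    by (intro mult_left_mono) (use Qs_pos[of i] in auto)
  finally have 1: "norm (H s i i - ?f i) \<le> 2 * C0\<^sup>2 * \<epsilon> * ((Qs i)\<^sup>2 * norm (b s i))"
    by (simp only: power2_eq_square mult_ac)
  have "(c0 * Qs i) * (c0 * Qs i) \<le> norm (p i i) * norm (p i i)"
    using norm_p_ge[of i i] c0_C0_pos Qs_pos[of i] by (intro mult_mono) auto
  then have "norm (b s i) * ((c0 * Qs i) * (c0 * Qs i)) \<le> norm (b s i) * (norm (p i i) * norm (p i i))"
    by (rule mult_left_mono) simp
  then have 2: "c0\<^sup>2 * ((Qs i)\<^sup>2 * norm (b s i)) \<le> norm (?f i)"
    by (simp only: norm_mult power2_eq_square mult_ac)
  have "norm (?f i) \<le> norm (H s i i) + norm (H s i i - ?f i)"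
    using norm_triangle_ineq4[of "H s i i" "H s i i - ?f i"] by simp
  then show ?thesis using 1 2 unfolding left_diff_distrib by linarith
qed

lemma norm_b_le: "large s \<Longrightarrow> norm (b s k) \<le> Qs k ^ \<delta>"
proof (induction k)
  case 0
  show ?case by (simp add: b_0 Qs_def)
next
  case (Suc k)
  have "norm (b s (Suc k)) \<le> norm (b s k) * (1 * (1 / norm q) ^ (\<delta> * k))"
    by (rule b_Suc_le', rule order.trans[OF large_imp[OF Suc(2)]]) simp
  also have "\<dots> = norm (b s k) * (r ^ k) ^ \<delta>" unfolding r_def by (simp only: mult_1 power_mult[symmetric] mult.commute)
  also have "\<dots> \<le> Qs k ^ \<delta> * (r ^ k) ^ \<delta>" using Suc r by (intro mult_right_mono) auto
  finally show ?case unfolding Qs_Suc power_mult_distrib .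
qed

lemma ln_Qs: "ln (Qs i) = - (real i * (real i - 1) / 2 * ln (norm q))"
proof (induction i)
  case (Suc i)
  have "ln (Qs (Suc i)) = ln (Qs i) + real i * ln r"
    unfolding Qs_Suc using Qs_pos[of i] r by (simp add: ln_mult ln_realpow)
  moreover have "ln r = - ln (norm q)" unfolding r_def using q0 by (simp add: ln_div)
  ultimately show ?case using Suc by (simp add: field_simps)
qed (simp add: Qs_def)

lemma sum_ln_Qs: "(\<Sum>i<n. ln (Qs i)) = - (real n * (real n - 1) * (real n - 2) / 6 * ln (norm q))"
proof (induction n)
  case (Suc n)
  have "real n * (real n - 1) * (real n - 2) / 6 + real n * (real n - 1) / 2 = (real n + 1) * real n * (real n - 1) / 6"
    by (simp add: field_simps)
  then have "real n * (real n - 1) * (real n - 2) / 6 * L + real n * (real n - 1) / 2 * L = (real n + 1) * real n * (real n - 1) / 6 * L" for L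
    by (simp only: distrib_right[symmetric])
  from this[of "ln (norm q)"]
  have "- (real n * (real n - 1) * (real n - 2) / 6 * ln (norm q)) + - (real n * (real n - 1) / 2 * ln (norm q))
    = - ((real n + 1) * real n * (real n - 1) / 6 * ln (norm q))" by linarith
  moreover have "(real n + 1) * real n * (real n - 1) = real (Suc n) * (real (Suc n) - 1) * (real (Suc n) - 2)" by simp
  ultimately show ?case unfolding sum.lessThan_Suc Suc ln_Qs[of n] by (simp only:)
qed simp

lemma ndet_H_bound:
  assumes s: "large s"
  shows "norm (ndet n (H s)) \<le> fact n * (\<Prod>i<n. 2 * C0\<^sup>2 * Qs i ^ (2 + \<delta>))"
proof -
  define d where "d i = sqrt 2 * C0 * Qs i * sqrt (Qs i ^ \<delta>)" for i
  have Qd: "0 < Qs i ^ \<delta>" for i using Qs_pos[of i] by simp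
  have d0: "0 \<le> d i" for i unfolding d_def using Qs_pos[of i] Qd[of i] c0_C0_pos by simp
  have "norm (H s i j) \<le> d i * d j" for i j
  proof -
    have "norm (b s (max i j)) \<le> Qs (max i j) ^ \<delta>" by (rule norm_b_le[OF s])
    also have "\<dots> = sqrt (Qs (max i j) ^ \<delta>) * sqrt (Qs (max i j) ^ \<delta>)" using Qd[of "max i j"] by simp
    also have "\<dots> \<le> sqrt (Qs i ^ \<delta>) * sqrt (Qs j ^ \<delta>)"
      using Qs_pos[of "max i j"] Qd[of i] Qd[of "max i j"]
      by (intro mult_mono real_sqrt_le_mono power_mono Qs_antimono) (auto simp: less_imp_le)
    finally have "norm (H s i j) \<le> 2 * C0\<^sup>2 * (Qs i * Qs j) * (sqrt (Qs i ^ \<delta>) * sqrt (Qs j ^ \<delta>))"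
      using H_le[OF s, of i j] Qs_pos[of i] Qs_pos[of j]
      by (meson mult_left_mono mult_nonneg_nonneg order_trans less_imp_le zero_le_numeral zero_le_power2)
    also have "\<dots> = (sqrt 2 * sqrt 2) * C0\<^sup>2 * (Qs i * Qs j) * (sqrt (Qs i ^ \<delta>) * sqrt (Qs j ^ \<delta>))" by simp
    also have "\<dots> = d i * d j" unfolding d_def by (simp only: power2_eq_square mult_ac)
    finally show ?thesis .
  qed
  then have "norm (ndet n (H s)) \<le> fact n * (\<Prod>i<n. d i)\<^sup>2" by (intro norm_ndet_le d0)
  also have "(\<Prod>i<n. d i)\<^sup>2 = (\<Prod>i<n. 2 * C0\<^sup>2 * Qs i ^ (2 + \<delta>))"
    unfolding prod_power_distrib
  proof (rule prod.cong[OF refl])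
    fix i
    have "(d i)\<^sup>2 = (sqrt 2)\<^sup>2 * C0\<^sup>2 * (Qs i)\<^sup>2 * (sqrt (Qs i ^ \<delta>))\<^sup>2" unfolding d_def power_mult_distrib ..
    also have "\<dots> = 2 * C0\<^sup>2 * (Qs i)\<^sup>2 * Qs i ^ \<delta>" using Qd[of i] by simp
    finally show "(d i)\<^sup>2 = 2 * C0\<^sup>2 * Qs i ^ (2 + \<delta>)" by (simp only: power_add mult.assoc)
  qed
  finally show ?thesis .
qed

text \<open>The shift \<open>s\<close> is chosen so large that the masses decay faster than \<open>\<kappa> ^ (2 * k)\<close>. With the weights
  \<open>sqrt (norm (b s i))\<close> half of this decay is left for the entries off the diagonal.\<close>
lemma ndet_H_nonzero:
  assumes s: "large s" and \<kappa>: "0 < \<kappa>" "\<kappa> \<le> 1 / 2" "10 * C0\<^sup>2 * \<kappa> \<le> c0\<^sup>2"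
    and \<epsilon>: "(norm l + norm \<alpha>) / norm q ^ (s + 1) \<le> \<kappa>\<^sup>2"
  shows "ndet n (H s) \<noteq> 0"
proof (rule ndet_nonzero_diag_dominant[where w = "\<lambda>i. Qs i * sqrt (norm (b s i))" and \<kappa> = \<kappa>
      and A = "c0\<^sup>2 - 2 * C0\<^sup>2 * \<kappa>\<^sup>2" and B = "2 * C0\<^sup>2"])
  show "0 < Qs i * sqrt (norm (b s i))" for i using Qs_pos[of i] b_nonzero[of s i] by simp
  show "0 < \<kappa>" "\<kappa> \<le> 1 / 2" by (rule \<kappa>)+
  show "0 \<le> 2 * C0\<^sup>2" by simp
  have "2 * C0\<^sup>2 * (\<kappa> * \<kappa>) \<le> 2 * C0\<^sup>2 * (\<kappa> * (1 / 2))" using \<kappa> by (intro mult_left_mono) auto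
  moreover have "0 < C0\<^sup>2 * \<kappa>" using \<kappa>(1) c0_C0_pos by simp
  moreover have "4 * \<kappa> * (2 * C0\<^sup>2) = 8 * (C0\<^sup>2 * \<kappa>)" "2 * C0\<^sup>2 * (\<kappa> * (1 / 2)) = C0\<^sup>2 * \<kappa>" "10 * C0\<^sup>2 * \<kappa> = 10 * (C0\<^sup>2 * \<kappa>)" by simp_all
  ultimately show "4 * \<kappa> * (2 * C0\<^sup>2) < c0\<^sup>2 - 2 * C0\<^sup>2 * \<kappa>\<^sup>2" unfolding power2_eq_square[of \<kappa>] using \<kappa>(3) by linarith
next
  fix i
  have "Qs i * sqrt (norm (b s i)) * (Qs i * sqrt (norm (b s i))) = (Qs i)\<^sup>2 * (sqrt (norm (b s i)) * sqrt (norm (b s i)))"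
    by (simp only: power2_eq_square mult_ac)
  then show "(c0\<^sup>2 - 2 * C0\<^sup>2 * \<kappa>\<^sup>2) * (Qs i * sqrt (norm (b s i)) * (Qs i * sqrt (norm (b s i)))) \<le> norm (H s i i)"
    using H_diag_ge[OF s \<epsilon>, of i] by simp
next
  fix i j :: nat
  define M m where "M = max i j" and "m = min i j"
  have "norm (b s (m + (M - m))) \<le> norm (b s m) * (\<kappa>\<^sup>2) ^ (M - m)" by (rule b_add_le[OF \<epsilon>])
  moreover have "m + (M - m) = M" unfolding M_def m_def by simp
  ultimately have "norm (b s M) \<le> norm (b s m) * (\<kappa> ^ (M - m))\<^sup>2" by (simp add: power_mult[symmetric] mult.commute)
  then have "sqrt (norm (b s M)) \<le> sqrt (norm (b s m) * (\<kappa> ^ (M - m))\<^sup>2)" by (rule real_sqrt_le_mono)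
  also have "\<dots> = sqrt (norm (b s m)) * \<kappa> ^ (M - m)" using \<kappa>(1) by (simp add: real_sqrt_mult)
  finally have "sqrt (norm (b s M)) * sqrt (norm (b s M)) \<le> sqrt (norm (b s M)) * (sqrt (norm (b s m)) * \<kappa> ^ (M - m))"
    by (rule mult_left_mono) simp
  then have "norm (b s M) \<le> \<kappa> ^ (M - m) * (sqrt (norm (b s M)) * sqrt (norm (b s m)))" by (simp add: mult_ac)
  moreover have "sqrt (norm (b s M)) * sqrt (norm (b s m)) = sqrt (norm (b s i)) * sqrt (norm (b s j))"
    unfolding M_def m_def by (cases "i \<le> j") (simp_all add: max_def min_def)
  ultimately have "norm (b s M) \<le> \<kappa> ^ (M - m) * (sqrt (norm (b s i)) * sqrt (norm (b s j)))" by simp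
  then have "2 * C0\<^sup>2 * (Qs i * Qs j) * norm (b s M) \<le> 2 * C0\<^sup>2 * (Qs i * Qs j) * (\<kappa> ^ (M - m) * (sqrt (norm (b s i)) * sqrt (norm (b s j))))"
    by (rule mult_left_mono) (use Qs_pos[of i] Qs_pos[of j] in simp)
  also have "\<dots> = 2 * C0\<^sup>2 * \<kappa> ^ (M - m) * (Qs i * sqrt (norm (b s i)) * (Qs j * sqrt (norm (b s j))))"
    by (simp only: mult_ac)
  finally show "norm (H s i j) \<le> 2 * C0\<^sup>2 * \<kappa> ^ (max i j - min i j) * (Qs i * sqrt (norm (b s i)) * (Qs j * sqrt (norm (b s j))))"
    using H_le[OF s, of i j] unfolding M_def[symmetric] m_def[symmetric] by linarith
qed

lemma poly_qhankel_eq: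
  assumes s: "large s"
  shows "poly (qhankel \<alpha> l (F q \<alpha> l) s n) q = (\<Prod>i<n. \<alpha> ^ i * \<alpha> ^ s) * (\<Prod>j<n. \<alpha> ^ j) * ndet n (H s)"
proof -
  have "poly (qtail \<alpha> l (F q \<alpha> l) (i + j + s)) q = (\<alpha> ^ i * \<alpha> ^ s) * \<alpha> ^ j * g (i + j + s)" for i j
  proof -
    have "poly (qtail \<alpha> l (F q \<alpha> l) (i + j + s)) q = \<alpha> ^ (i + j + s) * u (i + j + s)"
      unfolding u_def using \<alpha> by simp
    then show ?thesis using u_eq_g[OF large_mono[OF s, of "i + j + s"]] by (simp add: power_add mult_ac)
  qed
  then have "poly (qhankel \<alpha> l (F q \<alpha> l) s n) q = ndet n (\<lambda>i j. (\<alpha> ^ i * \<alpha> ^ s) * \<alpha> ^ j * g (i + j + s))"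
    unfolding qhankel_def poly_ndet by (simp only:)
  also have "\<dots> = (\<Prod>i<n. \<alpha> ^ i * \<alpha> ^ s) * (\<Prod>j<n. \<alpha> ^ j) * ndet n (\<lambda>i j. g (i + j + s))"
    by (rule ndet_smult)
  also have "ndet n (\<lambda>i j. g (i + j + s)) = ndet n (\<lambda>i j. act (node_poly i * node_poly j) (\<lambda>n. g (n + s)) 0)"
    by (rule hankel_ndet_change_basis; rule node_poly_monic)
  finally show ?thesis unfolding H_def[abs_def] .
qed

lemma real_le_square: "real n \<le> (real n)\<^sup>2"
  by (cases n) (auto simp: power2_eq_square)

text \<open>Up to factors that do not matter at order \<open>n ^ 3\<close>, the determinant of the Gram matrix is at most the product of
  the \<open>Qs i ^ (2 + \<delta>)\<close>, which bound its diagonal entries. The powers of \<open>\<alpha>\<close> removed from \<open>qtail\<close> only matter at order \<open>n\<^sup>2\<close>.\<close>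
lemma qhankel_small:
  "\<exists>s K. \<forall>n. poly (qhankel \<alpha> l (F q \<alpha> l) s n) q \<noteq> 0 \<and>
    ln (norm (poly (qhankel \<alpha> l (F q \<alpha> l) s n) q)) \<le> K * (real n)\<^sup>2 - real (2 + \<delta>) / 6 * real n ^ 3 * ln (norm q)"
proof -
  (* Diagonal dominance needs 10 * C0\<^sup>2 * \<kappa> \<le> c0\<^sup>2, and \<kappa> \<le> 1 / 2 for the geometric series. *)
  define \<kappa> where "\<kappa> = min (1 / 2) (c0\<^sup>2 / (10 * C0\<^sup>2))"
  have \<kappa>: "0 < \<kappa>" "\<kappa> \<le> 1 / 2" unfolding \<kappa>_def using c0_C0_pos by simp_all
  have "\<kappa> \<le> c0\<^sup>2 / (10 * C0\<^sup>2)" unfolding \<kappa>_def by simp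
  then have \<kappa>3: "10 * C0\<^sup>2 * \<kappa> \<le> c0\<^sup>2" using c0_C0_pos by (simp add: pos_le_divide_eq mult.commute)
  obtain s where s: "max (2 * (norm l + norm \<alpha>)) ((norm l + norm \<alpha>) / \<kappa>\<^sup>2) \<le> norm q ^ (s + 1)"
    using eventually_ge_power by blast
  have large: "large s" unfolding large_def using s by simp
  have qs: "0 < norm q ^ (s + 1)" using q0 by simp
  have "(norm l + norm \<alpha>) / \<kappa>\<^sup>2 \<le> norm q ^ (s + 1)" using s by simp
  then have "norm l + norm \<alpha> \<le> norm q ^ (s + 1) * \<kappa>\<^sup>2" using \<kappa>(1) by (simp only: pos_divide_le_eq zero_less_power)
  then have \<epsilon>: "(norm l + norm \<alpha>) / norm q ^ (s + 1) \<le> \<kappa>\<^sup>2" using qs by (simp only: pos_divide_le_eq mult.commute)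
  define V where "V n = poly (qhankel \<alpha> l (F q \<alpha> l) s n) q" for n
  define E where "E n = (\<Prod>i<n. \<alpha> ^ i * \<alpha> ^ s) * (\<Prod>j<n. \<alpha> ^ j)" for n
  have V: "V n = E n * ndet n (H s)" for n unfolding V_def E_def by (rule poly_qhankel_eq[OF large])
  have nz: "ndet n (H s) \<noteq> 0" for n by (rule ndet_H_nonzero[OF large \<kappa> \<kappa>3 \<epsilon>])
  have E0: "E n \<noteq> 0" for n unfolding E_def using \<alpha> by simp
  define a where "a = \<bar>ln (norm \<alpha>)\<bar>"
  have E_le: "ln (norm (E n)) \<le> (real s + 2) * a * (real n)\<^sup>2" for n
  proof -
    have "ln (norm (E n)) = (\<Sum>i<n. real (i + s) * ln (norm \<alpha>)) + (\<Sum>i<n. real i * ln (norm \<alpha>))"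
    proof -
      have "norm (E n) = (\<Prod>i<n. norm \<alpha> ^ (i + s)) * (\<Prod>i<n. norm \<alpha> ^ i)"
        unfolding E_def by (simp add: norm_mult norm_power power_add flip: prod_norm)
      moreover have "ln ((\<Prod>i<n. x ^ (i + s)) * (\<Prod>i<n. x ^ i)) = (\<Sum>i<n. real (i + s) * ln x) + (\<Sum>i<n. real i * ln x)"
        if "0 < x" for x :: real
        using that by (subst ln_mult_pos) (auto simp: ln_prod ln_realpow intro!: prod_pos)
      moreover have "0 < norm \<alpha>" using \<alpha> by simp
      ultimately show ?thesis by (simp only:)
    qed
    also have "\<dots> \<le> (\<Sum>i<n. (2 * real n + real s) * a) / 1"
      unfolding sum.distrib[symmetric] div_by_1
    proof (rule sum_mono)
      fix i assume i: "i \<in> {..<n}"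
      have "real (i + s) * ln (norm \<alpha>) + real i * ln (norm \<alpha>) = real (i + s + i) * ln (norm \<alpha>)" by (simp add: algebra_simps)
      also have "\<dots> \<le> real (i + s + i) * a" unfolding a_def by (intro mult_left_mono) auto
      also have "\<dots> \<le> (2 * real n + real s) * a" unfolding a_def using i by (intro mult_right_mono) auto
      finally show "real (i + s) * ln (norm \<alpha>) + real i * ln (norm \<alpha>) \<le> (2 * real n + real s) * a" .
    qed
    also have "\<dots> = a * (2 * (real n)\<^sup>2 + real s * real n)" by (simp add: power2_eq_square algebra_simps)
    also have "\<dots> \<le> a * (2 * (real n)\<^sup>2 + real s * (real n)\<^sup>2)"
      unfolding a_def by (intro mult_left_mono add_left_mono real_le_square) auto
    also have "\<dots> = (real s + 2) * a * (real n)\<^sup>2" by (simp add: algebra_simps)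
    finally show ?thesis .
  qed
  define L where "L = ln (norm q)"
  define C1 where "C1 = \<bar>ln (2 * C0\<^sup>2)\<bar>"
  have L: "0 < L" unfolding L_def using q by (rule ln_gt_zero)
  have H_bound: "ln (norm (ndet n (H s))) \<le> (1 + C1 + real (2 + \<delta>) / 2 * L) * (real n)\<^sup>2 - real (2 + \<delta>) / 6 * real n ^ 3 * L" for n
  proof -
    have C: "0 < 2 * C0\<^sup>2" using c0_C0_pos by simp
    have pos: "0 < 2 * C0\<^sup>2 * Qs i ^ (2 + \<delta>)" for i using C Qs_pos[of i] by (intro mult_pos_pos[of "2 * C0\<^sup>2"] zero_less_power)
    have "ln (norm (ndet n (H s))) \<le> ln (fact n * (\<Prod>i<n. 2 * C0\<^sup>2 * Qs i ^ (2 + \<delta>)))"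
      using ndet_H_bound[OF large, of n] nz[of n] by (intro ln_mono) auto
    also have "\<dots> = ln (fact n) + (\<Sum>i<n. ln (2 * C0\<^sup>2 * Qs i ^ (2 + \<delta>)))"
    proof -
      have "0 < (\<Prod>i<n. 2 * C0\<^sup>2 * Qs i ^ (2 + \<delta>))" by (rule prod_pos) (rule pos)
      moreover have "ln (\<Prod>i<n. 2 * C0\<^sup>2 * Qs i ^ (2 + \<delta>)) = (\<Sum>i<n. ln (2 * C0\<^sup>2 * Qs i ^ (2 + \<delta>)))"
        by (rule ln_prod, simp) (rule pos[THEN less_imp_neq, THEN not_sym])
      ultimately show ?thesis using ln_mult_pos[of "fact n" "\<Prod>i<n. 2 * C0\<^sup>2 * Qs i ^ (2 + \<delta>)"] by simp
    qed
    also have "(\<Sum>i<n. ln (2 * C0\<^sup>2 * Qs i ^ (2 + \<delta>))) = (\<Sum>i<n. ln (2 * C0\<^sup>2) + real (2 + \<delta>) * ln (Qs i))"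
    proof (rule sum.cong[OF refl])
      fix i
      have "ln (2 * C0\<^sup>2 * Qs i ^ (2 + \<delta>)) = ln (2 * C0\<^sup>2) + ln (Qs i ^ (2 + \<delta>))"
        using C Qs_pos[of i] by (intro ln_mult_pos zero_less_power)
      then show "ln (2 * C0\<^sup>2 * Qs i ^ (2 + \<delta>)) = ln (2 * C0\<^sup>2) + real (2 + \<delta>) * ln (Qs i)"
        using Qs_pos[of i] by (simp only: ln_realpow)
    qed
    also have "\<dots> = real n * ln (2 * C0\<^sup>2) + real (2 + \<delta>) * (\<Sum>i<n. ln (Qs i))"
      by (simp only: sum.distrib sum_constant card_lessThan sum_distrib_left)
    also have "(\<Sum>i<n. ln (Qs i)) \<le> (real n)\<^sup>2 / 2 * L - real n ^ 3 / 6 * L"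
    proof -
      have "real n ^ 3 / 6 - (real n)\<^sup>2 / 2 \<le> real n * (real n - 1) * (real n - 2) / 6"
        by (simp add: power2_eq_square power3_eq_cube algebra_simps)
      then have "(real n ^ 3 / 6 - (real n)\<^sup>2 / 2) * L \<le> real n * (real n - 1) * (real n - 2) / 6 * L"
        using L by (intro mult_right_mono) auto
      then show ?thesis unfolding sum_ln_Qs L_def[symmetric] left_diff_distrib by linarith
    qed
    then have "real (2 + \<delta>) * (\<Sum>i<n. ln (Qs i)) \<le> real (2 + \<delta>) * ((real n)\<^sup>2 / 2 * L - real n ^ 3 / 6 * L)"
      by (intro mult_left_mono) auto
    also have "\<dots> = real (2 + \<delta>) / 2 * L * (real n)\<^sup>2 - real (2 + \<delta>) / 6 * real n ^ 3 * L"
      by (simp add: algebra_simps)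
    finally have 1: "ln (norm (ndet n (H s))) \<le> ln (fact n) + (real n * ln (2 * C0\<^sup>2)
        + (real (2 + \<delta>) / 2 * L * (real n)\<^sup>2 - real (2 + \<delta>) / 6 * real n ^ 3 * L))" by simp
    have "real n * ln (2 * C0\<^sup>2) \<le> (real n)\<^sup>2 * C1"
    proof -
      have "real n * ln (2 * C0\<^sup>2) \<le> real n * C1" unfolding C1_def by (intro mult_left_mono) auto
      also have "\<dots> \<le> (real n)\<^sup>2 * C1" unfolding C1_def by (intro mult_right_mono real_le_square) auto
      finally show ?thesis .
    qed
    then show ?thesis using 1 ln_fact_le[of n] unfolding distrib_right mult.commute[of C1] by linarith
  qed
  have "V n \<noteq> 0 \<and> ln (norm (V n)) \<le> ((real s + 2) * a + (1 + C1 + real (2 + \<delta>) / 2 * L)) * (real n)\<^sup>2 - real (2 + \<delta>) / 6 * real n ^ 3 * L" for n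
  proof -
    have "ln (norm (V n)) = ln (norm (E n)) + ln (norm (ndet n (H s)))"
      unfolding V norm_mult using E0[of n] nz[of n] by (intro ln_mult_pos) simp_all
    then show ?thesis using E_le[of n] H_bound[of n] V[of n] E0[of n] nz[of n]
      unfolding distrib_right[of "(real s + 2) * a"] by simp
  qed
  then show ?thesis unfolding V_def L_def by blast
qed

end

section \<open>Conjugate pairs\<close>

locale quadratic_surd =
  fixes \<theta> :: complex and D :: int
  assumes square: "\<theta>\<^sup>2 = of_int D" and irrational: "\<theta> \<notin> \<rat>"
begin

text \<open>An element of the order \<open>\<int> + \<int> * \<theta>\<close> together with its conjugate. As a relation it avoids choosing the coordinates.\<close>
definition gpair :: "complex \<Rightarrow> complex \<Rightarrow> bool" where
  "gpair x y \<longleftrightarrow> (\<exists>a b. x = of_int a + of_int b * \<theta> \<and> y = of_int a - of_int b * \<theta>)"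

lemma gpair_int: "gpair (of_int a) (of_int a)"
  unfolding gpair_def by (rule exI[of _ a], rule exI[of _ 0]) simp

lemma gpair_0: "gpair 0 0" and gpair_1: "gpair 1 1"
  using gpair_int[of 0] gpair_int[of 1] by simp_all

lemma gpair_add:
  assumes "gpair x x'" "gpair y y'"
  shows "gpair (x + y) (x' + y')"
proof -
  obtain a b c d where e: "x = of_int a + of_int b * \<theta>" "x' = of_int a - of_int b * \<theta>"
    "y = of_int c + of_int d * \<theta>" "y' = of_int c - of_int d * \<theta>"
    using assms unfolding gpair_def by blast
  have "x + y = of_int (a + c) + of_int (b + d) * \<theta>" "x' + y' = of_int (a + c) - of_int (b + d) * \<theta>"
    unfolding e by (simp_all add: algebra_simps)
  then show ?thesis unfolding gpair_def by blast
qed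

lemma gpair_mult:
  assumes "gpair x x'" "gpair y y'"
  shows "gpair (x * y) (x' * y')"
proof -
  obtain a b c d where e: "x = of_int a + of_int b * \<theta>" "x' = of_int a - of_int b * \<theta>"
    "y = of_int c + of_int d * \<theta>" "y' = of_int c - of_int d * \<theta>"
    using assms unfolding gpair_def by blast
  have t: "\<theta> * \<theta> = of_int D" using square by (simp add: power2_eq_square)
  have "x * y = of_int a * of_int c + of_int b * of_int d * (\<theta> * \<theta>) + (of_int a * of_int d + of_int b * of_int c) * \<theta>"
    "x' * y' = of_int a * of_int c + of_int b * of_int d * (\<theta> * \<theta>) - (of_int a * of_int d + of_int b * of_int c) * \<theta>"
    unfolding e by (simp_all add: algebra_simps)
  then have "x * y = of_int (a * c + b * d * D) + of_int (a * d + b * c) * \<theta>"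
    "x' * y' = of_int (a * c + b * d * D) - of_int (a * d + b * c) * \<theta>"
    unfolding t by simp_all
  then show ?thesis unfolding gpair_def by blast
qed

lemma gpair_diff: "gpair x x' \<Longrightarrow> gpair y y' \<Longrightarrow> gpair (x - y) (x' - y')"
  using gpair_add[of x x' "- 1 * y" "- 1 * y'"] gpair_mult[OF gpair_int[of "-1"], of y y'] by simp

lemma gpair_sum: "(\<And>i. i \<in> S \<Longrightarrow> gpair (f i) (f' i)) \<Longrightarrow> gpair (sum f S) (sum f' S)"
  by (induction S rule: infinite_finite_induct) (auto intro: gpair_add gpair_0)

lemma gpair_power: "gpair x y \<Longrightarrow> gpair (x ^ n) (y ^ n)"
  by (induction n) (auto intro: gpair_mult gpair_1)

text \<open>The product is the norm, a rational integer.\<close>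
lemma gpair_product:
  assumes "gpair x y" "x \<noteq> 0"
  shows "1 \<le> norm x * norm y" "y \<noteq> 0"
proof -
  obtain a b where e: "x = of_int a + of_int b * \<theta>" "y = of_int a - of_int b * \<theta>"
    using assms(1) unfolding gpair_def by blast
  show y: "y \<noteq> 0"
  proof
    assume "y = 0"
    then have ab: "of_int a = of_int b * \<theta>" using e(2) by simp
    show False
    proof (cases "b = 0")
      case True
      then show False using e(1) ab assms(2) by simp
    next
      case False
      then have "\<theta> = of_int a / of_int b" using ab by simp
      then show False using irrational by simp
    qed
  qed
  have "x * y = of_int a * of_int a - of_int b * of_int b * (\<theta> * \<theta>)" unfolding e by (simp add: algebra_simps)
  also have "\<dots> = of_int (a * a - b * b * D)" using square by (simp add: power2_eq_square)
  finally have xy: "x * y = of_int (a * a - b * b * D)" .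
  have "x * y \<noteq> 0" using y assms(2) by simp
  then have "a * a - b * b * D \<noteq> 0" unfolding xy of_int_eq_0_iff .
  then have "1 \<le> \<bar>a * a - b * b * D\<bar>" by linarith
  then have "1 \<le> real_of_int \<bar>a * a - b * b * D\<bar>" by linarith
  also have "\<dots> = norm (x * y)" unfolding xy norm_of_int by simp
  finally show "1 \<le> norm x * norm y" by (simp only: norm_mult)
qed

definition gpoly :: "complex poly \<Rightarrow> complex poly \<Rightarrow> bool" where
  "gpoly p p' \<longleftrightarrow> (\<forall>k. gpair (coeff p k) (coeff p' k))"

lemma gpoly_add: "gpoly p p' \<Longrightarrow> gpoly r r' \<Longrightarrow> gpoly (p + r) (p' + r')"
  unfolding gpoly_def coeff_add using gpair_add by blast

lemma gpoly_diff: "gpoly p p' \<Longrightarrow> gpoly r r' \<Longrightarrow> gpoly (p - r) (p' - r')"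
  unfolding gpoly_def coeff_diff using gpair_diff by blast

lemma gpoly_mult: "gpoly p p' \<Longrightarrow> gpoly r r' \<Longrightarrow> gpoly (p * r) (p' * r')"
  unfolding gpoly_def coeff_mult by (intro allI gpair_sum gpair_mult) auto

lemma gpoly_monom: "gpair x y \<Longrightarrow> gpoly (monom x k) (monom y k)"
  unfolding gpoly_def coeff_monom using gpair_0 by simp

lemma gpoly_const: "gpair x y \<Longrightarrow> gpoly [:x:] [:y:]"
  using gpoly_monom[of x y 0] by (simp add: monom_0)

lemma gpoly_0: "gpoly 0 0" and gpoly_1: "gpoly 1 1"
  using gpoly_const[OF gpair_0] gpoly_const[OF gpair_1] by (simp_all add: one_pCons)

lemma gpoly_sum: "(\<And>i. i \<in> S \<Longrightarrow> gpoly (f i) (f' i)) \<Longrightarrow> gpoly (sum f S) (sum f' S)"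
  by (induction S rule: infinite_finite_induct) (auto intro: gpoly_add gpoly_0)

lemma gpoly_prod: "(\<And>i. i \<in> S \<Longrightarrow> gpoly (f i) (f' i)) \<Longrightarrow> gpoly (prod f S) (prod f' S)"
  by (induction S rule: infinite_finite_induct) (auto intro: gpoly_mult gpoly_1)

lemma gpoly_power: "gpoly p p' \<Longrightarrow> gpoly (p ^ n) (p' ^ n)"
  by (induction n) (auto intro: gpoly_mult gpoly_1)

lemma gpoly_ndet:
  assumes "\<And>i j. gpoly (f i j) (f' i j)"
  shows "gpoly (ndet n f) (ndet n f')"
  unfolding ndet_def
proof (rule gpoly_sum)
  fix p
  have "gpoly (signof p) (signof p)"
    using gpoly_1 gpoly_diff[OF gpoly_0 gpoly_1] by (simp add: sign_def)
  then show "gpoly (signof p * (\<Prod>i = 0..<n. f i (p i))) (signof p * (\<Prod>i = 0..<n. f' i (p i)))"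
    by (intro gpoly_mult gpoly_prod assms)
qed

text \<open>The coefficients of the quotient are determined from the top by those of the product,
  without division, since the divisor is monic.\<close>
lemma gpoly_divide:
  assumes m: "gpoly m m" "lead_coeff m = 1" and p: "gpoly (m * w) (m * w')"
  shows "gpoly w w'"
proof -
  define d where "d = degree m"
  have top: "coeff (m * v) (d + k) = coeff v k + (\<Sum>i<d. coeff m i * coeff v (d + k - i))" for v k
  proof -
    have "coeff (m * v) (d + k) = (\<Sum>i\<le>d + k. coeff m i * coeff v (d + k - i))" by (rule coeff_mult)
    also have "\<dots> = (\<Sum>i\<in>{..<Suc d}. coeff m i * coeff v (d + k - i))"
      by (rule sum.mono_neutral_right) (auto simp: d_def coeff_eq_0)
    also have "\<dots> = coeff v k + (\<Sum>i<d. coeff m i * coeff v (d + k - i))"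
      using m(2) by (simp add: d_def)
    finally show ?thesis .
  qed
  (* Downward induction on the coefficients, starting above both degrees. *)
  define N where "N = Suc (max (degree w) (degree w'))"
  have big: "gpair (coeff w k) (coeff w' k)" if "N \<le> k" for k
    using that gpair_0 by (simp add: N_def coeff_eq_0)
  have "gpair (coeff w k) (coeff w' k)" for k
  proof (induction "N - k" arbitrary: k rule: less_induct)
    case less
    show ?case
    proof (cases "N \<le> k")
      case False
      have "gpair (coeff w (d + k - i)) (coeff w' (d + k - i))" if "i < d" for i
      proof (cases "N \<le> d + k - i")
        case True
        then show ?thesis by (rule big)
      next
        case False
        then show ?thesis using that by (intro less) simp
      qed
      then have "gpair (\<Sum>i<d. coeff m i * coeff w (d + k - i)) (\<Sum>i<d. coeff m i * coeff w' (d + k - i))"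
        using m(1) unfolding gpoly_def by (intro gpair_sum gpair_mult) auto
      moreover have "gpair (coeff (m * w) (d + k)) (coeff (m * w') (d + k))" using p unfolding gpoly_def by blast
      ultimately have "gpair (coeff (m * w) (d + k) - (\<Sum>i<d. coeff m i * coeff w (d + k - i)))
        (coeff (m * w') (d + k) - (\<Sum>i<d. coeff m i * coeff w' (d + k - i)))" by (intro gpair_diff)
      then show ?thesis unfolding top by simp
    qed (rule big)
  qed
  then show ?thesis unfolding gpoly_def by blast
qed

text \<open>That is, the coefficients are rational integers: divide \<open>X ^ L - 1\<close> by the cyclotomic polynomials of lower order.\<close>
lemma gpoly_cyclo: "0 < L \<Longrightarrow> gpoly (cyclo L) (cyclo L)"
proof (induction L rule: less_induct)
  case (less L)
  let ?m = "\<Prod>d\<in>{d. d dvd L} - {L}. cyclo d"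
  have fin: "finite {d. d dvd L}" using less(2) by simp
  have "?m * cyclo L = (\<Prod>d | d dvd L. cyclo d)"
    using prod.remove[OF fin, of L cyclo] by (simp add: mult.commute)
  then have e: "?m * cyclo L = monom 1 L - 1" using prod_cyclo[OF less(2)] by simp
  have "gpoly ?m ?m"
  proof (rule gpoly_prod)
    fix d assume d: "d \<in> {d. d dvd L} - {L}"
    then have "d \<le> L" "0 < d" using less(2) dvd_imp_le[of d L] by (auto intro: Nat.gr0I)
    then show "gpoly (cyclo d) (cyclo d)" using d by (intro less) auto
  qed
  moreover have "lead_coeff ?m = 1" by (simp only: lead_coeff_prod lead_coeff_cyclo prod.neutral_const)
  moreover have "gpoly (?m * cyclo L) (?m * cyclo L)"
    unfolding e by (intro gpoly_diff gpoly_monom gpoly_1 gpair_1)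
  ultimately show ?case by (rule gpoly_divide)
qed

lemma gpoly_psi: "gpoly (psi A N n) (psi A N n)"
  unfolding psi_def by (intro gpoly_mult gpoly_prod gpoly_power gpoly_cyclo gpoly_monom gpair_1) auto

lemma gpoly_qtail:
  assumes "gpair (of_int d * a) (of_int d * a')" "gpair (of_int d * l) (of_int d * l')" "gpair (of_int d * \<mu>) (of_int d * \<mu>')"
  shows "gpoly ([:of_int d ^ (n + 1):] * qtail a l \<mu> n) ([:of_int d ^ (n + 1):] * qtail a' l' \<mu>' n)"
proof (induction n)
  case 0
  have e: "[:of_int d ^ (0 + 1):] * qtail b k \<nu> 0 = [:of_int d * \<nu>:]" for b k \<nu> :: complex
    by simp
  show ?case unfolding e by (rule gpoly_const[OF assms(3)])
next
  case (Suc n)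
  have e: "[:of_int d ^ (Suc n + 1):] * qtail b k \<nu> (Suc n)
    = (monom (of_int d) (Suc n) - [:of_int d * k:]) * ([:of_int d ^ (n + 1):] * qtail b k \<nu> n - [:of_int d * (of_int d * b) ^ n:])"
    for b k \<nu> :: complex
  proof -
    have 1: "monom (of_int d) (Suc n) - [:of_int d * k:] = [:of_int d:] * (monom 1 (Suc n) - [:k:])"
      by (simp add: smult_diff_right smult_monom)
    have 2: "[:of_int d * (of_int d * b) ^ n:] = [:of_int d ^ (n + 1):] * [:b ^ n:]"
      by (simp add: power_mult_distrib mult_ac)
    have 3: "[:of_int d ^ (Suc n + 1):] = [:of_int d:] * [:of_int d ^ (n + 1) :: complex:]" by simp
    show ?thesis unfolding 1 2 3 qtail.simps by (simp only: right_diff_distrib mult_ac)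
  qed
  show ?case unfolding e
    by (intro gpoly_mult gpoly_diff gpoly_monom gpoly_const gpair_mult gpair_power gpair_int assms Suc)
qed

text \<open>The factor \<open>d ^ i\<close> for row \<open>i\<close> and \<open>d ^ (j + s + 1)\<close> for column \<open>j\<close>: the entry is a polynomial of total degree at most
  \<open>i + j + s + 1\<close> in \<open>a\<close>, \<open>l\<close> and \<open>\<mu>\<close>, which have denominator \<open>d\<close>.\<close>
definition scale :: "int \<Rightarrow> nat \<Rightarrow> nat \<Rightarrow> int" where
  "scale d s n = (\<Prod>i<n. d ^ i) * (\<Prod>j<n. d ^ (j + s + 1))"

lemma gpoly_qhankel:
  assumes "gpair (of_int d * a) (of_int d * a')" "gpair (of_int d * l) (of_int d * l')" "gpair (of_int d * \<mu>) (of_int d * \<mu>')"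
  shows "gpoly ([:of_int (scale d s n):] * qhankel a l \<mu> s n) ([:of_int (scale d s n):] * qhankel a' l' \<mu>' s n)"
proof -
  have c: "[:\<Prod>i<n. f i:] = (\<Prod>i<n. [:f i:])" for f :: "nat \<Rightarrow> complex"
  proof (induction n)
    case (Suc n)
    have "[:\<Prod>i<Suc n. f i:] = [:\<Prod>i<n. f i:] * [:f n:]" by (simp add: mult.commute)
    also have "\<dots> = (\<Prod>i<Suc n. [:f i:])" unfolding Suc by (simp only: prod.lessThan_Suc)
    finally show ?case .
  qed (simp add: one_pCons)
  have e: "[:of_int (scale d s n):] * qhankel b k \<nu> s n
      = ndet n (\<lambda>i j. [:of_int d ^ (i + j + s + 1):] * qtail b k \<nu> (i + j + s))" for b k \<nu>
  proof -
    have "[:of_int (scale d s n) :: complex:] = [:\<Prod>i<n. of_int d ^ i:] * [:\<Prod>j<n. of_int d ^ (j + s + 1):]"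
      unfolding scale_def by simp
    also have "\<dots> = (\<Prod>i<n. [:of_int d ^ i:]) * (\<Prod>j<n. [:of_int d ^ (j + s + 1):])" unfolding c ..
    finally have "[:of_int (scale d s n):] * qhankel b k \<nu> s n
      = ndet n (\<lambda>i j. [:of_int d ^ i:] * [:of_int d ^ (j + s + 1):] * qtail b k \<nu> (i + j + s))"
      unfolding qhankel_def ndet_smult by (simp only:)
    moreover have "[:of_int d ^ i:] * [:of_int d ^ (j + s + 1) :: complex:] = [:of_int d ^ (i + j + s + 1):]" for i j
      by (simp add: power_add mult_ac)
    ultimately show ?thesis by (simp only:)
  qed
  show ?thesis unfolding e by (intro gpoly_ndet gpoly_qtail assms)
qed

lemma gpair_homogenized:
  assumes g: "gpoly w w'" and e: "degree w \<le> e" "degree w' \<le> e" and \<sigma>: "\<sigma> \<noteq> 0"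
  shows "gpair (of_int \<sigma> ^ e * poly w (of_int \<rho> / of_int \<sigma>)) (of_int \<sigma> ^ e * poly w' (of_int \<rho> / of_int \<sigma>))"
proof -
  have h: "of_int \<sigma> ^ e * poly v (of_int \<rho> / of_int \<sigma>) = (\<Sum>k\<le>e. coeff v k * of_int (\<rho> ^ k * \<sigma> ^ (e - k)))"
    if "degree v \<le> e" for v :: "complex poly"
  proof -
    have "poly v (of_int \<rho> / of_int \<sigma>) = (\<Sum>k\<le>e. coeff v k * (of_int \<rho> / of_int \<sigma>) ^ k)"
      unfolding poly_altdef by (rule sum.mono_neutral_left) (use that in \<open>auto simp: coeff_eq_0\<close>)
    also have "of_int \<sigma> ^ e * \<dots> = (\<Sum>k\<le>e. coeff v k * of_int (\<rho> ^ k * \<sigma> ^ (e - k)))"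
      unfolding sum_distrib_left
    proof (rule sum.cong[OF refl])
      fix k assume "k \<in> {..e}"
      then have "of_int \<sigma> ^ e = (of_int \<sigma> :: complex) ^ k * of_int \<sigma> ^ (e - k)" by (simp flip: power_add)
      then show "of_int \<sigma> ^ e * (coeff v k * (of_int \<rho> / of_int \<sigma>) ^ k) = coeff v k * of_int (\<rho> ^ k * \<sigma> ^ (e - k))"
        using \<sigma> by (simp add: power_divide)
    qed
    finally show ?thesis .
  qed
  show ?thesis
    unfolding h[OF e(1)] h[OF e(2)] using g unfolding gpoly_def
    by (intro gpair_sum gpair_mult gpair_int) auto
qed

text \<open>The quotients of both determinants by \<open>psi\<close> are conjugate, after scaling, and have degree at most
  \<open>2 * (\<Sum>i<n. qdeg s i) - degree psi\<close>. This is the power of \<open>\<sigma>\<close> needed to clear the denominators of their values at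
  \<open>\<rho> / \<sigma>\<close>. The inequality is the logarithm of \<open>1 \<le> \<bar>norm\<bar>\<close>.\<close>
lemma qhankel_product_ge:
  assumes g: "gpair (of_int d * a) (of_int d * a')" "gpair (of_int d * l) (of_int d * l')" "gpair (of_int d * \<mu>) (of_int d * \<mu>')"
    and d: "d \<noteq> 0" and \<sigma>: "\<sigma> \<noteq> 0" and q: "q = of_int \<rho> / of_int \<sigma>" "norm q > 1"
    and A: "monom 1 A dvd qhankel a l \<mu> s n" "monom 1 A dvd qhankel a' l' \<mu>' s n"
    and nz: "poly (qhankel a l \<mu> s n) q \<noteq> 0"
  shows "poly (qhankel a' l' \<mu>' s n) q \<noteq> 0"
    and "degree (psi A N n) \<le> 2 * (\<Sum>i<n. qdeg s i)"
    and "0 \<le> 2 * (2 * real (\<Sum>i<n. qdeg s i) - real (degree (psi A N n))) * ln \<bar>real_of_int \<sigma>\<bar>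
      + 2 * ln \<bar>real_of_int (scale d s n)\<bar>
      + ln (norm (poly (qhankel a l \<mu> s n) q)) + ln (norm (poly (qhankel a' l' \<mu>' s n) q))
      - 2 * ln (norm (poly (psi A N n) q))"
proof -
  define V V' P where "V = qhankel a l \<mu> s n" and "V' = qhankel a' l' \<mu>' s n" and "P = psi A N n"
  define M where "M = 2 * (\<Sum>i<n. qdeg s i)"
  define c where "c = scale d s n"
  have c0: "c \<noteq> 0" unfolding c_def scale_def using d by simp
  obtain w where w: "V = P * w" using psi_dvd_qhankel[OF A(1), of N] unfolding V_def P_def by (elim dvdE)
  obtain w' where w': "V' = P * w'" using psi_dvd_qhankel[OF A(2), of N] unfolding V'_def P_def by (elim dvdE)
  have P0: "P \<noteq> 0" using psi_monic[of A N n] unfolding P_def by auto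
  have q0: "q \<noteq> 0" using q(2) by auto
  have cy: "poly (cyclo L) q \<noteq> 0" if "L \<in> {1..n}" for L using poly_cyclo_nonzero[of q L] q(2) that by auto
  have Pq: "poly P q \<noteq> 0"
    unfolding P_def psi_def poly_mult poly_prod poly_power poly_monom
    using q0 cy by simp
  have wq: "poly w q \<noteq> 0" using nz unfolding V_def[symmetric] w by auto
  then have w0: "w \<noteq> 0" by auto
  have degP: "degree P + degree w \<le> M"
    using degree_qhankel[of a l \<mu> s n] unfolding V_def[symmetric] M_def w using P0 w0 by (simp add: degree_mult_eq)
  show "degree (psi A N n) \<le> 2 * (\<Sum>i<n. qdeg s i)" using degP unfolding P_def M_def by linarith
  define e where "e = M - degree P"
  have dw': "degree w' \<le> e"
  proof (cases "w' = 0")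
    case False
    then have "degree P + degree w' \<le> M"
      using degree_qhankel[of a' l' \<mu>' s n] unfolding V'_def[symmetric] M_def w' using P0 by (simp add: degree_mult_eq)
    then show ?thesis unfolding e_def by linarith
  qed simp
  have dw: "degree w \<le> e" using degP unfolding e_def by linarith
  have "gpoly ([:of_int c:] * V) ([:of_int c:] * V')" unfolding c_def V_def V'_def by (rule gpoly_qhankel[OF g])
  then have "gpoly (P * ([:of_int c:] * w)) (P * ([:of_int c:] * w'))" unfolding w w' by (simp only: mult.left_commute)
  then have gw: "gpoly ([:of_int c:] * w) ([:of_int c:] * w')"
    unfolding P_def by (rule gpoly_divide[OF gpoly_psi psi_monic])
  have sd: "degree ([:of_int c:] * v) \<le> e" if "degree v \<le> e" for v :: "complex poly"
    using that by (simp add: degree_smult_le order.trans)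
  have gp: "gpair (of_int \<sigma> ^ e * poly ([:of_int c:] * w) q) (of_int \<sigma> ^ e * poly ([:of_int c:] * w') q)"
    unfolding q(1) by (rule gpair_homogenized[OF gw sd[OF dw] sd[OF dw'] \<sigma>])
  have x0: "of_int \<sigma> ^ e * poly ([:of_int c:] * w) q \<noteq> 0" using wq c0 \<sigma> by simp
  from gpair_product[OF gp x0] have w'q: "poly w' q \<noteq> 0" by auto
  then show "poly (qhankel a' l' \<mu>' s n) q \<noteq> 0" unfolding V'_def[symmetric] w' using Pq by simp
  define S C where "S = \<bar>real_of_int \<sigma>\<bar>" and "C = \<bar>real_of_int c\<bar>"
  have SC: "0 < S" "0 < C" unfolding S_def C_def using \<sigma> c0 by simp_all
  have pos: "0 < norm (poly w q)" "0 < norm (poly w' q)" "0 < norm (poly P q)" using wq w'q Pq by simp_all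
  have "1 \<le> (S ^ e * (C * norm (poly w q))) * (S ^ e * (C * norm (poly w' q)))"
    using gpair_product(1)[OF gp x0] by (simp add: norm_mult norm_power S_def C_def)
  then have "ln 1 \<le> ln ((S ^ e * (C * norm (poly w q))) * (S ^ e * (C * norm (poly w' q))))" by (intro ln_mono) auto
  also have "\<dots> = (real e * ln S + (ln C + ln (norm (poly w q)))) + (real e * ln S + (ln C + ln (norm (poly w' q))))"
    using SC pos by (simp only: ln_mult_pos mult_pos_pos zero_less_power ln_realpow)
  finally have 1: "0 \<le> 2 * (real e * ln S) + 2 * ln C + ln (norm (poly w q)) + ln (norm (poly w' q))" by simp
  have 2: "ln (norm (poly V q)) = ln (norm (poly P q)) + ln (norm (poly w q))"
    "ln (norm (poly V' q)) = ln (norm (poly P q)) + ln (norm (poly w' q))"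
    unfolding w w' poly_mult norm_mult using pos by (simp_all only: ln_mult_pos)
  have 3: "real e = 2 * real (\<Sum>i<n. qdeg s i) - real (degree P)" using degP unfolding e_def M_def by simp
  have "0 \<le> 2 * (real e * ln S) + 2 * ln C + ln (norm (poly V q)) + ln (norm (poly V' q)) - 2 * ln (norm (poly P q))"
    using 1 2 by linarith
  then show "0 \<le> 2 * (2 * real (\<Sum>i<n. qdeg s i) - real (degree (psi A N n))) * ln \<bar>real_of_int \<sigma>\<bar>
      + 2 * ln \<bar>real_of_int (scale d s n)\<bar>
      + ln (norm (poly (qhankel a l \<mu> s n) q)) + ln (norm (poly (qhankel a' l' \<mu>' s n) q))
      - 2 * ln (norm (poly (psi A N n) q))"
    unfolding 3 S_def C_def c_def V_def V'_def P_def by (simp only: mult.assoc)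
qed

end

section \<open>Comparison of growth rates\<close>

lemma sum_qdeg_le:
  "real (\<Sum>i<n. qdeg s i) \<le> real n ^ 3 / 3 + ((real s + 1) + (real s + 1)\<^sup>2) * (real n)\<^sup>2"
proof (induction n)
  case (Suc n)
  define k where "k = real s + 1"
  define x where "x = real n"
  have k: "1 \<le> k" and x: "0 \<le> x" unfolding k_def x_def by simp_all
  have "0 \<le> k * x + 2 * (k * k * x)" using k x by simp
  moreover have "1 * x \<le> k * x" by (rule mult_right_mono[OF k x])
  ultimately have "x\<^sup>2 + k * x + k\<^sup>2 + (x ^ 3 / 3 + (k + k\<^sup>2) * x\<^sup>2) \<le> (x + 1) ^ 3 / 3 + (k + k\<^sup>2) * (x + 1)\<^sup>2"
    using k x by (simp add: power2_eq_square power3_eq_cube field_simps)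
  moreover have "real (qdeg s n) = x\<^sup>2 + k * x + k\<^sup>2"
    unfolding qdeg_def k_def x_def by (simp only: of_nat_add of_nat_mult of_nat_power of_nat_1)
  moreover have "real (Suc n) = x + 1" unfolding x_def by simp
  ultimately show ?case using Suc by (simp only: sum.lessThan_Suc of_nat_add k_def[symmetric] x_def[symmetric])
qed simp

lemma sum_shift_le: "real (\<Sum>i<n. i + s + 1) \<le> (real s + 1) * (real n)\<^sup>2"
proof (induction n)
  case (Suc n)
  have h: "real n + real s + 1 \<le> (real s + 1) * (2 * real n + 1)"
    by (simp add: algebra_simps)
  have e: "(real s + 1) * (real (Suc n))\<^sup>2 = (real s + 1) * (real n)\<^sup>2 + (real s + 1) * (2 * real n + 1)"
    by (simp add: power2_eq_square algebra_simps)
  show ?case using add_mono[OF Suc h] unfolding e sum.lessThan_Suc of_nat_add of_nat_1 .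
qed simp

lemma (in quadratic_surd) ln_scale_le:
  assumes d: "d \<noteq> 0"
  shows "ln \<bar>real_of_int (scale d s n)\<bar> \<le> 2 * (real s + 1) * ln \<bar>real_of_int d\<bar> * (real n)\<^sup>2"
proof -
  define L where "L = ln \<bar>real_of_int d\<bar>"
  have L: "0 \<le> L" unfolding L_def using d by (intro ln_ge_zero) linarith
  have "\<bar>real_of_int (scale d s n)\<bar> = \<bar>real_of_int d\<bar> ^ ((\<Sum>i<n. i) + (\<Sum>i<n. i + s + 1))"
    unfolding scale_def power_add[of _ "\<Sum>i<n. i"] power_sum
    by (simp only: of_int_mult of_int_prod of_int_power abs_mult abs_prod power_abs)
  then have "ln \<bar>real_of_int (scale d s n)\<bar> = real ((\<Sum>i<n. i) + (\<Sum>i<n. i + s + 1)) * L"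
    unfolding L_def using d by (simp only: ln_realpow zero_less_abs_iff of_int_eq_0_iff not_False_eq_True)
  also have "\<dots> \<le> (2 * (real s + 1) * (real n)\<^sup>2) * L"
  proof (rule mult_right_mono[OF _ L])
    have "(\<Sum>i<n. i) \<le> (\<Sum>i<n. i + s + 1)" by (rule sum_mono) simp
    then show "real ((\<Sum>i<n. i) + (\<Sum>i<n. i + s + 1)) \<le> 2 * (real s + 1) * (real n)\<^sup>2"
      using sum_shift_le[of s n] by linarith
  qed
  finally show ?thesis unfolding L_def by (simp only: mult_ac)
qed

lemma qhankel_growth:
  assumes q: "norm q > 1"
  shows "\<exists>K. \<forall>n. poly (qhankel a l \<mu> s n) q \<noteq> 0 \<longrightarrow>
    ln (norm (poly (qhankel a l \<mu> s n) q)) \<le> 2 / 3 * ln (norm q) * real n ^ 3 + K * (real n)\<^sup>2"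
proof -
  define C where "C = 2 * (1 + norm l) * (1 + norm a) * (1 + norm \<mu>)"
  have "1 * 1 * 1 * 1 \<le> C" unfolding C_def by (intro mult_mono) auto
  then have C: "1 \<le> C" by simp
  define b where "b = ln (norm q)"
  have b: "0 \<le> b" unfolding b_def using q by simp
  define k where "k = (real s + 1) + (real s + 1)\<^sup>2"
  have "ln (norm (poly (qhankel a l \<mu> s n) q)) \<le> 2 / 3 * b * real n ^ 3 + (1 + 2 * (real s + 1) * ln C + 2 * k * b) * (real n)\<^sup>2"
    if nz: "poly (qhankel a l \<mu> s n) q \<noteq> 0" for n
  proof -
    define d where "d i = C ^ (i + s + 1) * norm q ^ qdeg s i" for i
    have d: "0 < d i" for i unfolding d_def using C q by (intro mult_pos_pos zero_less_power) linarith+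
    have "norm (poly (qtail a l \<mu> (i + j + s)) q) \<le> d i * d j" for i j
    proof -
      have "norm (poly (qtail a l \<mu> (i + j + s)) q) \<le> C ^ (i + j + s + 1) * norm q ^ \<Sum>{..i + j + s}"
        unfolding C_def using q by (intro norm_poly_qtail_le) simp
      also have "\<dots> \<le> C ^ ((i + s + 1) + (j + s + 1)) * norm q ^ (qdeg s i + qdeg s j)"
        using C q by (intro mult_mono power_increasing sum_upto_le_qdeg) auto
      also have "\<dots> = d i * d j" unfolding d_def by (simp only: power_add mult_ac)
      finally show ?thesis .
    qed
    then have "norm (ndet n (\<lambda>i j. poly (qtail a l \<mu> (i + j + s)) q)) \<le> fact n * (\<Prod>i<n. d i)\<^sup>2"
      using d by (intro norm_ndet_le) (simp_all add: less_imp_le)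
    then have le: "norm (poly (qhankel a l \<mu> s n) q) \<le> fact n * (\<Prod>i<n. d i)\<^sup>2"
      unfolding qhankel_def poly_ndet .
    have "(\<Prod>i<n. d i) = C ^ (\<Sum>i<n. i + s + 1) * norm q ^ (\<Sum>i<n. qdeg s i)"
      unfolding d_def prod.distrib power_sum ..
    moreover have "0 < C" "0 < norm q" using C q by linarith+
    ultimately have lnp: "ln (\<Prod>i<n. d i) = real (\<Sum>i<n. i + s + 1) * ln C + real (\<Sum>i<n. qdeg s i) * b"
      unfolding b_def by (simp only: ln_mult_pos zero_less_power ln_realpow)
    have pp: "0 < (\<Prod>i<n. d i)" using d by (intro prod_pos) auto
    have "ln (norm (poly (qhankel a l \<mu> s n) q)) \<le> ln (fact n * (\<Prod>i<n. d i)\<^sup>2)"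
      using le nz by (intro ln_mono) auto
    also have "\<dots> = ln (fact n) + real 2 * ln (\<Prod>i<n. d i)"
      using pp by (simp only: ln_mult_pos fact_gt_zero zero_less_power ln_realpow)
    finally have 1: "ln (norm (poly (qhankel a l \<mu> s n) q)) \<le> ln (fact n) + 2 * ln (\<Prod>i<n. d i)" by simp
    have 2: "real (\<Sum>i<n. i + s + 1) * ln C \<le> ((real s + 1) * (real n)\<^sup>2) * ln C"
      using C by (intro mult_right_mono sum_shift_le ln_ge_zero)
    have 3: "real (\<Sum>i<n. qdeg s i) * b \<le> (real n ^ 3 / 3 + k * (real n)\<^sup>2) * b"
      unfolding k_def by (rule mult_right_mono[OF sum_qdeg_le b])
    define Z where "Z = ((real s + 1) * (real n)\<^sup>2) * ln C + (real n ^ 3 / 3 + k * (real n)\<^sup>2) * b"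
    have "ln (\<Prod>i<n. d i) \<le> Z" unfolding lnp Z_def by (rule add_mono[OF 2 3])
    then have "ln (norm (poly (qhankel a l \<mu> s n) q)) \<le> (real n)\<^sup>2 + 2 * Z"
      using 1 ln_fact_le[of n] by linarith
    also have "\<dots> = 2 / 3 * b * real n ^ 3 + (1 + 2 * (real s + 1) * ln C + 2 * k * b) * (real n)\<^sup>2"
      unfolding Z_def by (simp add: algebra_simps)
    finally show ?thesis .
  qed
  then show ?thesis unfolding b_def by blast
qed

lemma cubic_minus_quadratic_neg:
  fixes g K :: real
  assumes "0 < g"
  shows "\<exists>n::nat. K * (real n)\<^sup>2 - g * real n ^ 3 < 0"
proof -
  obtain n :: nat where n: "max 1 (K / g) < real n" using reals_Archimedean2 by blast
  then have "K < g * real n" using assms by (simp add: pos_divide_less_eq mult.commute)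
  then have "(K - g * real n) * (real n)\<^sup>2 < 0" using n by (intro mult_neg_pos) auto
  then show ?thesis by (intro exI[of _ n]) (simp add: power2_eq_square power3_eq_cube algebra_simps)
qed

lemma common_denominator:
  assumes "finite S" "S \<subseteq> \<rat>"
  shows "\<exists>d::int. d \<noteq> 0 \<and> (\<forall>x\<in>S. of_int d * x \<in> (\<int> :: complex set))"
  using assms
proof (induction S rule: finite_induct)
  case empty
  show ?case by (rule exI[of _ 1]) simp
next
  case (insert x S)
  then obtain d where d: "d \<noteq> 0" "\<forall>x\<in>S. of_int d * x \<in> (\<int> :: complex set)" by auto
  from insert have "x \<in> \<rat>" by simp
  then obtain a b where x: "0 < b" "x = of_int a / of_int b" by (metis Rats_cases')
  have "of_int (d * b) * x = of_int (d * a)" using x by simp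
  then have "of_int (d * b) * x \<in> \<int>" by (simp only: Ints_of_int)
  moreover have "of_int (d * b) * y \<in> (\<int> :: complex set)" if "y \<in> S" for y
  proof -
    have "of_int d * y \<in> (\<int> :: complex set)" using d(2) that by (rule bspec)
    then have "of_int b * (of_int d * y) \<in> (\<int> :: complex set)" by (rule Ints_mult[OF Ints_of_int])
    then show ?thesis by (simp only: of_int_mult mult_ac)
  qed
  moreover have "d * b \<noteq> 0" using d(1) x(1) by simp
  ultimately show ?case by (intro exI[of _ "d * b"] conjI ballI) (assumption, elim insertE, simp_all only:)
qed

lemma (in quadratic_surd) gpair_of_Ints:
  assumes "of_int d * x \<in> \<int>" "of_int d * y \<in> \<int>"
  shows "gpair (of_int d * (x + y * \<theta>)) (of_int d * (x - y * \<theta>))"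
proof -
  obtain a where a: "of_int d * x = of_int a" using assms(1) by (rule Ints_cases)
  obtain b where b: "of_int d * y = of_int b" using assms(2) by (rule Ints_cases)
  have "of_int d * (x + y * \<theta>) = of_int d * x + (of_int d * y) * \<theta>"
    "of_int d * (x - y * \<theta>) = of_int d * x - (of_int d * y) * \<theta>" by (simp_all add: algebra_simps)
  then show ?thesis unfolding gpair_def a b by blast
qed

text \<open>The arithmetic inequality for the two determinants, combined with all estimates, has a leading term of order
  \<open>n ^ 3\<close> with a negative coefficient as soon as \<open>N\<close> is large and \<open>\<eta>\<close> small.\<close>
lemma no_quadratic_coordinates:
  fixes \<rho> \<sigma> :: int and E :: real
  assumes surd: "quadratic_surd \<theta> D" and ser: "q_series q \<alpha> l"
    and q: "q = of_int \<rho> / of_int \<sigma>" and \<sigma>: "\<sigma> \<noteq> 0"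
    and coord: "\<alpha> = a1 + a2 * \<theta>" "l = l1 + l2 * \<theta>" "F q \<alpha> l = m1 + m2 * \<theta>"
    and rat: "a1 \<in> \<rat>" "a2 \<in> \<rat>" "l1 \<in> \<rat>" "l2 \<in> \<rat>" "m1 \<in> \<rat>" "m2 \<in> \<rat>"
    and a: "a = (if l = 0 then 5 / 24 else 1 / 6)"
    and E: "(\<lambda>N. 1 / pi\<^sup>2 * (\<Sum>J\<in>jset N. 1 / (real J)\<^sup>2)) \<longlonglongrightarrow> E"
    and gap: "2 * (2 / 3 - (a + E)) * ln \<bar>real_of_int \<sigma>\<bar>
      < (2 * (a + E) - (if l = 0 then 1 / 6 else 1 / 3)) * ln (norm q)"
  shows False
proof -
  interpret quadratic_surd \<theta> D by (rule surd)
  interpret Q: q_series q \<alpha> l by (rule ser)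
  define b where "b = ln (norm q)"
  define \<kappa> where "\<kappa> = ln \<bar>real_of_int \<sigma>\<bar>"
  define e :: real where "e = (if l = 0 then 1 / 6 else 1 / 3)"
  have b: "0 < b" unfolding b_def using Q.q by (rule ln_gt_zero)
  have \<kappa>: "0 \<le> \<kappa>" unfolding \<kappa>_def using \<sigma> by (intro ln_ge_zero) linarith
  have "\<exists>d. d \<noteq> 0 \<and> (\<forall>x\<in>{a1, a2, l1, l2, m1, m2}. of_int d * x \<in> (\<int> :: complex set))"
    by (rule common_denominator) (use rat in auto)
  then obtain d where d: "d \<noteq> 0"
    and dI: "of_int d * a1 \<in> \<int>" "of_int d * a2 \<in> \<int>" "of_int d * l1 \<in> \<int>" "of_int d * l2 \<in> \<int>"
      "of_int d * m1 \<in> \<int>" "of_int d * m2 \<in> \<int>" by auto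
  define \<alpha>' l' \<mu>' where "\<alpha>' = a1 - a2 * \<theta>" and "l' = l1 - l2 * \<theta>" and "\<mu>' = m1 - m2 * \<theta>"
  have g: "gpair (of_int d * \<alpha>) (of_int d * \<alpha>')" "gpair (of_int d * l) (of_int d * l')"
    "gpair (of_int d * F q \<alpha> l) (of_int d * \<mu>')"
    unfolding \<alpha>'_def l'_def \<mu>'_def coord(3) using dI
    by (simp_all only: coord(1)[symmetric] coord(2)[symmetric] gpair_of_Ints[of d a1 a2, folded coord(1)]
      gpair_of_Ints[of d l1 l2, folded coord(2)] gpair_of_Ints)
  (* The better power of X for l = 0 is needed for the conjugate determinant too. *)
  have l': "l' = 0" if "l = 0"
  proof (cases "l2 = 0")
    case True
    then show ?thesis using that coord(2) unfolding l'_def by simp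
  next
    case False
    have "l2 * \<theta> = - l1" using that coord(2) by (simp add: eq_neg_iff_add_eq_0 add.commute)
    then have "\<theta> = - l1 / l2" using False by (simp add: field_simps)
    moreover have "- l1 / l2 \<in> \<rat>" using rat(3,4) by simp
    ultimately show ?thesis using irrational by simp
  qed
  define A where "A n = (if l = 0 then xval0 n else xval n)" for n
  have A: "monom 1 (A n) dvd qhankel \<alpha> l \<mu> s n" "monom 1 (A n) dvd qhankel \<alpha>' l' \<mu>' s n" for n s \<mu>
    unfolding A_def using l' X_power_xval_dvd_qhankel X_power_xval0_dvd_qhankel by simp_all
  have A_ge: "a * real n ^ 3 - 2 * (real n)\<^sup>2 \<le> real (A n)" for n
    unfolding A_def a using xval_ge[of n] xval0_ge[of n] by simp
  define g where "g = (2 * (a + E) - e) * b - 2 * (2 / 3 - (a + E)) * \<kappa>"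
  have "0 < g" using gap unfolding g_def e_def b_def \<kappa>_def by simp
  define B where "B N = a + 1 / pi\<^sup>2 * (\<Sum>J\<in>jset N. 1 / (real J)\<^sup>2)" for N
  have "(\<lambda>N. (2 * B N - e) * b - 2 * (2 / 3 - B N) * \<kappa>) \<longlonglongrightarrow> g"
    unfolding g_def B_def by (intro tendsto_intros E)
  then have "\<forall>\<^sub>F N in sequentially. 0 < (2 * B N - e) * b - 2 * (2 / 3 - B N) * \<kappa>"
    using \<open>0 < g\<close> by (rule order_tendstoD(1))
  then obtain N where "0 < (2 * B N - e) * b - 2 * (2 / 3 - B N) * \<kappa>"
    unfolding eventually_sequentially by auto
  define h where "h = (2 * B N - e) * b - 2 * (2 / 3 - B N) * \<kappa>"
  have h: "0 < h" unfolding h_def by fact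
  (* This \<eta> makes all errors of order n ^ 3 add up to half of the gap h. *)
  define \<eta> where "\<eta> = h / (4 * (\<kappa> + 1))"
  have \<eta>: "0 < \<eta>" unfolding \<eta>_def using h \<kappa> by simp
  have \<eta>h: "2 * \<eta> * \<kappa> + 2 * \<eta> = h / 2" 
  proof -
    have "4 * (\<kappa> + 1) \<noteq> 0" using \<kappa> by simp
    from nonzero_eq_divide_eq[THEN iffD1, OF this \<eta>_def] have "\<eta> * (4 * (\<kappa> + 1)) = h" .
    then show ?thesis by (simp add: algebra_simps)
  qed
  obtain s K1 where small: "\<And>n. poly (qhankel \<alpha> l (F q \<alpha> l) s n) q \<noteq> 0"
    "\<And>n. ln (norm (poly (qhankel \<alpha> l (F q \<alpha> l) s n) q)) \<le> K1 * (real n)\<^sup>2 - real (2 + Q.\<delta>) / 6 * real n ^ 3 * b"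
    using Q.qhankel_small unfolding b_def by blast
  obtain K2 where growth: "\<And>n. poly (qhankel \<alpha>' l' \<mu>' s n) q \<noteq> 0 \<Longrightarrow>
    ln (norm (poly (qhankel \<alpha>' l' \<mu>' s n) q)) \<le> 2 / 3 * b * real n ^ 3 + K2 * (real n)\<^sup>2"
    using qhankel_growth[OF Q.q, of \<alpha>' l' \<mu>' s] unfolding b_def by blast
  obtain K3 where deg: "\<And>n A. real A + 1 / pi\<^sup>2 * (\<Sum>J\<in>jset N. 1 / (real J)\<^sup>2) * real n ^ 3 - \<eta> * real n ^ 3 - K3 * (real n)\<^sup>2
    \<le> real (degree (psi A N n))" using psi_degree_ge[OF \<eta>, of N] by blast
  obtain K4 where lnpsi: "\<And>n A. (real A + 1 / pi\<^sup>2 * (\<Sum>J\<in>jset N. 1 / (real J)\<^sup>2) * real n ^ 3) * b - \<eta> * real n ^ 3 - K4 * (real n)\<^sup>2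
    \<le> ln (norm (poly (psi A N n) q))" using ln_psi_ge[OF Q.q \<eta>, of N] unfolding b_def by blast
  define k where "k = (real s + 1) + (real s + 1)\<^sup>2"
  define K5 where "K5 = 2 * (real s + 1) * ln \<bar>real_of_int d\<bar>"
  define K where "K = 2 * (2 * k + 2 + K3) * \<kappa> + 2 * K5 + K1 + K2 + 2 * (2 * b + K4)"
  have \<delta>: "2 / 3 - real (2 + Q.\<delta>) / 6 = e" unfolding Q.\<delta>_def e_def by simp
  have "0 \<le> K * (real n)\<^sup>2 - h / 2 * real n ^ 3" for n
  proof -
    have "monom 1 (A n) dvd qhankel \<alpha> l (F q \<alpha> l) s n" "monom 1 (A n) dvd qhankel \<alpha>' l' \<mu>' s n" by (rule A)+
    note P = qhankel_product_ge[OF g d \<sigma> q Q.q this small(1)]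
    define S where "S = real (\<Sum>i<n. qdeg s i)"
    define x3 x2 where "x3 = real n ^ 3" and "x2 = (real n)\<^sup>2"
    define dp lp where "dp = real (degree (psi (A n) N n))" and "lp = ln (norm (poly (psi (A n) N n) q))"
    define E' where "E' = 1 / pi\<^sup>2 * (\<Sum>J\<in>jset N. 1 / (real J)\<^sup>2)"
    have BE: "B N = a + E'" unfolding B_def E'_def ..
    have S: "S \<le> x3 / 3 + k * x2" unfolding S_def x3_def x2_def k_def by (rule sum_qdeg_le)
    have A': "a * x3 - 2 * x2 \<le> real (A n)" unfolding x3_def x2_def by (rule A_ge)
    have dp: "real (A n) + E' * x3 - \<eta> * x3 - K3 * x2 \<le> dp"
      unfolding dp_def E'_def x3_def x2_def by (rule deg)
    have lp: "(real (A n) + E' * x3) * b - \<eta> * x3 - K4 * x2 \<le> lp"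
      unfolding lp_def E'_def x3_def x2_def by (rule lnpsi)
    have "2 * S - dp \<le> (2 / 3 - B N + \<eta>) * x3 + (2 * k + 2 + K3) * x2"
      using S A' dp unfolding BE by (simp add: algebra_simps)
    then have 1: "(2 * S - dp) * \<kappa> \<le> ((2 / 3 - B N + \<eta>) * x3 + (2 * k + 2 + K3) * x2) * \<kappa>"
      by (rule mult_right_mono[OF _ \<kappa>])
    have "(B N * x3 - 2 * x2) * b \<le> (real (A n) + E' * x3) * b"
      using A' b unfolding BE by (intro mult_right_mono) (simp_all add: algebra_simps)
    then have 2: "(B N * x3 - 2 * x2) * b - \<eta> * x3 - K4 * x2 \<le> lp" using lp by linarith
    have 3: "ln (norm (poly (qhankel \<alpha> l (F q \<alpha> l) s n) q)) \<le> K1 * x2 - real (2 + Q.\<delta>) / 6 * x3 * b"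
      unfolding x3_def x2_def by (rule small(2))
    have 4: "ln (norm (poly (qhankel \<alpha>' l' \<mu>' s n) q)) \<le> 2 / 3 * b * x3 + K2 * x2"
      unfolding x3_def x2_def by (rule growth[OF P(1)])
    have 5: "ln \<bar>real_of_int (scale d s n)\<bar> \<le> K5 * x2" unfolding K5_def x2_def by (rule ln_scale_le[OF d])
    define V V' c where "V = ln (norm (poly (qhankel \<alpha> l (F q \<alpha> l) s n) q))"
      and "V' = ln (norm (poly (qhankel \<alpha>' l' \<mu>' s n) q))" and "c = ln \<bar>real_of_int (scale d s n)\<bar>"
    define u1 u2 u3 u4 u5 w where "u1 = ((2 / 3 - B N + \<eta>) * x3 + (2 * k + 2 + K3) * x2) * \<kappa>"
      and "u2 = (B N * x3 - 2 * x2) * b - \<eta> * x3 - K4 * x2"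
      and "u3 = K1 * x2 - real (2 + Q.\<delta>) / 6 * x3 * b" and "u4 = 2 / 3 * b * x3 + K2 * x2"
      and "u5 = K5 * x2" and "w = (2 * S - dp) * \<kappa>"
    have "0 \<le> 2 * w + 2 * c + V + V' - 2 * lp"
      using P(3)[of N] unfolding S_def dp_def lp_def \<kappa>_def V_def V'_def c_def w_def by (simp only: mult.assoc)
    moreover have "w \<le> u1" "u2 \<le> lp" "V \<le> u3" "V' \<le> u4" "c \<le> u5"
      using 1 2 3 4 5 unfolding u1_def u2_def u3_def u4_def u5_def V_def V'_def c_def w_def by simp_all
    ultimately have "0 \<le> 2 * u1 + 2 * u5 + u3 + u4 - 2 * u2" by linarith
    also have "\<dots> = K * x2 + ((2 / 3 - real (2 + Q.\<delta>) / 6) * b - 2 * B N * b + 2 * (2 / 3 - B N) * \<kappa> + (2 * \<eta> * \<kappa> + 2 * \<eta>)) * x3"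
      unfolding K_def u1_def u2_def u3_def u4_def u5_def by (simp add: algebra_simps)
    also have "\<dots> = K * x2 - h / 2 * x3"
      unfolding \<delta> \<eta>h h_def by (simp add: algebra_simps)
    finally show ?thesis unfolding x3_def x2_def .
  qed
  moreover obtain n :: nat where "K * (real n)\<^sup>2 - h / 2 * real n ^ 3 < 0"
    using cubic_minus_quadratic_neg[of "h / 2" K] h by auto
  ultimately show False by (meson not_le)
qed

section \<open>The dilogarithm constant\<close>

lemma cis_third: "exp (2 * of_real pi * \<i> / 3) = Complex (- 1 / 2) (sqrt 3 / 2)"
proof -
  have "exp (2 * of_real pi * \<i> / 3) = cis (2 * pi / 3)"
    unfolding cis_conv_exp by (simp add: mult_ac)
  also have "\<dots> = Complex (- 1 / 2) (sqrt 3 / 2)"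
    by (simp add: complex_eq_iff cos_120 sin_120)
  finally show ?thesis .
qed

text \<open>The nontrivial Dirichlet character modulo \<open>3\<close>.\<close>
definition chi :: "nat \<Rightarrow> real" where
  "chi n = (if n mod 3 = 0 then 0 else if n mod 3 = 1 then 1 else - 1)"

lemma Im_cube_root_power: "Im (Complex (- 1 / 2) (sqrt 3 / 2) ^ n) = sqrt 3 / 2 * chi n"
proof -
  define w where "w = Complex (- 1 / 2) (sqrt 3 / 2)"
  have w2: "w ^ 2 = Complex (- 1 / 2) (- sqrt 3 / 2)"
    unfolding w_def power2_eq_square by (simp add: complex_eq_iff)
  have "w ^ 3 = w ^ 2 * w" by (simp add: power3_eq_cube power2_eq_square)
  also have "\<dots> = 1" unfolding w2 unfolding w_def by (simp add: complex_eq_iff)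
  finally have w3: "w ^ 3 = 1" .
  have "w ^ n = w ^ (3 * (n div 3) + n mod 3)" by simp
  also have "\<dots> = w ^ (n mod 3)" unfolding power_add power_mult w3 by simp
  finally have e: "w ^ n = w ^ (n mod 3)" .
  have "n mod 3 < 3" by simp
  then consider "n mod 3 = 0" | "n mod 3 = 1" | "n mod 3 = 2" by linarith
  then have "Im (w ^ n) = sqrt 3 / 2 * chi n"
  proof cases
    case 1
    then show ?thesis unfolding e chi_def by simp
  next
    case 2
    then show ?thesis unfolding e chi_def by (simp add: w_def)
  next
    case 3
    then show ?thesis unfolding e chi_def by (simp add: w2)
  qed
  then show ?thesis unfolding w_def .
qed

lemma Im_Li2_third_sums:
  "(\<lambda>n. chi n / (real n)\<^sup>2) sums (2 / sqrt 3 * Im (Li2 (exp (2 * of_real pi * \<i> / 3))))"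
proof -
  define w where "w = exp (2 * of_real pi * \<i> / 3)"
  have nw: "norm w = 1" unfolding w_def by simp
  define t where "t n = w ^ Suc n / of_nat (Suc n) ^ 2" for n
  have "norm (t n) = 1 / (real n + 1)\<^sup>2" for n
    unfolding t_def by (simp add: norm_divide norm_power norm_mult nw add.commute del: of_nat_Suc)
  then have "summable (\<lambda>n. norm (t n))"
    using inverse_squares_sums[THEN sums_summable] by (simp add: add.commute)
  then have "summable t" by (rule summable_norm_cancel)
  then have "t sums Li2 w" unfolding Li2_def t_def[symmetric] by (rule summable_sums)
  then have "(\<lambda>n. Im (t n)) sums Im (Li2 w)" by (rule sums_Im)
  moreover have "Im (t n) = sqrt 3 / 2 * (chi (Suc n) / (real (Suc n))\<^sup>2)" for n
  proof -
    have "t n = w ^ Suc n / of_real ((real (Suc n))\<^sup>2)" unfolding t_def by simp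
    then have "Im (t n) = Im (w ^ Suc n) / (real (Suc n))\<^sup>2" by (simp only: Im_divide_of_real)
    then show ?thesis unfolding w_def cis_third Im_cube_root_power by (simp only: times_divide_eq_right)
  qed
  ultimately have "(\<lambda>n. sqrt 3 / 2 * (chi (Suc n) / (real (Suc n))\<^sup>2)) sums Im (Li2 w)" by simp
  then have "(\<lambda>n. 2 / sqrt 3 * (sqrt 3 / 2 * (chi (Suc n) / (real (Suc n))\<^sup>2))) sums (2 / sqrt 3 * Im (Li2 w))"
    by (rule sums_mult)
  then have "(\<lambda>n. chi (Suc n) / (real (Suc n))\<^sup>2) sums (2 / sqrt 3 * Im (Li2 w))" by simp
  then show ?thesis unfolding w_def[symmetric]
    using sums_Suc_iff[of "\<lambda>n. chi n / (real n)\<^sup>2"] by simp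
qed

lemma inverse_squares_sums_0: "(\<lambda>n. 1 / (real n)\<^sup>2) sums (pi\<^sup>2 / 6)"
proof -
  have "(\<lambda>n. 1 / (real (Suc n))\<^sup>2) sums (pi\<^sup>2 / 6)"
    using inverse_squares_sums by (simp add: add.commute)
  then show ?thesis using sums_Suc_iff[of "\<lambda>n. 1 / (real n)\<^sup>2"] by simp
qed

text \<open>The indicator function of \<open>n mod 3 \<noteq> 1\<close> is \<open>1 / 2 + 1 / 2\<close> times that of \<open>3 dvd n\<close>, minus \<open>chi n / 2\<close>. The three
  resulting sums are \<open>\<pi>\<^sup>2 / 6\<close>, \<open>\<pi>\<^sup>2 / 54\<close> and the imaginary part of the dilogarithm.\<close>
lemma jset_sums:
  "(\<lambda>n. if n mod 3 = 1 then 0 else 1 / (real n)\<^sup>2) sums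
    (5 * pi\<^sup>2 / 54 - Im (Li2 (exp (2 * of_real pi * \<i> / 3))) / sqrt 3)"
proof -
  define L where "L = Im (Li2 (exp (2 * of_real pi * \<i> / 3)))"
  have "(\<lambda>n. 1 / 9 * (1 / (real n)\<^sup>2)) sums (1 / 9 * (pi\<^sup>2 / 6))"
    by (rule sums_mult[OF inverse_squares_sums_0])
  moreover have "1 / 9 * (1 / (real n)\<^sup>2) = (if 3 dvd 3 * n then 1 / (real (3 * n))\<^sup>2 else 0)" for n
    by (simp add: power_mult_distrib)
  ultimately have "(\<lambda>n. if 3 dvd 3 * n then 1 / (real (3 * n))\<^sup>2 else 0) sums (1 / 9 * (pi\<^sup>2 / 6))" by simp
  moreover have "strict_mono (\<lambda>n::nat. 3 * n)" by (rule strict_monoI) simp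
  ultimately have m3: "(\<lambda>n. if 3 dvd n then 1 / (real n)\<^sup>2 else 0) sums (1 / 9 * (pi\<^sup>2 / 6))"
    by (subst (asm) sums_mono_reindex) (auto simp: image_iff elim!: dvdE)
  have "(\<lambda>n. 1 / 2 * (1 / (real n)\<^sup>2) + 1 / 2 * (if 3 dvd n then 1 / (real n)\<^sup>2 else 0) - 1 / 2 * (chi n / (real n)\<^sup>2))
    sums (1 / 2 * (pi\<^sup>2 / 6) + 1 / 2 * (1 / 9 * (pi\<^sup>2 / 6)) - 1 / 2 * (2 / sqrt 3 * L))"
    unfolding L_def by (intro sums_add sums_diff sums_mult inverse_squares_sums_0 m3 Im_Li2_third_sums)
  moreover have "1 / 2 * (1 / (real n)\<^sup>2) + 1 / 2 * (if 3 dvd n then 1 / (real n)\<^sup>2 else 0) - 1 / 2 * (chi n / (real n)\<^sup>2)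
    = (if n mod 3 = 1 then 0 else 1 / (real n)\<^sup>2)" for n
    unfolding chi_def dvd_eq_mod_eq_0 by simp
  moreover have "1 / 2 * (pi\<^sup>2 / 6) + 1 / 2 * (1 / 9 * (pi\<^sup>2 / 6)) - 1 / 2 * (2 / sqrt 3 * L) = 5 * pi\<^sup>2 / 54 - L / sqrt 3"
    by simp
  ultimately show ?thesis unfolding L_def by simp
qed

text \<open>The asymptotic contribution, in multiples of \<open>n ^ 3\<close>, of the cyclotomic factors to the degree of \<open>psi\<close>.\<close>
definition jconst :: real where
  "jconst = 1 / pi\<^sup>2 * (5 * pi\<^sup>2 / 54 - Im (Li2 (exp (2 * of_real pi * \<i> / 3))) / sqrt 3)"

lemma jset_sum_tendsto: "(\<lambda>N. 1 / pi\<^sup>2 * (\<Sum>J\<in>jset N. 1 / (real J)\<^sup>2)) \<longlonglongrightarrow> jconst"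
proof -
  have "(\<Sum>J\<in>jset N. 1 / (real J)\<^sup>2) = (\<Sum>n<Suc N. if n mod 3 = 1 then 0 else 1 / (real n)\<^sup>2)" for N
  proof (rule sum.mono_neutral_cong_left)
    show "\<forall>i\<in>{..<Suc N} - jset N. (if i mod 3 = 1 then 0 else 1 / (real i)\<^sup>2) = 0"
    proof
      fix i assume i: "i \<in> {..<Suc N} - jset N"
      show "(if i mod 3 = 1 then 0 else 1 / (real i)\<^sup>2) = 0"
      proof (cases "i = 0")
        case False
        then have "i = 1 \<or> i mod 3 = 1" using i by (auto simp: jset_def)
        then show ?thesis by auto
      qed simp
    qed
  qed (auto simp: jset_def)
  then show ?thesis unfolding jconst_def
    using LIMSEQ_Suc[OF jset_sums[unfolded sums_def]] by (simp only: tendsto_mult_left)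
qed

lemma jconst_pos: "0 < jconst"
proof -
  let ?f = "\<lambda>n. if n mod 3 = 1 then 0 else 1 / (real n)\<^sup>2"
  have "0 < suminf ?f"
    by (rule suminf_pos2[OF sums_summable[OF jset_sums], of 2]) simp_all
  then show ?thesis unfolding jconst_def sums_unique[OF jset_sums, symmetric] by simp
qed

text \<open>In terms of \<open>jconst\<close> the bounds have positive denominators, so the inequality for the exponent can be cleared.\<close>
lemma threshold_eq:
  "27 * pi\<^sup>2 / (5 * pi\<^sup>2 - 18 * sqrt 3 * Im (Li2 (exp (2 * of_real pi * \<i> / 3)))) = 1 / (2 * jconst)"
  "126 * pi\<^sup>2 / (47 * pi\<^sup>2 - 72 * sqrt 3 * Im (Li2 (exp (2 * of_real pi * \<i> / 3)))) = (7 / 6) / (1 / 4 + 2 * jconst)"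
proof -
  define L where "L = Im (Li2 (exp (2 * of_real pi * \<i> / 3)))"
  have p: "pi\<^sup>2 \<noteq> 0" by simp
  have "sqrt 3 * sqrt 3 = (3 :: real)" by simp
  then have "L / sqrt 3 = sqrt 3 * L / 3" by (simp add: field_simps)
  then have j: "pi\<^sup>2 * jconst = 5 * pi\<^sup>2 / 54 - sqrt 3 * L / 3"
    unfolding jconst_def L_def[symmetric] by simp
  then have e: "5 * pi\<^sup>2 - 18 * sqrt 3 * L = pi\<^sup>2 * (54 * jconst)" "47 * pi\<^sup>2 - 72 * sqrt 3 * L = pi\<^sup>2 * (27 + 216 * jconst)"
    by (simp_all add: algebra_simps)
  show "27 * pi\<^sup>2 / (5 * pi\<^sup>2 - 18 * sqrt 3 * Im (Li2 (exp (2 * of_real pi * \<i> / 3)))) = 1 / (2 * jconst)"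
    unfolding L_def[symmetric] e using jconst_pos by (simp add: field_simps)
  show "126 * pi\<^sup>2 / (47 * pi\<^sup>2 - 72 * sqrt 3 * Im (Li2 (exp (2 * of_real pi * \<i> / 3)))) = (7 / 6) / (1 / 4 + 2 * jconst)"
  proof -
    define x where "x = 1 / 4 + 2 * jconst"
    have "27 + 216 * jconst = 108 * x" "x \<noteq> 0" unfolding x_def using jconst_pos by simp_all
    then show ?thesis unfolding L_def[symmetric] e x_def[symmetric] using p by (simp add: field_simps)
  qed
qed

section \<open>Quadratic fields\<close>

text \<open>Completing the square, and multiplying by the denominator of the discriminant.\<close>
lemma quadratic_surd_coordinates:
  assumes x: "x \<notin> \<rat>" and e: "x\<^sup>2 = b * x + c" and bc: "b \<in> \<rat>" "c \<in> \<rat>"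
  obtains \<theta> D u v where "quadratic_surd \<theta> D" "u \<in> \<rat>" "v \<in> \<rat>" "x = u + v * \<theta>"
proof -
  have "c + b\<^sup>2 / 4 \<in> \<rat>" using bc by simp
  then obtain m n where mn: "0 < n" "c + b\<^sup>2 / 4 = of_int m / of_int n" by (metis Rats_cases')
  define \<theta> where "\<theta> = of_int n * (x - b / 2)"
  have n0: "(of_int n :: complex) \<noteq> 0" using mn(1) by simp
  have xe: "x = b / 2 + 1 / of_int n * \<theta>" unfolding \<theta>_def using n0 by simp
  have "(x - b / 2)\<^sup>2 = x\<^sup>2 - b * x + b\<^sup>2 / 4" by (simp add: power2_eq_square algebra_simps)
  also have "\<dots> = of_int m / of_int n" unfolding mn(2)[symmetric] e by simp
  finally have "\<theta>\<^sup>2 = of_int n ^ 2 * (of_int m / of_int n)" unfolding \<theta>_def power_mult_distrib by simp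
  also have "\<dots> = of_int (n * m)" using n0 by (simp add: power2_eq_square)
  finally have sq: "\<theta>\<^sup>2 = of_int (n * m)" .
  have irr: "\<theta> \<notin> \<rat>"
  proof
    assume "\<theta> \<in> \<rat>"
    then have "b / 2 + 1 / of_int n * \<theta> \<in> \<rat>" using bc by simp
    then show False using x xe by simp
  qed
  show ?thesis
    by (rule that[of \<theta> "n * m" "b / 2" "1 / of_int n"]) (use sq irr bc xe in \<open>simp_all add: quadratic_surd_def\<close>)
qed

lemma ring_of_type_algebra_simps:
  defines "R \<equiv> (ring_of_type_algebra :: complex ring)"
  shows "carrier R = UNIV" "\<zero>\<^bsub>R\<^esub> = 0" "\<one>\<^bsub>R\<^esub> = 1" "x \<oplus>\<^bsub>R\<^esub> y = x + y" "x \<otimes>\<^bsub>R\<^esub> y = x * y"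
  unfolding R_def ring_of_type_algebra_def by simp_all

lemma quadratic_extension_basis:
  assumes "quadratic_extension K"
  obtains v w where "K = {a * v + b * w | a b. a \<in> \<rat> \<and> b \<in> \<rat>}" "w \<noteq> 0" "\<forall>b\<in>\<rat>. v \<noteq> b * w"
proof -
  interpret R: ring "ring_of_type_algebra :: complex ring" by (rule ring_from_type_algebra)
  have dim: "R.dimension 2 \<rat> K" using assms unfolding quadratic_extension_def by blast
  have le: "R.line_extension \<rat> v E = {a * v + e | a e. a \<in> \<rat> \<and> e \<in> E}" for v E
    unfolding set_eq_iff R.line_extension_mem_iff ring_of_type_algebra_simps mem_Collect_eq by blast
  from dim have "\<exists>v E. v \<notin> E \<and> R.dimension (Suc 0) \<rat> E \<and> K = R.line_extension \<rat> v E"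
    by (cases rule: R.dimension.cases) (auto simp: numeral_2_eq_2)
  then obtain v E where v: "v \<notin> E" "R.dimension (Suc 0) \<rat> E" "K = R.line_extension \<rat> v E" by blast
  from v(2) have "\<exists>w E0. w \<notin> E0 \<and> R.dimension 0 \<rat> E0 \<and> E = R.line_extension \<rat> w E0"
    by (cases rule: R.dimension.cases) auto
  then obtain w E0 where w: "w \<notin> E0" "R.dimension 0 \<rat> E0" "E = R.line_extension \<rat> w E0" by blast
  from w(2) have E0: "E0 = {0}"
    by (cases rule: R.dimension.cases) (auto simp: ring_of_type_algebra_simps)
  have E: "E = {b * w | b. b \<in> \<rat>}" unfolding w(3) le E0 by auto
  have "K = {a * v + b * w | a b. a \<in> \<rat> \<and> b \<in> \<rat>}" unfolding v(3) le E by auto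
  moreover have "w \<noteq> 0" using w(1) E0 by simp
  moreover have "\<forall>b\<in>\<rat>. v \<noteq> b * w" using v(1) unfolding E by auto
  ultimately show ?thesis by (rule that)
qed

text \<open>An extension of degree \<open>2\<close> contains an irrational \<open>x\<close>; then \<open>1\<close> and \<open>x\<close> form a basis, and \<open>x\<^sup>2\<close>
  expressed in it is a quadratic equation for \<open>x\<close>.\<close>
lemma quadratic_extension_coordinates:
  assumes K: "quadratic_extension K"
  obtains \<theta> D where "quadratic_surd \<theta> D" "\<forall>x\<in>K. \<exists>a\<in>\<rat>. \<exists>b\<in>\<rat>. x = a + b * \<theta>"
proof -
  obtain v w where basis: "K = {a * v + b * w | a b. a \<in> \<rat> \<and> b \<in> \<rat>}" and w: "w \<noteq> 0"
    and v: "\<forall>b\<in>\<rat>. v \<noteq> b * w" by (rule quadratic_extension_basis[OF K])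
  have sub: "subring K (ring_of_type_algebra :: complex ring)"
    using K unfolding quadratic_extension_def by (blast intro: subfieldE(1))
  have one: "1 \<in> K" using subringE(3)[OF sub] unfolding ring_of_type_algebra_simps .
  have mult: "x * y \<in> K" if "x \<in> K" "y \<in> K" for x y
    using subringE(6)[OF sub that] unfolding ring_of_type_algebra_simps .
  have vw: "v \<in> K" "w \<in> K"
    unfolding basis mem_Collect_eq
    by (rule exI[of _ 1], rule exI[of _ 0], simp, rule exI[of _ 0], rule exI[of _ 1], simp)
  obtain x where x: "x \<in> K" "x \<notin> \<rat>"
  proof (rule ccontr)
    assume "\<not> thesis"
    then have "v \<in> \<rat>" "w \<in> \<rat>" using vw that by blast+
    then have "v / w \<in> \<rat>" by simp
    then show False using bspec[OF v, of "v / w"] w by simp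
  qed
  obtain a1 b1 where e1: "1 = a1 * v + b1 * w" "a1 \<in> \<rat>" "b1 \<in> \<rat>" using one unfolding basis by blast
  obtain a2 b2 where e2: "x = a2 * v + b2 * w" "a2 \<in> \<rat>" "b2 \<in> \<rat>" using x(1) unfolding basis by blast
  define d where "d = a1 * b2 - a2 * b1"
  have dv: "d * v = b2 - b1 * x" and dw: "d * w = a1 * x - a2"
  proof -
    have "b2 * 1 - b1 * x = d * v" "a1 * x - a2 * 1 = d * w"
      unfolding d_def by (subst e1(1), subst e2(1), simp add: algebra_simps)+
    then show "d * v = b2 - b1 * x" "d * w = a1 * x - a2" by simp_all
  qed
  have d: "d \<noteq> 0"
  proof
    assume "d = 0"
    then have 1: "b1 * x = b2" "a1 * x = a2" using dv dw by simp_all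
    have "a1 \<noteq> 0 \<or> b1 \<noteq> 0" using e1(1) by auto
    then have "x = a2 / a1 \<or> x = b2 / b1" using 1 by (auto simp: nonzero_eq_divide_eq mult.commute)
    then show False using x(2) e1 e2 by auto
  qed
  have span: "\<exists>a\<in>\<rat>. \<exists>b\<in>\<rat>. y = a + b * x" if yK: "y \<in> K" for y
  proof -
    obtain a b where y: "y = a * v + b * w" "a \<in> \<rat>" "b \<in> \<rat>" using yK unfolding basis by blast
    have v: "v = (b2 - b1 * x) / d" and w: "w = (a1 * x - a2) / d"
      using dv dw d by (simp_all add: nonzero_eq_divide_eq mult.commute)
    have "y = (a * b2 - b * a2) / d + (b * a1 - a * b1) / d * x"
      unfolding y(1) v w using d by (simp add: field_simps)
    moreover have "(a * b2 - b * a2) / d \<in> \<rat>" "(b * a1 - a * b1) / d \<in> \<rat>"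
      unfolding d_def using y e1 e2 by simp_all
    ultimately show ?thesis by blast
  qed
  obtain c b where cb: "x * x = c + b * x" "c \<in> \<rat>" "b \<in> \<rat>" using span[OF mult[OF x(1) x(1)]] by blast
  then have "x\<^sup>2 = b * x + c" by (simp add: power2_eq_square)
  then obtain \<theta> D r s where th: "quadratic_surd \<theta> D" "r \<in> \<rat>" "s \<in> \<rat>" "x = r + s * \<theta>"
    using quadratic_surd_coordinates[OF x(2) _ cb(3) cb(2)] by blast
  have "\<exists>a\<in>\<rat>. \<exists>b\<in>\<rat>. y = a + b * \<theta>" if yK: "y \<in> K" for y
  proof -
    obtain a b where y: "y = a + b * x" "a \<in> \<rat>" "b \<in> \<rat>" using span[OF yK] by blast
    have "y = (a + b * r) + (b * s) * \<theta>" unfolding y(1) th(4) by (simp add: algebra_simps)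
    moreover have "a + b * r \<in> \<rat>" "b * s \<in> \<rat>" using y th by simp_all
    ultimately show ?thesis by blast
  qed
  then show ?thesis using th(1) that by blast
qed

text \<open>If \<open>\<alpha>\<close>, \<open>l\<close> and \<open>\<mu>\<close> are all rational, any quadratic field contains them.\<close>
lemma quadratic_surd_i: "quadratic_surd \<i> (- 1)"
proof
  show "\<i> \<notin> \<rat>"
  proof
    assume "\<i> \<in> \<rat>"
    then obtain a b where ab: "0 < b" "\<i> = of_int a / of_int b" by (metis Rats_cases')
    then have "(of_int b :: complex) \<noteq> 0" by simp
    from nonzero_eq_divide_eq[THEN iffD1, OF this ab(2)] have "\<i> * of_int b = of_int a" .
    from arg_cong[OF this, of Im] show False using ab(1) by simp
  qed
qed simp

lemma map_poly_of_rat_degree_le_2: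
  assumes "degree p \<le> 2"
  shows "poly (map_poly of_rat p) x = of_rat (coeff p 0) + of_rat (coeff p 1) * x + of_rat (coeff p 2) * (x :: complex)\<^sup>2"
proof -
  have "degree (map_poly of_rat p :: complex poly) \<le> 2" using assms by (simp add: degree_map_poly)
  then have "poly (map_poly of_rat p) x = (\<Sum>k\<le>2. coeff (map_poly of_rat p) k * x ^ k)"
    unfolding poly_altdef by (intro sum.mono_neutral_left) (auto simp: coeff_eq_0)
  then show ?thesis by (simp add: coeff_map_poly numeral_2_eq_2)
qed

lemma algebraic_of_degree_1: "algebraic_of_degree x 1 \<Longrightarrow> x \<in> \<rat>"
proof -
  assume "algebraic_of_degree x 1"
  then obtain p :: "rat poly" where p: "lead_coeff p = 1" "degree p = 1" "poly (map_poly of_rat p) x = 0"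
    unfolding algebraic_of_degree_def by blast
  have "of_rat (coeff p 0) + x = 0"
    using p map_poly_of_rat_degree_le_2[of p x] by (simp add: coeff_eq_0)
  then have "x = of_rat (- coeff p 0)" by (simp add: of_rat_minus eq_neg_iff_add_eq_0 add.commute)
  then show ?thesis by simp
qed

lemma algebraic_of_degree_2:
  assumes "algebraic_of_degree x 2"
  obtains b c where "x \<notin> \<rat>" "x\<^sup>2 = b * x + c" "b \<in> \<rat>" "c \<in> \<rat>"
proof -
  obtain p :: "rat poly" where p: "lead_coeff p = 1" "irreducible p" "degree p = 2" "poly (map_poly of_rat p) x = 0"
    using assms unfolding algebraic_of_degree_def by blast
  have 0: "of_rat (coeff p 0) + of_rat (coeff p 1) * x + x\<^sup>2 = 0"
    using p map_poly_of_rat_degree_le_2[of p x] by simp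
  have "x\<^sup>2 = (of_rat (coeff p 0) + of_rat (coeff p 1) * x + x\<^sup>2) - of_rat (coeff p 1) * x - of_rat (coeff p 0)" by simp
  then have "x\<^sup>2 = of_rat (- coeff p 1) * x + of_rat (- coeff p 0)" unfolding 0 by (simp add: of_rat_minus)
  moreover have irr: "x \<notin> \<rat>"
  proof
    assume "x \<in> \<rat>"
    then obtain r where r: "x = of_rat r" by (auto elim: Rats_cases)
    have "of_rat (poly p r) = poly (map_poly of_rat p) (of_rat r :: complex)"
      by (induction p) (simp_all add: map_poly_pCons of_rat_add of_rat_mult)
    then have "(of_rat (poly p r) :: complex) = 0" using p(4) unfolding r by simp
    then have "poly p r = 0" by simp
    then have "[:- r, 1:] dvd p" by (simp add: poly_eq_0_iff_dvd)
    then obtain k where k: "p = [:- r, 1:] * k" by (elim dvdE)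
    have "k \<noteq> 0" using k p(3) by auto
    then have "degree p = 1 + degree k" unfolding k by (subst degree_mult_eq) auto
    then have "degree k = 1" using p(3) by simp
    moreover have "is_unit [:- r, 1:] \<or> is_unit k" using Factorial_Ring.irreducibleD[OF p(2) k] .
    ultimately show False by (auto simp: is_unit_poly_iff)
  qed
  ultimately show ?thesis by (intro that[OF _ _ Rats_of_rat Rats_of_rat])
qed

section \<open>The condition on the exponent\<close>

lemma q_seriesI:
  assumes "norm q > 1" "\<alpha> \<noteq> 0" "l \<notin> pos_powers q" "\<alpha> \<notin> {- l * x | x. x \<in> pos_powers q}"
  shows "q_series q \<alpha> l"
proof -
  have p: "q ^ k \<in> pos_powers q" if "0 < k" for k
    unfolding pos_powers_def mem_Collect_eq using that by (intro exI[of _ "int k"]) simp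
  show ?thesis
  proof
    fix k :: nat assume k: "0 < k"
    show "l \<noteq> q ^ k" using p[OF k] assms(3) by blast
    show "\<alpha> \<noteq> - (l * q ^ k)"
    proof
      assume "\<alpha> = - (l * q ^ k)"
      then have "\<alpha> = - l * q ^ k" by simp
      then show False using p[OF k] assms(4) by blast
    qed
  qed (use assms in auto)
qed

text \<open>If \<open>q\<close> is an integer, it is written with denominator \<open>1\<close>: the term with \<open>ln \<bar>s\<bar>\<close> vanishes and positivity of
  \<open>jconst\<close> suffices. Otherwise \<open>\<bar>\<sigma>\<bar> \<ge> 2\<close>, and the inequality for the exponent is multiplied by \<open>ln \<bar>\<sigma>\<bar>\<close>.\<close>
lemma log_ratio_gap:
  fixes q :: complex
  assumes \<rho>: "\<rho> \<noteq> 0" and \<sigma>: "\<sigma> \<noteq> 0" and q: "q = of_int \<rho> / of_int \<sigma>" "norm q > 1"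
    and gt: "log_ratio \<rho> \<sigma> > ereal (if l = (0::complex) then (7 / 6) / (1 / 4 + 2 * jconst) else 1 / (2 * jconst))"
    and a: "a = (if l = 0 then 5 / 24 else 1 / 6)"
  obtains r s where "s \<noteq> (0::int)" "q = of_int r / of_int s"
    "2 * (2 / 3 - (a + jconst)) * ln \<bar>real_of_int s\<bar> < (2 * (a + jconst) - (if l = 0 then 1 / 6 else 1 / 3)) * ln (norm q)"
proof (cases "q \<in> \<int>")
  case True
  then obtain m where m: "q = of_int m" by (rule Ints_cases)
  have "0 < ln (norm q)" using q(2) by (rule ln_gt_zero)
  moreover have "0 < 2 * (a + jconst) - (if l = 0 then 1 / 6 else 1 / 3)" unfolding a using jconst_pos by simp
  ultimately have "0 < (2 * (a + jconst) - (if l = 0 then 1 / 6 else 1 / 3)) * ln (norm q)" by (rule mult_pos_pos[rotated])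
  then show ?thesis by (intro that[of 1 m]) (simp_all add: m)
next
  case False
  define R S where "R = ln \<bar>real_of_int \<rho>\<bar>" and "S = ln \<bar>real_of_int \<sigma>\<bar>"
  have "\<sigma> \<noteq> 1"
  proof
    assume "\<sigma> = 1"
    then have "q = of_int \<rho>" unfolding q(1) by simp
    then show False using False by (simp only: Ints_of_int not_True_eq_False)
  qed
  moreover have "\<sigma> \<noteq> - 1"
  proof
    assume "\<sigma> = - 1"
    then have "q = of_int (- \<rho>)" unfolding q(1) by simp
    then show False using False by (simp only: Ints_of_int not_True_eq_False)
  qed
  ultimately have "2 \<le> \<bar>\<sigma>\<bar>" using \<sigma> by linarith
  then have "1 < \<bar>real_of_int \<sigma>\<bar>" by linarith
  then have S: "0 < S" unfolding S_def by (rule ln_gt_zero)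
  have "norm q = \<bar>real_of_int \<rho>\<bar> / \<bar>real_of_int \<sigma>\<bar>" unfolding q(1) by (simp add: norm_divide)
  then have nq: "ln (norm q) = R - S" unfolding R_def S_def using \<rho> \<sigma> by (simp add: ln_div)
  have lr: "log_ratio \<rho> \<sigma> = ereal (R / S)" using False unfolding log_ratio_def q(1) R_def S_def by simp
  have clear: "c * S < R * y" if "c / y < R / S" "0 < y" for c y
  proof -
    have "c < R / S * y" using that by (simp only: pos_divide_less_eq)
    then have "c * S < R / S * y * S" using S by (rule mult_strict_right_mono)
    also have "\<dots> = R * y" using S by simp
    finally show ?thesis .
  qed
  have "2 * (2 / 3 - (a + jconst)) * S < (2 * (a + jconst) - (if l = 0 then 1 / 6 else 1 / 3)) * (R - S)"
  proof (cases "l = 0")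
    case True
    define y where "y = 1 / 4 + 2 * jconst"
    have "7 / 6 * S < R * y"
      by (rule clear) (use gt True jconst_pos in \<open>simp_all add: lr y_def\<close>)
    moreover have "2 * (2 / 3 - (5 / 24 + jconst)) * S = 7 / 6 * S - y * S"
      "(2 * (5 / 24 + jconst) - 1 / 6) * (R - S) = R * y - y * S"
      unfolding y_def by (simp_all add: algebra_simps)
    moreover have "a = 5 / 24" "(if l = 0 then 1 / 6 else 1 / 3) = (1 / 6 :: real)" using a True by simp_all
    ultimately show ?thesis by (simp only: diff_strict_right_mono mult_1)
  next
    case False
    define y where "y = 2 * jconst"
    have "1 * S < R * y"
      by (rule clear) (use gt False jconst_pos in \<open>simp_all add: lr y_def\<close>)
    moreover have "2 * (2 / 3 - (1 / 6 + jconst)) * S = S - y * S"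
      "(2 * (1 / 6 + jconst) - 1 / 3) * (R - S) = R * y - y * S"
      unfolding y_def by (simp_all add: algebra_simps)
    moreover have "a = 1 / 6" "(if l = 0 then 1 / 6 else 1 / 3) = (1 / 3 :: real)" using a False by simp_all
    ultimately show ?thesis by (simp only: diff_strict_right_mono mult_1)
  qed
  note gap = this
  show ?thesis by (rule that[OF \<sigma> q(1)]) (unfold nq S_def[symmetric], rule gap)
qed

theorem theorem1:
  fixes \<rho> \<sigma> :: int and q \<alpha> l :: complex and \<gamma> :: ereal
  assumes "\<rho> \<noteq> 0" and "\<sigma> \<noteq> 0"
    and "q = of_int \<rho> / of_int \<sigma>" and "norm q > 1"
    and "\<alpha> \<noteq> 0"
    and "l \<notin> pos_powers q"
    and "\<alpha> \<notin> {- l * x | x. x \<in> pos_powers q}"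
    and "\<gamma> = log_ratio \<rho> \<sigma>"
    and "\<gamma> > ereal (if l = 0
        then 126 * pi\<^sup>2 / (47 * pi\<^sup>2 - 72 * sqrt 3 * Im (Li2 (exp (2 * of_real pi * \<i> / 3))))
        else 27 * pi\<^sup>2 / (5 * pi\<^sup>2 - 18 * sqrt 3 * Im (Li2 (exp (2 * of_real pi * \<i> / 3)))))"
  shows "(\<nexists>K. quadratic_extension K \<and> \<alpha> \<in> K \<and> l \<in> K \<and> F q \<alpha> l \<in> K) \<and>
    (\<alpha> \<in> \<rat> \<and> l \<in> \<rat> \<longrightarrow>
       \<not> algebraic_of_degree (F q \<alpha> l) 1 \<and> \<not> algebraic_of_degree (F q \<alpha> l) 2)"
proof -
  have ser: "q_series q \<alpha> l" using assms(4-7) by (rule q_seriesI)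
  obtain r s where rs: "s \<noteq> (0::int)" "q = of_int r / of_int s"
    and gap: "2 * (2 / 3 - ((if l = 0 then 5 / 24 else 1 / 6) + jconst)) * ln \<bar>real_of_int s\<bar>
      < (2 * ((if l = 0 then 5 / 24 else 1 / 6) + jconst) - (if l = 0 then 1 / 6 else 1 / 3)) * ln (norm q)"
    by (rule log_ratio_gap[OF assms(1-4) assms(9)[unfolded assms(8) threshold_eq] refl])
  have main: False if surd: "quadratic_surd \<theta> D"
    and c: "\<exists>a\<in>\<rat>. \<exists>b\<in>\<rat>. \<alpha> = a + b * \<theta>" "\<exists>a\<in>\<rat>. \<exists>b\<in>\<rat>. l = a + b * \<theta>" "\<exists>a\<in>\<rat>. \<exists>b\<in>\<rat>. F q \<alpha> l = a + b * \<theta>" for \<theta> D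
  proof -
    obtain a1 a2 where a: "a1 \<in> \<rat>" "a2 \<in> \<rat>" "\<alpha> = a1 + a2 * \<theta>" using c(1) by blast
    obtain l1 l2 where l: "l1 \<in> \<rat>" "l2 \<in> \<rat>" "l = l1 + l2 * \<theta>" using c(2) by blast
    obtain m1 m2 where m: "m1 \<in> \<rat>" "m2 \<in> \<rat>" "F q \<alpha> l = m1 + m2 * \<theta>" using c(3) by blast
    show False
      by (rule no_quadratic_coordinates[OF surd ser rs(2,1) a(3) l(3) m(3) a(1,2) l(1,2) m(1,2) refl jset_sum_tendsto gap])
  qed
  have rational: "\<exists>a\<in>\<rat>. \<exists>b\<in>\<rat>. x = a + b * \<theta>" if "x \<in> \<rat>" for x \<theta> :: complex
    by (rule bexI[OF _ that], rule bexI[of _ 0]) simp_all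
  show ?thesis
  proof (intro conjI impI notI)
    assume "\<exists>K. quadratic_extension K \<and> \<alpha> \<in> K \<and> l \<in> K \<and> F q \<alpha> l \<in> K"
    then obtain K where K: "quadratic_extension K" "\<alpha> \<in> K" "l \<in> K" "F q \<alpha> l \<in> K" by blast
    obtain \<theta> D where th: "quadratic_surd \<theta> D" "\<forall>x\<in>K. \<exists>a\<in>\<rat>. \<exists>b\<in>\<rat>. x = a + b * \<theta>"
      by (rule quadratic_extension_coordinates[OF K(1)])
    show False by (rule main[OF th(1) bspec[OF th(2) K(2)] bspec[OF th(2) K(3)] bspec[OF th(2) K(4)]])
  next
    assume r: "\<alpha> \<in> \<rat> \<and> l \<in> \<rat>" and "algebraic_of_degree (F q \<alpha> l) 1"
    then have "F q \<alpha> l \<in> \<rat>" by (intro algebraic_of_degree_1)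
    then show False using r by (elim conjE) (rule main[OF quadratic_surd_i rational rational rational])
  next
    assume r: "\<alpha> \<in> \<rat> \<and> l \<in> \<rat>" and "algebraic_of_degree (F q \<alpha> l) 2"
    then obtain b c where bc: "F q \<alpha> l \<notin> \<rat>" "(F q \<alpha> l)\<^sup>2 = b * F q \<alpha> l + c" "b \<in> \<rat>" "c \<in> \<rat>"
      by (elim algebraic_of_degree_2)
    obtain \<theta> D u v where th: "quadratic_surd \<theta> D" "u \<in> \<rat>" "v \<in> \<rat>" "F q \<alpha> l = u + v * \<theta>"
      by (rule quadratic_surd_coordinates[OF bc])
    show False
    proof (rule main[OF th(1) rational rational])
      show "\<alpha> \<in> \<rat>" "l \<in> \<rat>" using r by simp_all
      show "\<exists>a\<in>\<rat>. \<exists>b\<in>\<rat>. F q \<alpha> l = a + b * \<theta>"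
        by (rule bexI[OF _ th(2)], rule bexI[OF _ th(3)], rule th(4))
    qed
  qed
qed

end
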